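(* Let $H:\mathbb{R}^2\times\mathbb{R}^2\to\mathbb{R}$ be continuous with $y\mapsto H(y,p)$ $\mathbb{Z}^2$-periodic for each $p$, $\lim_{|p|\to\infty}H(y,p)=+\infty$ uniformly in $y$, and $p\mapsto H(y,p)$ convex for each $y$. Assume further that there is $k\ge1$ such that $H(y,\lambda p)=\lambda^kH(y,p)$ for all $\lambda\ge0$, $y\in\mathbb{R}^2$, $p\in\mathbb{R}^2$. Let $g$ be bounded and Lipschitz continuous on $\mathbb{R}^2$. For $\varepsilon>0$ let $u^\varepsilon$ be the viscosity solution of $u^\varepsilon_t+H(x/\varepsilon,Du^\varepsilon)=0$ in $\mathbb{R}^2\times(0,\infty)$, $u^\varepsilon(\cdot,0)=g$, and let $u$ be the viscosity solution of $u_t+\overline H(Du)=0$ in $\mathbb{R}^2\times(0,\infty)$, $u(\cdot,0)=g$, where $\overline H$ is the effective Hamiltonian of $H$. Then there is a constant $C>0$ depending only on $H$ and $\|Dg\|_{L^\infty(\mathbb{R}^2)}$ such that for every $\varepsilon>0$ $$|u^\varepsilon(x,t)-u(x,t)|\le C\varepsilon\qquad\text{for all }(x,t)\in\mathbb{R}^2\times[0,\infty).$$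
   Context: $\mathbb{T}^2=\mathbb{R}^2/\mathbb{Z}^2$. The effective Hamiltonian $\overline H:\mathbb{R}^2\to\mathbb{R}$: for each $p\in\mathbb{R}^2$, $\overline H(p)$ is the unique constant such that the cell problem $H(y,p+Dv)=\overline H(p)$ in $\mathbb{T}^2$ has a continuous ($\mathbb{Z}^2$-periodic) viscosity solution $v$. "The viscosity solution" of each Cauchy problem means the unique viscosity solution that is Lipschitz continuous on $\mathbb{R}^2\times[0,\infty)$. *)

theory Defs
  imports
    "HOL-Analysis.Analysis"
    "HOL-Probability.Essential_Supremum"
begin

definition gradient :: "('a::real_inner \<Rightarrow> real) \<Rightarrow> 'a \<Rightarrow> 'a" where
  "gradient f x = (THE D. GDERIV f x :> D)"

lemma gradient_eqI:
  assumes "GDERIV f x :> D"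
  shows "gradient f x = D"
  unfolding gradient_def
proof (rule the_equality)
  show "GDERIV f x :> D" by (rule assms)
next
  fix E assume "GDERIV f x :> E"
  then have "(\<lambda>h. h \<bullet> E) = (\<lambda>h. h \<bullet> D)"
    using assms has_derivative_unique unfolding gderiv_def by blast
  then have "(E - D) \<bullet> E = (E - D) \<bullet> D" by meson
  then have "(E - D) \<bullet> (E - D) = 0" by (simp add: inner_diff_right)
  then show "E = D" by simp
qed

text \<open>The norm of \<open>Dg\<close> in \<open>L\<^sup>\<infinity>\<close>, meant for Lipschitz functions, which are
  differentiable almost everywhere (Rademacher). At the remaining points \<open>gradient g\<close> is one fixed
  unspecified vector, so they influence neither measurability nor the essential supremum.\<close>

definition Linf_norm_gradient :: "('a::euclidean_space \<Rightarrow> real) \<Rightarrow> ereal" where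
  "Linf_norm_gradient g = esssup lebesgue (\<lambda>x. ereal (norm (gradient g x)))"

definition C1_on :: "'a::euclidean_space set \<Rightarrow> ('a \<Rightarrow> real) \<Rightarrow> bool" where
  "C1_on \<Omega> \<phi> \<longleftrightarrow> (\<forall>z\<in>\<Omega>. \<phi> differentiable (at z)) \<and> continuous_on \<Omega> (gradient \<phi>)"

text \<open>Continuous viscosity solutions of \<open>F z (Dw z) = 0\<close> in an open set \<open>\<Omega>\<close>. For evolution equations
  the variable is \<open>z = (x, t)\<close> and the full gradient is \<open>(Dw, w\<^sub>t)\<close>.\<close>

definition viscosity_subsolution ::
    "('a::euclidean_space \<Rightarrow> 'a \<Rightarrow> real) \<Rightarrow> 'a set \<Rightarrow> ('a \<Rightarrow> real) \<Rightarrow> bool" where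
  "viscosity_subsolution F \<Omega> w \<longleftrightarrow> continuous_on \<Omega> w \<and>
     (\<forall>\<phi>. \<forall>z\<in>\<Omega>. C1_on \<Omega> \<phi> \<and> (\<forall>\<^sub>F z' in nhds z. w z' - \<phi> z' \<le> w z - \<phi> z)
        \<longrightarrow> F z (gradient \<phi> z) \<le> 0)"

definition viscosity_supersolution ::
    "('a::euclidean_space \<Rightarrow> 'a \<Rightarrow> real) \<Rightarrow> 'a set \<Rightarrow> ('a \<Rightarrow> real) \<Rightarrow> bool" where
  "viscosity_supersolution F \<Omega> w \<longleftrightarrow> continuous_on \<Omega> w \<and>
     (\<forall>\<phi>. \<forall>z\<in>\<Omega>. C1_on \<Omega> \<phi> \<and> (\<forall>\<^sub>F z' in nhds z. w z' - \<phi> z' \<ge> w z - \<phi> z)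
        \<longrightarrow> F z (gradient \<phi> z) \<ge> 0)"

definition viscosity_solution ::
    "('a::euclidean_space \<Rightarrow> 'a \<Rightarrow> real) \<Rightarrow> 'a set \<Rightarrow> ('a \<Rightarrow> real) \<Rightarrow> bool" where
  "viscosity_solution F \<Omega> w \<longleftrightarrow> viscosity_subsolution F \<Omega> w \<and> viscosity_supersolution F \<Omega> w"

text \<open>Functions on the torus are represented by periodic functions on the plane.\<close>

definition Z2_periodic :: "(real^2 \<Rightarrow> 'b) \<Rightarrow> bool" where
  "Z2_periodic f \<longleftrightarrow> (\<forall>y z. (\<forall>i. z $ i \<in> \<int>) \<longrightarrow> f (y + z) = f y)"

definition cell_problem_solution ::
    "(real^2 \<Rightarrow> real^2 \<Rightarrow> real) \<Rightarrow> real^2 \<Rightarrow> real \<Rightarrow> (real^2 \<Rightarrow> real) \<Rightarrow> bool" where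
  "cell_problem_solution H p c v \<longleftrightarrow>
     continuous_on UNIV v \<and> Z2_periodic v \<and>
     viscosity_solution (\<lambda>y q. H y (p + q) - c) UNIV v"

definition effective_Hamiltonian :: "(real^2 \<Rightarrow> real^2 \<Rightarrow> real) \<Rightarrow> real^2 \<Rightarrow> real" where
  "effective_Hamiltonian H p = (THE c. \<exists>v. cell_problem_solution H p c v)"

text \<open>Lipschitz viscosity solutions of \<open>u\<^sub>t + K x (Du) = 0\<close> for positive times with initial value \<open>g\<close>;
  values of \<open>u\<close> at negative times play no role.\<close>

definition Cauchy_solution ::
    "(real^2 \<Rightarrow> real^2 \<Rightarrow> real) \<Rightarrow> (real^2 \<Rightarrow> real) \<Rightarrow> ((real^2) \<times> real \<Rightarrow> real) \<Rightarrow> bool" where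
  "Cauchy_solution K g u \<longleftrightarrow>
     (\<exists>L. L-lipschitz_on (UNIV \<times> {0..}) u) \<and>
     (\<forall>x. u (x, 0) = g x) \<and>
     viscosity_solution (\<lambda>(x, t) (q, a). a + K x q) (UNIV \<times> {0<..}) u"

end

theory Submission
  imports Defs
begin

text \<open>After rescaling, \<open>\<epsilon> = 1\<close>. Put \<open>F = H\<^bsup>1/k\<^esup>\<close>, which is convex, coercive and positively homogeneous
  of degree one in \<open>p\<close>. Both Cauchy problems are solved by a Hopf--Lax formula
  \<open>inf\<^sub>y g y + P t (d y x)\<close> in which the Hamiltonian enters only through a distance \<open>d\<close>: the Finsler
  distance whose unit speeds are dual to \<open>F\<close> for the oscillating problem, and its stable norm for
  the effective one. The conjugate \<open>P\<close> of \<open>f \<mapsto> f\<^sup>k\<close> may be restricted to slopes \<open>f \<le> A\<close> with \<open>A\<close>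
  proportional to the Lipschitz constant of \<open>g\<close>, and is then \<open>A\<close>-Lipschitz in the distance. So the
  theorem follows once the two distances differ by a bounded amount. That is a planar fact: every
  path from \<open>0\<close> to \<open>2 v\<close> contains a piece with increment \<open>v\<close>, hence \<open>d 0 (2 v)\<close> and \<open>2 d 0 v\<close>
  differ by a constant. The effective Hamiltonian is the \<open>k\<close>-th power of the dual of the stable norm,
  because a Busemann function of \<open>d\<close> is a corrector. Rademacher's theorem turns the bound on
  \<open>\<parallel>Dg\<parallel>\<^sub>\<infinity>\<close> into a Lipschitz constant.\<close>

section \<open>Half chords of planar paths\<close>

text \<open>Periodicity and the triangle inequality bound \<open>distance 0 (2 *\<^sub>R v)\<close>
  by \<open>2 * distance 0 v\<close> up to a constant. The reverse bound, with an error independent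
  of \<open>v\<close>, is the hard half, and the half chord supplies it. Dyadic iteration sums the
  errors to a constant. Truncating the slopes at \<open>A\<close> must not change the equation.
  Where a test function touches the value function from above, a slope beyond \<open>A\<close> is
  impossible. Where one touches from below, such a slope is harmless, because the value function
  decreases in time at a rate of at most \<open>(M / c) powr k\<close>. Rectifiable curves are
  avoided: the distance is an infimum over polygonal chains, and a path is only remembered through
  the distances between its points. Geodesics may fail to exist, so every use of one carries an
  error. A bound on the gradient that holds almost everywhere says nothing on a single segment,
  which is a null set of the plane. It is integrated over thin rectangles instead, and this requires
  differentiability almost everywhere.\<close>

lemma continuous_exp_const_imp_const:
  fixes h :: "real \<Rightarrow> complex"
  assumes h: "continuous_on {0..1} h" and e: "\<And>s. s \<in> {0..1} \<Longrightarrow> exp (h s) = c"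
  shows "h 0 = h 1"
proof -
  \<comment> \<open>The values lie in one coset of the integer multiples of 2 pi i, whose distinct
    points are at least 1 apart.\<close>
  have "h constant_on {0..1}"
  proof (rule continuous_discrete_range_constant[OF _ h])
    show "connected {0..1::real}" by simp
    fix x assume x: "x \<in> {0..1::real}"
    show "\<exists>e>0. \<forall>y. y \<in> {0..1} \<and> h y \<noteq> h x \<longrightarrow> e \<le> norm (h y - h x)"
    proof (intro exI[of _ 1] conjI allI impI)
      fix y assume y: "y \<in> {0..1} \<and> h y \<noteq> h x"
      then have "exp (h y) = exp (h x)" using e x by simp
      then obtain n :: int where n: "h y = h x + of_real (of_int (2 * n) * pi) * \<i>"
        using exp_eq by blast
      then have "n \<noteq> 0" using y by auto
      then have "1 \<le> \<bar>real_of_int n\<bar>" by linarith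
      moreover have "norm (h y - h x) = 2 * \<bar>real_of_int n\<bar> * pi"
        by (simp add: n norm_mult)
      ultimately show "1 \<le> norm (h y - h x)"
        using pi_gt3 mult_mono[of 1 "\<bar>real_of_int n\<bar>" 1 pi] by simp
    qed simp
  qed
  then show ?thesis unfolding constant_on_def by auto
qed

text \<open>Without such a chord, \<open>(a, b) \<mapsto> \<gamma> b - \<gamma> a - (\<gamma> 1 - \<gamma> 0) / 2\<close> has a continuous logarithm on the
  triangle \<open>0 \<le> a \<le> b \<le> 1\<close>. The function is constant on the diagonal and takes opposite
  values at \<open>(0, s)\<close> and \<open>(s, 1)\<close>, so the logarithm would have to increase by twice an odd
  multiple of \<open>\<i> \<pi>\<close> between the ends of the diagonal.\<close>

lemma half_chord_complex:
  fixes \<gamma> :: "real \<Rightarrow> complex"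
  assumes c: "continuous_on {0..1} \<gamma>"
  shows "\<exists>a b. 0 \<le> a \<and> a \<le> b \<and> b \<le> 1 \<and> 2 * (\<gamma> b - \<gamma> a) = \<gamma> 1 - \<gamma> 0"
proof (rule ccontr)
  assume no: "\<not> ?thesis"
  define T where "T = {p::real\<times>real. 0 \<le> fst p \<and> fst p \<le> snd p \<and> snd p \<le> 1}"
  define f where "f = (\<lambda>p. 2 * (\<gamma> (snd p) - \<gamma> (fst p)) - (\<gamma> 1 - \<gamma> 0))"
  have "convex T"
  proof (rule convexI)
    fix x y :: "real \<times> real" and u v :: real
    assume "x \<in> T" "y \<in> T" "0 \<le> u" "0 \<le> v" "u + v = 1"
    then have *: "0 \<le> u * fst x" "0 \<le> v * fst y" "u * fst x \<le> u * snd x" "v * fst y \<le> v * snd y"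
      "u * snd x \<le> u" "v * snd y \<le> v"
      by (auto simp: T_def mult_left_mono mult_left_le)
    then show "u *\<^sub>R x + v *\<^sub>R y \<in> T"
      using \<open>u + v = 1\<close> by (simp add: T_def)
  qed
  then have T: "contractible T" by (rule convex_imp_contractible)
  have f: "continuous_on T f"
    unfolding f_def by (intro continuous_intros continuous_on_compose2[OF c]) (auto simp: T_def)
  have "f z \<noteq> 0" if "z \<in> T" for z
    using no that by (auto simp: T_def f_def)
  then obtain g where g: "continuous_on T g" and fg: "\<And>z. z \<in> T \<Longrightarrow> f z = exp (g z)"
    using continuous_logarithm_on_contractible[OF f T] by metis
  have 1: "g (0, 0) = g (1, 1)"
    by (rule continuous_exp_const_imp_const[of "\<lambda>s. g (s, s)" "- (\<gamma> 1 - \<gamma> 0)"])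
      (auto intro!: continuous_on_compose2[OF g] continuous_intros simp: fg[symmetric] T_def f_def)
  define h where "h = (\<lambda>s. g (s, 1) - g (0, s))"
  have eh: "exp (h s) = - 1" if "s \<in> {0..1}" for s
  proof -
    have m: "(s, 1) \<in> T" "(0, s) \<in> T" using that by (auto simp: T_def)
    have "f (s, 1) = - f (0, s)" by (simp add: f_def algebra_simps)
    moreover have "f (0, s) \<noteq> 0" using fg[OF m(2)] by simp
    ultimately show ?thesis by (simp add: h_def exp_diff fg[OF m(1), symmetric] fg[OF m(2), symmetric])
  qed
  have "h 0 = h 1"
    by (rule continuous_exp_const_imp_const[OF _ eh])
      (auto simp: h_def T_def intro!: continuous_on_compose2[OF g] continuous_intros)
  \<comment> \<open>The agreement of \<open>g\<close> at both ends of the diagonal gives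
    \<open>h 1 = - h 0\<close>; together with \<open>h 0 = h 1\<close> this leaves 0, whose
    exponential is not -1.\<close>
  with 1 have "h 0 = 0" by (simp add: h_def)
  with eh[of 0] show False by simp
qed

lemma half_chord:
  fixes \<gamma> :: "real \<Rightarrow> real^2"
  assumes c: "continuous_on {0..1} \<gamma>"
  obtains a b where "0 \<le> a" "a \<le> b" "b \<le> 1" "2 *\<^sub>R (\<gamma> b - \<gamma> a) = \<gamma> 1 - \<gamma> 0"
proof -
  have "continuous_on {0..1} (\<lambda>s. Complex (\<gamma> s $ 1) (\<gamma> s $ 2))"
    unfolding Complex_eq by (intro continuous_intros c)
  from half_chord_complex[OF this] obtain a b where ab: "0 \<le> a" "a \<le> b" "b \<le> 1"
    and e: "2 * (Complex (\<gamma> b $ 1) (\<gamma> b $ 2) - Complex (\<gamma> a $ 1) (\<gamma> a $ 2)) =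
      Complex (\<gamma> 1 $ 1) (\<gamma> 1 $ 2) - Complex (\<gamma> 0 $ 1) (\<gamma> 0 $ 2)" by blast
  have "2 *\<^sub>R (\<gamma> b - \<gamma> a) = \<gamma> 1 - \<gamma> 0"
    using e by (simp add: vec_eq_iff forall_2 complex_eq_iff)
  with ab show thesis by (rule that)
qed

section \<open>Comparison of Lipschitz viscosity solutions\<close>

lemma C1_onI:
  assumes "\<And>z. z \<in> \<Omega> \<Longrightarrow> GDERIV \<phi> z :> G z" and "continuous_on \<Omega> G"
  shows "C1_on \<Omega> \<phi>"
proof -
  have "continuous_on \<Omega> (gradient \<phi>) = continuous_on \<Omega> G"
    using assms(1) by (intro continuous_on_cong) (auto intro: gradient_eqI)
  then show ?thesis
    using assms by (auto simp: C1_on_def gderiv_def differentiable_def)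
qed

lemma viscosity_subsolution_test:
  "viscosity_subsolution F \<Omega> w \<Longrightarrow> C1_on \<Omega> \<phi> \<Longrightarrow> z \<in> \<Omega> \<Longrightarrow>
    \<forall>\<^sub>F z' in nhds z. w z' - \<phi> z' \<le> w z - \<phi> z \<Longrightarrow> F z (gradient \<phi> z) \<le> 0"
  unfolding viscosity_subsolution_def by blast

lemma viscosity_supersolution_test:
  "viscosity_supersolution F \<Omega> w \<Longrightarrow> C1_on \<Omega> \<phi> \<Longrightarrow> z \<in> \<Omega> \<Longrightarrow>
    \<forall>\<^sub>F z' in nhds z. w z' - \<phi> z' \<ge> w z - \<phi> z \<Longrightarrow> F z (gradient \<phi> z) \<ge> 0"
  unfolding viscosity_supersolution_def by blast

lemma viscosity_subsolutionD:
  assumes "viscosity_subsolution F \<Omega> w" "z \<in> \<Omega>"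
    and "\<And>z. GDERIV \<phi> z :> G z" "continuous_on \<Omega> G"
    and "\<forall>\<^sub>F z' in nhds z. w z' - \<phi> z' \<le> w z - \<phi> z"
  shows "F z (G z) \<le> 0"
  using assms C1_onI[OF assms(3,4)] gradient_eqI[OF assms(3)]
  unfolding viscosity_subsolution_def by metis

lemma viscosity_supersolutionD:
  assumes "viscosity_supersolution F \<Omega> w" "z \<in> \<Omega>"
    and "\<And>z. GDERIV \<phi> z :> G z" "continuous_on \<Omega> G"
    and "\<forall>\<^sub>F z' in nhds z. w z' - \<phi> z' \<ge> w z - \<phi> z"
  shows "F z (G z) \<ge> 0"
  using assms C1_onI[OF assms(3,4)] gradient_eqI[OF assms(3)]
  unfolding viscosity_supersolution_def by metis

lemma GDERIV_norm_diff_sq: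
  fixes c :: "'a::real_inner"
  shows "GDERIV (\<lambda>z. a * (norm (z - c))\<^sup>2) z :> (2 * a) *\<^sub>R (z - c)"
  unfolding gderiv_def power2_norm_eq_inner
  by (auto intro!: derivative_eq_intros simp: inner_commute algebra_simps)

text \<open>Completing the square. The quadratic penalty of a doubling of variables absorbs a
  Lipschitz increment at a price that is linear in \<open>\<delta>\<close>.\<close>

lemma parabola_bound:
  fixes M r \<delta> :: real
  assumes "\<delta> > 0"
  shows "M * r - r\<^sup>2 / (2 * \<delta>) \<le> M\<^sup>2 * \<delta> / 2"
proof -
  have "0 \<le> (M * \<delta> - r)\<^sup>2" by simp
  then have "2 * \<delta> * (M * r) - r\<^sup>2 \<le> M\<^sup>2 * \<delta>\<^sup>2" by (simp add: power2_eq_square algebra_simps)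
  then have "(2 * \<delta> * (M * r) - r\<^sup>2) / (2 * \<delta>) \<le> M\<^sup>2 * \<delta>\<^sup>2 / (2 * \<delta>)"
    by (rule divide_right_mono) (use assms in simp)
  then show ?thesis using assms by (simp add: power2_eq_square field_simps)
qed

text \<open>Doubling of variables in space-time. The Lipschitz bounds keep the penalty gradients in
  a ball of radius \<open>2 * M\<close>, so uniform continuity of \<open>K\<close> for bounded
  momenta suffices. Space is unbounded and a supremum may not be attained; a small localization
  around a nearly maximal pair repairs this.\<close>

theorem Lipschitz_comparison:
  fixes w1 w2 :: "'a::euclidean_space \<times> real \<Rightarrow> real"
  assumes uc: "\<And>R. uniformly_continuous_on (UNIV \<times> cball 0 R) (\<lambda>(x, p). K x p)"
    and L1: "M-lipschitz_on (UNIV \<times> {0..}) w1" and L2: "M-lipschitz_on (UNIV \<times> {0..}) w2"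
    and sub: "viscosity_subsolution (\<lambda>(x, t) (q, a). a + K x q) (UNIV \<times> {0<..}) w1"
    and super: "viscosity_supersolution (\<lambda>(x, t) (q, a). a + K x q) (UNIV \<times> {0<..}) w2"
    and init: "\<And>x. w1 (x, 0) \<le> w2 (x, 0)"
    and t: "t \<ge> 0"
  shows "w1 (x, t) \<le> w2 (x, t)"
proof (rule ccontr)
  assume "\<not> ?thesis"
  define \<sigma> where "\<sigma> = w1 (x, t) - w2 (x, t)"
  with \<open>\<not> ?thesis\<close> have \<sigma>: "\<sigma> > 0" by simp
  have M: "M \<ge> 0" using L1 by (rule lipschitz_on_nonneg)
  define Z where "Z = (UNIV \<times> {0..} :: ('a \<times> real) set)"
  have l1: "\<bar>w1 z - w1 w\<bar> \<le> M * norm (z - w)" and l2: "\<bar>w2 z - w2 w\<bar> \<le> M * norm (z - w)"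
    if "z \<in> Z" "w \<in> Z" for z w
    using lipschitz_onD[OF L1, of z w] lipschitz_onD[OF L2, of z w] that
    by (auto simp: Z_def dist_norm)
  have c1: "continuous_on Z w1" and c2: "continuous_on Z w2"
    using L1 L2 by (auto intro: lipschitz_on_continuous_on simp: Z_def)
  \<comment> \<open>The linear term gives the strict inequality with margin \<open>\<eta>\<close>;
    the quadratic term beats the growth \<open>2 * M * t\<close> and confines the maximum in
    time.\<close>
  define \<psi> where "\<psi> = (\<lambda>t::real. t + t\<^sup>2)"
  have \<psi>0: "\<psi> t \<ge> 0" if "t \<ge> 0" for t using that by (simp add: \<psi>_def)
  define \<eta> where "\<eta> = \<sigma> / (2 * (\<psi> t + 1))"
  have \<eta>: "\<eta> > 0" using \<sigma> \<psi>0[OF t] by (simp add: \<eta>_def add_nonneg_pos)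
  have \<eta>t: "\<eta> * \<psi> t \<le> \<sigma> / 2"
    using \<sigma> \<psi>0[OF t] by (simp add: \<eta>_def field_simps)
  obtain m where m: "m > 0" and mod: "\<And>x y p q. norm p \<le> 2 * M + 1 \<Longrightarrow> norm q \<le> 2 * M + 1 \<Longrightarrow>
      dist (x, p) (y, q) < m \<Longrightarrow> \<bar>K x p - K y q\<bar> < \<eta>"
  proof -
    obtain m where "m > 0" "\<And>z z'. z \<in> UNIV \<times> cball 0 (2 * M + 1) \<Longrightarrow>
        z' \<in> UNIV \<times> cball 0 (2 * M + 1) \<Longrightarrow> dist z z' < m \<Longrightarrow>
        dist ((\<lambda>(x, p). K x p) z) ((\<lambda>(x, p). K x p) z') < \<eta>"
      using uc[of "2 * M + 1"] \<eta> unfolding uniformly_continuous_on_def by (metis dist_commute)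
    from this(1) this(2)[of "(_,_)" "(_,_)"] show thesis by (intro that) (auto simp: dist_real_def)
  qed
  \<comment> \<open>The first bound keeps the doubled points within three quarters of the modulus
    \<open>m\<close>; the second makes the gain from doubling at most \<open>\<sigma> / 8\<close>,
    which keeps the maximum away from the initial time.\<close>
  define \<delta> where "\<delta> = min (m / (4 * M + 1)) (\<sigma> / (4 * (M\<^sup>2 + 1)))"
  have \<delta>: "\<delta> > 0" using m \<sigma> M by (simp add: \<delta>_def add_nonneg_pos)
  have "2 * M * \<delta> \<le> 2 * M * (m / (4 * M + 1))" using M by (intro mult_left_mono) (auto simp: \<delta>_def)
  also have "\<dots> < m / 2 + m / 4" using M m by (simp add: field_simps add_pos_nonneg)
  finally have \<delta>1: "2 * M * \<delta> < 3 * m / 4" by simp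
  have "M\<^sup>2 * \<delta> \<le> M\<^sup>2 * (\<sigma> / (4 * (M\<^sup>2 + 1)))" by (intro mult_left_mono) (auto simp: \<delta>_def)
  also have "\<dots> \<le> \<sigma> / 4"
  proof -
    have "0 < M\<^sup>2 + 1" by (simp add: add_nonneg_pos)
    then show ?thesis using \<sigma> by (simp add: pos_divide_le_eq)
  qed
  finally have \<delta>2: "M\<^sup>2 * \<delta> / 2 \<le> \<sigma> / 8" by linarith
  \<comment> \<open>The three bounds keep the near-maximum positive, keep the perturbed momentum in
    the ball of radius \<open>2 * M + 1\<close>, and leave the last quarter of \<open>m\<close> for
    the perturbation.\<close>
  define \<beta> where "\<beta> = min (min (\<sigma> / 4) (1 / 2)) (m / 8)"
  have \<beta>: "\<beta> > 0" "\<beta> \<le> \<sigma> / 4" "2 * \<beta> \<le> 1" "2 * \<beta> \<le> m / 4" using m \<sigma> by (auto simp: \<beta>_def)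
  define \<Phi> where "\<Phi> = (\<lambda>(z, w). w1 z - w2 w - (norm (z - w))\<^sup>2 / (2 * \<delta>) - \<eta> * \<psi> (snd z))"
  define C where "C = 2 * M\<^sup>2 / \<eta> + M\<^sup>2 * \<delta>"
  have \<Phi>_le: "\<Phi> (z, w) \<le> C - \<eta> / 2 * (snd z)\<^sup>2 - (norm (z - w))\<^sup>2 / (4 * \<delta>)"
    if z: "z \<in> Z" and w: "w \<in> Z" for z w
  proof -
    obtain x' t' where z': "z = (x', t')" "t' \<ge> 0" using z by (auto simp: Z_def)
    have m0: "(x', 0) \<in> Z" by (simp add: Z_def)
    have "w1 z \<le> w1 (x', 0) + M * t'" "w2 (x', 0) \<le> w2 z + M * t'"
      using l1[OF z m0] l2[OF m0 z] z' by (auto simp: norm_Pair)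
    then have "w1 z - w2 w \<le> 2 * M * t' + M * norm (z - w)"
      using init[of x'] l2[OF z w] by auto
    moreover have "2 * M * t' \<le> \<eta> / 2 * t'\<^sup>2 + 2 * M\<^sup>2 / \<eta>"
    proof -
      have "2 * M * t' - t'\<^sup>2 / (2 * (1 / \<eta>)) \<le> (2 * M)\<^sup>2 * (1 / \<eta>) / 2"
        by (rule parabola_bound) (use \<eta> in simp)
      then show ?thesis by (simp add: power2_eq_square field_simps)
    qed
    moreover have "M * norm (z - w) - (norm (z - w))\<^sup>2 / (2 * (2 * \<delta>)) \<le> M\<^sup>2 * (2 * \<delta>) / 2"
      by (rule parabola_bound) (use \<delta> in simp)
    moreover have "(norm (z - w))\<^sup>2 / (2 * \<delta>) = 2 * ((norm (z - w))\<^sup>2 / (4 * \<delta>))" by simp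
    moreover have "\<eta> * \<psi> t' = \<eta> * t' + 2 * (\<eta> / 2 * t'\<^sup>2)" by (simp add: \<psi>_def algebra_simps)
    moreover have "\<eta> * t' \<ge> 0" using \<eta> z' by simp
    ultimately show ?thesis by (simp add: \<Phi>_def C_def z'(1))
  qed
  have bdd: "bdd_above (\<Phi> ` (Z \<times> Z))"
  proof (rule bdd_aboveI2)
    fix p assume "p \<in> Z \<times> Z"
    moreover obtain z w where "p = (z, w)" by (cases p)
    ultimately have "\<Phi> p \<le> C - \<eta> / 2 * (snd z)\<^sup>2 - (norm (z - w))\<^sup>2 / (4 * \<delta>)" using \<Phi>_le by auto
    also have "\<dots> \<le> C"
    proof -
      have "0 \<le> \<eta> / 2 * (snd z)\<^sup>2" "0 \<le> (norm (z - w))\<^sup>2 / (4 * \<delta>)" using \<eta> \<delta> by auto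
      then show ?thesis by linarith
    qed
    finally show "\<Phi> p \<le> C" .
  qed
  define S where "S = Sup (\<Phi> ` (Z \<times> Z))"
  have \<Phi>S: "\<Phi> p \<le> S" if "p \<in> Z \<times> Z" for p
    using that bdd unfolding S_def by (intro cSup_upper) auto
  have "\<Phi> ((x, t), (x, t)) \<le> S" by (rule \<Phi>S) (use t in \<open>auto simp: Z_def\<close>)
  then have S: "\<sigma> / 2 \<le> S" using \<eta>t by (simp add: \<Phi>_def \<sigma>_def)
  have "Z \<times> Z \<noteq> {}" by (auto simp: Z_def)
  then obtain z0 w0 where zw0: "z0 \<in> Z" "w0 \<in> Z" "\<Phi> (z0, w0) > S - \<beta>"
  proof -
    have "\<exists>y\<in>\<Phi> ` (Z \<times> Z). S - \<beta> < y"
      using \<open>Z \<times> Z \<noteq> {}\<close> \<beta>(1) unfolding S_def by (intro less_cSupD) auto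
    then show thesis using that by auto
  qed
  \<comment> \<open>\<open>\<Phi>\<close> is within \<open>\<beta>\<close> of its supremum at
    \<open>(z0, w0)\<close>, so a pair at spatial distance 1 or more from \<open>z0\<close> cannot
    beat that pair for \<open>\<Psi>\<close>. This makes the superlevel set \<open>A\<close>
    compact.\<close>
  define \<Psi> where "\<Psi> = (\<lambda>p. \<Phi> p - \<beta> * (norm (fst (fst p) - fst z0))\<^sup>2)"
  define A where "A = {p \<in> Z \<times> Z. \<Psi> (z0, w0) \<le> \<Psi> p}"
  have \<Psi>0: "\<Psi> (z0, w0) > S - \<beta>" using zw0 by (simp add: \<Psi>_def)
  have clZ: "closed (Z \<times> Z)" by (auto simp: Z_def intro!: closed_Times)
  have contPsi: "continuous_on (Z \<times> Z) \<Psi>"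
    unfolding \<Psi>_def \<Phi>_def \<psi>_def split_beta
    by (intro continuous_intros continuous_on_compose2[OF c1] continuous_on_compose2[OF c2]) (use \<delta> in auto)
  have A_props: "norm (fst z - fst z0) \<le> 1 \<and> \<eta> / 2 * (snd z)\<^sup>2 \<le> C \<and> (norm (z - w))\<^sup>2 / (4 * \<delta>) \<le> C"
    if "(z, w) \<in> A" for z w
  proof -
    have zw: "z \<in> Z" "w \<in> Z" and g: "\<Psi> (z, w) > S - \<beta>" using that \<Psi>0 by (auto simp: A_def)
    have "\<beta> * (norm (fst z - fst z0))\<^sup>2 < \<beta>" using g \<Phi>S[of "(z, w)"] zw by (simp add: \<Psi>_def)
    then have "(norm (fst z - fst z0))\<^sup>2 < 1" using \<beta>(1) by simp
    then have "norm (fst z - fst z0) \<le> 1" using one_le_power[of "norm (fst z - fst z0)" 2] by linarith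
    moreover have "\<Phi> (z, w) \<ge> \<Psi> (z, w)" using \<beta>(1) by (simp add: \<Psi>_def)
    then have "0 < C - \<eta> / 2 * (snd z)\<^sup>2 - (norm (z - w))\<^sup>2 / (4 * \<delta>)"
      using \<Phi>_le[OF zw] g S \<beta>(2) \<sigma> by linarith
    moreover have "0 \<le> \<eta> / 2 * (snd z)\<^sup>2" "0 \<le> (norm (z - w))\<^sup>2 / (4 * \<delta>)" using \<eta> \<delta> by auto
    ultimately show ?thesis by linarith
  qed
  have "compact A"
    unfolding compact_eq_bounded_closed
  proof
    show "closed A" unfolding A_def
      using continuous_closed_preimage[OF contPsi clZ, of "{\<Psi> (z0, w0)..}"]
      by (simp add: vimage_def Int_def)
    have "norm z \<le> norm (fst z0) + 1 + sqrt (2 * C / \<eta>)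
       \<and> norm w \<le> norm (fst z0) + 1 + sqrt (2 * C / \<eta>) + sqrt (4 * \<delta> * C)" if "(z, w) \<in> A" for z w
    proof -
      note P = A_props[OF that]
      have "(snd z)\<^sup>2 \<le> 2 * C / \<eta>" using P \<eta> by (simp add: field_simps)
      then have 1: "\<bar>snd z\<bar> \<le> sqrt (2 * C / \<eta>)" by (metis real_sqrt_abs real_sqrt_le_iff)
      have "norm (fst z) \<le> norm (fst z0) + 1" using P norm_triangle_sub[of "fst z" "fst z0"] by simp
      then have 2: "norm z \<le> norm (fst z0) + 1 + sqrt (2 * C / \<eta>)"
        using 1 norm_Pair_le[of "fst z" "snd z"] by simp
      have "(norm (z - w))\<^sup>2 \<le> 4 * \<delta> * C" using P \<delta> by (simp add: field_simps)
      then have "norm (z - w) \<le> sqrt (4 * \<delta> * C)" by (rule real_le_rsqrt)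
      with 2 show ?thesis using norm_triangle_sub[of w z] by (simp add: norm_minus_commute)
    qed
    then have "\<forall>p\<in>A. norm (fst p) \<le> norm (fst z0) + 1 + sqrt (2 * C / \<eta>)
       \<and> norm (snd p) \<le> norm (fst z0) + 1 + sqrt (2 * C / \<eta>) + sqrt (4 * \<delta> * C)"
      by (metis prod.collapse)
    then have "bounded (fst ` A)" "bounded (snd ` A)"
      unfolding bounded_iff by blast+
    then show "bounded A"
      by (rule bounded_subset[OF bounded_Times]) force
  qed
  moreover have "(z0, w0) \<in> A" using zw0 by (simp add: A_def)
  moreover have "continuous_on A \<Psi>" by (rule continuous_on_subset[OF contPsi]) (auto simp: A_def)
  ultimately obtain p where p: "p \<in> A" "\<And>p'. p' \<in> A \<Longrightarrow> \<Psi> p' \<le> \<Psi> p"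
    using continuous_attains_sup[of A \<Psi>] by blast
  obtain z w where zw: "p = (z, w)" by (cases p)
  have zwZ: "z \<in> Z" "w \<in> Z" using p zw by (auto simp: A_def)
  have max: "\<Psi> (z', w') \<le> \<Psi> (z, w)" if "z' \<in> Z" "w' \<in> Z" for z' w'
    using p zw that by (cases "(z', w') \<in> A") (auto simp: A_def)
  have \<Psi>big: "\<Psi> (z, w) > \<sigma> / 8" using \<Psi>0 max[OF zw0(1,2)] S \<beta>(2) \<sigma> by linarith
  have \<Psi>small: "\<Psi> (z, w) \<le> w1 z - w2 w - (norm (z - w))\<^sup>2 / (2 * \<delta>)"
  proof -
    have "0 \<le> \<psi> (snd z)" using zwZ by (intro \<psi>0) (auto simp: Z_def)
    then have "0 \<le> \<eta> * \<psi> (snd z)" "0 \<le> \<beta> * (norm (fst z - fst z0))\<^sup>2" using \<beta>(1) \<eta> by auto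
    then show ?thesis by (simp add: \<Psi>_def \<Phi>_def)
  qed
  \<comment> \<open>If \<open>z\<close> or \<open>w\<close> were at time 0, the initial inequality
    and the Lipschitz bound of one function would contradict this.\<close>
  have noninit: "\<not> w1 z - w2 w \<le> M * norm (z - w)"
    using \<Psi>big \<Psi>small parabola_bound[OF \<delta>, of M "norm (z - w)"] \<delta>2 by linarith
  have sz: "snd z > 0"
  proof (rule ccontr)
    assume "\<not> ?thesis"
    then have "snd z = 0" using zwZ by (auto simp: Z_def)
    then have "w1 z \<le> w2 z" using init[of "fst z"] by (metis prod.collapse)
    then show False using noninit l2[OF zwZ] by auto
  qed
  have sw: "snd w > 0"
  proof (rule ccontr)
    assume "\<not> ?thesis"
    then have "snd w = 0" using zwZ by (auto simp: Z_def)
    then have "w1 w \<le> w2 w" using init[of "fst w"] by (metis prod.collapse)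
    then show False using noninit l1[OF zwZ] by auto
  qed
  \<comment> \<open>The maximum is compared with the diagonal pair \<open>(z, z)\<close>, where only
    the doubling penalty and the value of \<open>w2\<close> change.\<close>
  have r: "norm (z - w) \<le> 2 * M * \<delta>"
  proof (cases "norm (z - w) = 0")
    case False
    have "(norm (z - w))\<^sup>2 / (2 * \<delta>) \<le> M * norm (z - w)"
      using max[OF zwZ(1) zwZ(1)] l2[OF zwZ] by (simp add: \<Psi>_def \<Phi>_def)
    then have "norm (z - w) * norm (z - w) \<le> (2 * M * \<delta>) * norm (z - w)"
      using \<delta> by (simp add: power2_eq_square field_simps)
    then show ?thesis using False by (simp add: mult_le_cancel_right)
  qed (use M \<delta> in simp)
  have openZ: "open (UNIV \<times> {0<..} :: ('a \<times> real) set)" by (intro open_Times) auto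
  have evZ: "\<forall>\<^sub>F z' in nhds v. z' \<in> Z" if "snd v > 0" for v
    using openZ that eventually_nhds_in_open[OF openZ, of v]
    by (force simp: Z_def mem_Times_iff elim: eventually_mono)
  \<comment> \<open>The time and localization penalties are all placed on \<open>z\<close>; the
    doubling penalty has the same gradient in both tests and cancels on subtraction, apart from the
    argument of \<open>K\<close>.\<close>
  define \<phi>1 where "\<phi>1 = (\<lambda>z'. 1 / (2 * \<delta>) * (norm (z' - w))\<^sup>2 + (\<eta> * (snd z' + (snd z')\<^sup>2)
      + \<beta> * (norm (fst z' - fst z0))\<^sup>2))"
  define G1 where "G1 = (\<lambda>z'. (1 / \<delta>) *\<^sub>R (z' - w) + ((2 * \<beta>) *\<^sub>R (fst z' - fst z0), \<eta> * (1 + 2 * snd z')))"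
  have "GDERIV \<phi>1 z' :> G1 z'" for z'
  proof -
    have "GDERIV (\<lambda>z'. \<eta> * (snd z' + (snd z')\<^sup>2) + \<beta> * (norm (fst z' - fst z0))\<^sup>2) z' :>
        ((2 * \<beta>) *\<^sub>R (fst z' - fst z0), \<eta> * (1 + 2 * snd z'))"
      unfolding gderiv_def power2_norm_eq_inner
      by (auto intro!: derivative_eq_intros simp: fun_eq_iff inner_prod_def inner_commute algebra_simps)
    from GDERIV_add[OF GDERIV_norm_diff_sq[of "1 / (2 * \<delta>)" w z'] this]
    show ?thesis unfolding \<phi>1_def G1_def by simp
  qed
  moreover have "continuous_on (UNIV \<times> {0<..}) G1"
    unfolding G1_def by (intro continuous_intros)
  moreover have "\<forall>\<^sub>F z' in nhds z. w1 z' - \<phi>1 z' \<le> w1 z - \<phi>1 z"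
    using evZ[OF sz]
  proof eventually_elim
    case (elim z')
    from max[OF this zwZ(2)] show ?case by (simp add: \<Psi>_def \<Phi>_def \<phi>1_def \<psi>_def)
  qed
  ultimately have "(case z of (x, t) \<Rightarrow> \<lambda>(q, a). a + K x q) (G1 z) \<le> 0"
    using sz by (intro viscosity_subsolutionD[OF sub]) (auto simp: mem_Times_iff)
  then have 1: "(snd z - snd w) / \<delta> + \<eta> * (1 + 2 * snd z)
      + K (fst z) ((1 / \<delta>) *\<^sub>R (fst z - fst w) + (2 * \<beta>) *\<^sub>R (fst z - fst z0)) \<le> 0"
    by (simp add: G1_def split_beta)
  define \<phi>2 where "\<phi>2 = (\<lambda>w'. (- 1 / (2 * \<delta>)) * (norm (w' - z))\<^sup>2)"
  have "\<And>w'. GDERIV \<phi>2 w' :> (2 * (- 1 / (2 * \<delta>))) *\<^sub>R (w' - z)"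
    unfolding \<phi>2_def by (rule GDERIV_norm_diff_sq)
  moreover have "continuous_on (UNIV \<times> {0<..}) (\<lambda>w'. (2 * (- 1 / (2 * \<delta>))) *\<^sub>R (w' - z))"
    by (intro continuous_intros)
  moreover have "\<forall>\<^sub>F w' in nhds w. w2 w' - \<phi>2 w' \<ge> w2 w - \<phi>2 w"
    using evZ[OF sw]
  proof eventually_elim
    case (elim w')
    from max[OF zwZ(1) this] show ?case by (simp add: \<Psi>_def \<Phi>_def \<phi>2_def norm_minus_commute)
  qed
  ultimately have "(case w of (x, t) \<Rightarrow> \<lambda>(q, a). a + K x q) ((2 * (- 1 / (2 * \<delta>))) *\<^sub>R (w - z)) \<ge> 0"
    using sw by (intro viscosity_supersolutionD[OF super]) (auto simp: mem_Times_iff)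
  then have 2: "(snd z - snd w) / \<delta> + K (fst w) ((1 / \<delta>) *\<^sub>R (fst z - fst w)) \<ge> 0"
    by (simp add: split_beta scaleR_diff_right diff_divide_distrib)
  define p where "p = (1 / \<delta>) *\<^sub>R (fst z - fst w)"
  define e where "e = (2 * \<beta>) *\<^sub>R (fst z - fst z0)"
  have nxy: "norm (fst z - fst w) \<le> 2 * M * \<delta>"
    using r norm_fst_le[of "fst z - fst w" "snd z - snd w"] by (simp add: minus_prod_def)
  then have np: "norm p \<le> 2 * M"
    unfolding p_def norm_scaleR using \<delta> by (simp add: pos_divide_le_eq)
  have "norm (fst z - fst z0) \<le> 1" using A_props p zw by blast
  then have ne: "norm e \<le> 2 * \<beta>" using \<beta>(1) by (simp add: e_def)
  have "dist (fst w, p) (fst z, p + e) \<le> norm (fst w - fst z) + norm e"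
    using norm_Pair_le[of "fst w - fst z" "- e"] by (simp add: dist_norm)
  also have "\<dots> < m" using nxy ne \<delta>1 \<beta>(4) by (simp add: norm_minus_commute)
  finally have "\<bar>K (fst w) p - K (fst z) (p + e)\<bar> < \<eta>"
    using np ne \<beta>(3) norm_triangle_ineq[of p e] by (intro mod) auto
  moreover have "\<eta> * (1 + 2 * snd z) \<ge> \<eta>" using \<eta> sz by simp
  ultimately show False using 1 2 unfolding p_def[symmetric] e_def[symmetric] by linarith
qed

section \<open>The Hopf--Lax formula of a Finsler distance\<close>

lemma GDERIV_exists:
  fixes f :: "'a::euclidean_space \<Rightarrow> real"
  assumes "f differentiable (at z)"
  shows "GDERIV f z :> gradient f z"
proof -
  obtain f' where f': "(f has_derivative f') (at z)"
    using assms by (auto simp: differentiable_def)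
  then interpret bounded_linear f' by (rule has_derivative_bounded_linear)
  have "f' h = h \<bullet> (\<Sum>b\<in>Basis. f' b *\<^sub>R b)" for h
  proof -
    have "f' h = f' (\<Sum>b\<in>Basis. (h \<bullet> b) *\<^sub>R b)" by (simp add: euclidean_representation)
    also have "\<dots> = (\<Sum>b\<in>Basis. (h \<bullet> b) * f' b)" by (simp add: sum scaleR)
    finally show ?thesis by (simp add: inner_sum_right mult.commute)
  qed
  then have "f' = (\<lambda>h. h \<bullet> (\<Sum>b\<in>Basis. f' b *\<^sub>R b))" by (rule ext)
  then have "GDERIV f z :> (\<Sum>b\<in>Basis. f' b *\<^sub>R b)"
    using f' by (simp add: gderiv_def)
  then show ?thesis using gradient_eqI by metis
qed

lemma C1_on_first_order:
  fixes \<phi> :: "'a::euclidean_space \<Rightarrow> real"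
  assumes "C1_on \<Omega> \<phi>" "z \<in> \<Omega>" "e > 0"
  obtains r where "r > 0"
    "\<And>y. norm (y - z) < r \<Longrightarrow> \<bar>\<phi> y - \<phi> z - (y - z) \<bullet> gradient \<phi> z\<bar> \<le> e * norm (y - z)"
proof -
  have "(\<phi> has_derivative (\<lambda>h. h \<bullet> gradient \<phi> z)) (at z)"
    using assms(1,2) GDERIV_exists unfolding C1_on_def gderiv_def by blast
  then show thesis
    using assms(3) that unfolding has_derivative_at_alt by (metis real_norm_def)
qed

section \<open>Powers and their conjugates on a bounded range of slopes\<close>

lemma powr_above_tangent:
  fixes f F k :: real
  assumes "k \<ge> 1" "f \<ge> 0" "F \<ge> 0"
  shows "F powr k + k * F powr (k - 1) * (f - F) \<le> f powr k"
proof -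
  \<comment> \<open>Since \<open>0 powr 0 = 0\<close>, the slope at \<open>F = 0\<close> is 0 even
    for \<open>k = 1\<close>; it still supports the power on the half line. The case
    \<open>f = 0\<close> is separate because convexity is used on the open half line.\<close>
  consider "F = 0" | "F > 0" "f = 0" | "F > 0" "f > 0" using assms by linarith
  then show ?thesis
  proof cases
    case 2
    then have "F powr (k - 1) * F = F powr k" by (simp add: powr_mult_base mult.commute)
    moreover have "F powr k \<le> k * F powr k" using assms 2 by (simp add: mult_le_cancel_right1)
    ultimately show ?thesis using 2 by (simp add: algebra_simps)
  next
    case 3
    have "f powr k - F powr k \<ge> (k * F powr (k - 1)) * (f - F)"
      by (rule convex_on_imp_above_tangent[of "{0<..}"])
        (use 3 assms powr_convex[of k] in \<open>auto intro!: derivative_eq_intros simp: interior_open\<close>)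
    then show ?thesis by simp
  qed auto
qed

text \<open>Restricting the slopes to \<open>[0, A]\<close> keeps the supremum finite when \<open>k = 1\<close> and makes sense of the
  Hopf--Lax formula at \<open>t = 0\<close>, where it is \<open>A r\<close>.\<close>

definition truncated_action :: "real \<Rightarrow> real \<Rightarrow> real \<Rightarrow> real \<Rightarrow> real" where
  "truncated_action A k t r = (SUP f\<in>{0..A}. f * r - t * f powr k)"

context
  fixes A k :: real
  assumes A: "A > 0" and k: "k \<ge> 1"
begin

lemma truncated_action_upper:
  assumes "0 \<le> f" "f \<le> A"
  shows "f * r - t * f powr k \<le> truncated_action A k t r"
  unfolding truncated_action_def
proof (rule cSUP_upper)
  have "f * r - t * f powr k \<le> A * \<bar>r\<bar> + \<bar>t\<bar> * A powr k" if "f \<in> {0..A}" for f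
  proof -
    have "f * r \<le> A * \<bar>r\<bar>"
      using that mult_mono[of f A "\<bar>r\<bar>" "\<bar>r\<bar>"] mult_left_mono[of r "\<bar>r\<bar>" f, OF abs_ge_self] by simp
    moreover have "- t * f powr k \<le> \<bar>t\<bar> * A powr k"
      using that k by (intro mult_mono powr_mono2) auto
    ultimately show ?thesis by simp
  qed
  then show "bdd_above ((\<lambda>f. f * r - t * f powr k) ` {0..A})" by (rule bdd_aboveI2)
qed (use assms in auto)

lemma truncated_action_least:
  assumes "\<And>f. 0 \<le> f \<Longrightarrow> f \<le> A \<Longrightarrow> f * r - t * f powr k \<le> X"
  shows "truncated_action A k t r \<le> X"
  unfolding truncated_action_def using assms A by (intro cSUP_least) auto

lemma truncated_action_nonneg: "0 \<le> truncated_action A k t r"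
  using truncated_action_upper[of 0 r t] A by simp

text \<open>A supremum of functions linear in \<open>(t, r)\<close> is jointly subadditive. This is
  what lets two consecutive pieces of a trajectory be merged.\<close>

lemma truncated_action_add:
  "truncated_action A k (t + s) (r + q) \<le> truncated_action A k t r + truncated_action A k s q"
proof (rule truncated_action_least)
  fix f assume "0 \<le> f" "f \<le> A"
  from truncated_action_upper[OF this, of r t] truncated_action_upper[OF this, of q s]
  show "f * (r + q) - (t + s) * f powr k \<le> truncated_action A k t r + truncated_action A k s q"
    by (simp add: algebra_simps)
qed

lemma truncated_action_scale:
  assumes "s \<ge> 0"
  shows "truncated_action A k (s * t) (s * r) \<le> s * truncated_action A k t r"
proof (rule truncated_action_least)
  fix f assume "0 \<le> f" "f \<le> A"
  from mult_left_mono[OF truncated_action_upper[OF this, of r t] assms]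
  show "f * (s * r) - s * t * f powr k \<le> s * truncated_action A k t r"
    by (simp add: algebra_simps)
qed

lemma truncated_action_mono_Lipschitz:
  assumes "r \<le> q + e" "0 \<le> e"
  shows "truncated_action A k t r \<le> truncated_action A k t q + A * e"
proof (rule truncated_action_least)
  fix f assume f: "0 \<le> f" "f \<le> A"
  have "f * r \<le> f * q + A * e"
    using mult_left_mono[OF assms(1) f(1)] mult_right_mono[OF f(2) assms(2)] by (simp add: algebra_simps)
  with truncated_action_upper[OF f, of q t]
  show "f * r - t * f powr k \<le> truncated_action A k t q + A * e" by simp
qed

lemma truncated_action_Lipschitz_time:
  "truncated_action A k t r \<le> truncated_action A k s r + A powr k * \<bar>t - s\<bar>"
proof (rule truncated_action_least)
  fix f assume f: "0 \<le> f" "f \<le> A"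
  have "(s - t) * f powr k \<le> \<bar>t - s\<bar> * A powr k"
    using f k by (intro mult_mono powr_mono2) auto
  with truncated_action_upper[OF f, of r s]
  show "f * r - t * f powr k \<le> truncated_action A k s r + A powr k * \<bar>t - s\<bar>"
    by (simp add: algebra_simps)
qed

lemma truncated_action_0: "t \<ge> 0 \<Longrightarrow> truncated_action A k t 0 \<le> 0"
  by (rule truncated_action_least) simp

text \<open>Equality case of Fenchel's inequality: \<open>k * F powr (k - 1)\<close> is the
  derivative of the power at \<open>F\<close>, and the tangent inequality makes \<open>F\<close> the
  best slope.\<close>

lemma truncated_action_conjugate:
  assumes "0 \<le> F" "F \<le> A"
  shows "truncated_action A k 1 (k * F powr (k - 1)) \<le> k * F powr (k - 1) * F - F powr k"
proof (rule truncated_action_least)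
  fix f assume "0 \<le> f" "f \<le> A"
  from powr_above_tangent[OF k this(1) assms(1)]
  show "f * (k * F powr (k - 1)) - 1 * f powr k \<le> k * F powr (k - 1) * F - F powr k"
    by (simp add: algebra_simps)
qed

end

text \<open>Common frame for the oscillating distance and its stable norm. Neither need be
  symmetric, hence the order of arguments: paths end at \<open>x\<close>. \<open>d_between\<close>
  replaces geodesics, the two tangent assumptions say that \<open>N x\<close> is the infinitesimal
  form of \<open>d\<close> at \<open>x\<close>, and the last two make \<open>F x\<close> the dual of
  \<open>N x\<close>, with attained maximum.\<close>

locale Finsler_distance =
  fixes d N F :: "'a::euclidean_space \<Rightarrow> 'a \<Rightarrow> real" and c C :: real
  assumes c_pos: "c > 0"
    and d_triangle: "d x z \<le> d x y + d y z"
    and d_lower: "c * norm (y - x) \<le> d x y" and d_upper: "d x y \<le> C * norm (y - x)"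
    and d_between: "0 \<le> \<theta> \<Longrightarrow> \<theta> \<le> 1 \<Longrightarrow> 0 < \<delta> \<Longrightarrow>
      \<exists>z. d x z \<le> \<theta> * d x y + \<delta> \<and> d z y \<le> (1 - \<theta>) * d x y + \<delta>"
    and d_tangent_upper: "0 < \<delta> \<Longrightarrow> \<forall>\<^sub>F s in at_right 0. d (x - s *\<^sub>R q) x \<le> s * (N x q + \<delta>)"
    and d_tangent_lower: "0 < \<delta> \<Longrightarrow> \<forall>\<^sub>F y in nhds x. N x (x - y) - \<delta> * norm (x - y) \<le> d y x"
    and N_scale: "0 \<le> r \<Longrightarrow> N x (r *\<^sub>R q) = r * N x q"
    and N_lower: "c * norm q \<le> N x q"
    and F_nonneg: "0 \<le> F x p"
    and dual_le: "p \<bullet> q \<le> F x p * N x q"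
    and dual_attained: "\<exists>q. N x q = 1 \<and> p \<bullet> q = F x p"
begin

lemma d_self: "d x x = 0"
  using d_lower[of x x] d_upper[of x x] by simp

lemma d_nonneg: "0 \<le> d x y"
  using d_lower[of y x] c_pos by (meson mult_nonneg_nonneg norm_ge_zero order_trans less_imp_le)

lemma C_nonneg: "0 \<le> C"
proof -
  obtain b :: 'a where "b \<in> Basis" using nonempty_Basis by blast
  then show ?thesis using d_upper[of 0 b] d_nonneg[of 0 b] by simp
qed

section \<open>The value function and its dynamic programming inequalities\<close>

definition value_function :: "real \<Rightarrow> real \<Rightarrow> ('a \<Rightarrow> real) \<Rightarrow> 'a \<times> real \<Rightarrow> real" where
  "value_function A k g = (\<lambda>(x, t). INF y. g y + truncated_action A k t (d y x))"

context
  fixes A k M B :: real and g :: "'a \<Rightarrow> real"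
  assumes A: "A > 0" and k: "k \<ge> 1" and g: "M-lipschitz_on UNIV g" and gB: "\<And>y. \<bar>g y\<bar> \<le> B"
    and MA: "M \<le> c * A"
begin

abbreviation "P \<equiv> truncated_action A k"
abbreviation "V \<equiv> value_function A k g"

lemma M_nonneg: "0 \<le> M"
  using g by (rule lipschitz_on_nonneg)

lemma g_Lipschitz: "g x \<le> g y + M * norm (x - y)"
  using lipschitz_onD[OF g, of x y] by (auto simp: dist_norm dist_real_def)

lemma value_function_le: "V (x, t) \<le> g y + P t (d y x)"
proof -
  have "bdd_below (range (\<lambda>y. g y + P t (d y x)))"
  proof (rule bdd_belowI2)
    fix y show "- B \<le> g y + P t (d y x)"
      using gB[of y] truncated_action_nonneg[OF A k, of t "d y x"] by linarith
  qed
  then show ?thesis unfolding value_function_def by (auto intro: cINF_lower2)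
qed

lemma value_function_greatest:
  assumes "\<And>y. X \<le> g y + P t (d y x)"
  shows "X \<le> V (x, t)"
  unfolding value_function_def using assms by (auto intro: cINF_greatest)

lemma value_function_near_optimal:
  assumes "e > 0"
  obtains y where "g y + P t (d y x) < V (x, t) + e"
proof (rule ccontr)
  assume "\<not> thesis"
  then have "V (x, t) + e \<le> V (x, t)"
    using that by (intro value_function_greatest) (meson not_less)
  with assms show False by simp
qed

text \<open>At time 0 travelling costs \<open>A * d y x\<close>, which dominates the variation of
  \<open>g\<close> because \<open>M \<le> c * A\<close>; staying at \<open>x\<close> is then
  optimal.\<close>

lemma value_function_initial: "V (x, 0) = g x"
proof (rule antisym)
  show "V (x, 0) \<le> g x"
    using value_function_le[of x 0 x] truncated_action_0[OF A k, of 0] by (simp add: d_self)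
  show "g x \<le> V (x, 0)"
  proof (rule value_function_greatest)
    fix y
    have "M * norm (x - y) \<le> A * (c * norm (x - y))"
      using mult_right_mono[OF MA norm_ge_zero[of "x - y"]] by (simp add: mult_ac)
    also have "\<dots> \<le> A * d y x" using A d_lower by (intro mult_left_mono) auto
    also have "\<dots> \<le> P 0 (d y x)" using truncated_action_upper[OF A k, of A "d y x" 0] A by simp
    finally show "g x \<le> g y + P 0 (d y x)" using g_Lipschitz[of x y] by simp
  qed
qed

lemma value_function_space: "V (x, t) \<le> V (x', t) + A * d x' x"
proof -
  have "V (x, t) - A * d x' x \<le> V (x', t)"
  proof (rule value_function_greatest)
    fix y
    have "P t (d y x) \<le> P t (d y x') + A * d x' x"
      by (rule truncated_action_mono_Lipschitz[OF A k d_triangle d_nonneg])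
    then show "V (x, t) - A * d x' x \<le> g y + P t (d y x')" using value_function_le[of x t y] by simp
  qed
  then show ?thesis by simp
qed

lemma value_function_time: "V (x, t) \<le> V (x, s) + A powr k * \<bar>t - s\<bar>"
proof -
  have "V (x, t) - A powr k * \<bar>t - s\<bar> \<le> V (x, s)"
  proof (rule value_function_greatest)
    fix y
    show "V (x, t) - A powr k * \<bar>t - s\<bar> \<le> g y + P s (d y x)"
      using value_function_le[of x t y] truncated_action_Lipschitz_time[OF A k, of t "d y x" s] by simp
  qed
  then show ?thesis by simp
qed

lemma value_function_Lipschitz: "(A * C + A powr k)-lipschitz_on U V"
proof (rule lipschitz_onI)
  fix z w :: "'a \<times> real"
  have *: "V z \<le> V w + (A * C + A powr k) * norm (z - w)" for z w :: "'a \<times> real"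
  proof -
    obtain x t y s where zw: "z = (x, t)" "w = (y, s)" by fastforce
    have "V z \<le> V (y, t) + A * d y x" unfolding zw by (rule value_function_space)
    also have "A * d y x \<le> A * (C * norm (x - y))" using A d_upper by (intro mult_left_mono) auto
    also have "\<dots> \<le> A * (C * norm (z - w))"
      using A C_nonneg norm_fst_le[of "x - y" "t - s"] by (intro mult_left_mono) (auto simp: zw)
    also have "V (y, t) \<le> V w + A powr k * \<bar>t - s\<bar>" unfolding zw by (rule value_function_time)
    also have "A powr k * \<bar>t - s\<bar> \<le> A powr k * norm (z - w)"
      using norm_snd_le[of "t - s" "x - y"] by (intro mult_left_mono) (auto simp: zw)
    finally show ?thesis by (simp add: algebra_simps)
  qed
  show "dist (V z) (V w) \<le> (A * C + A powr k) * dist z w"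
    using *[of z w] *[of w z] by (auto simp: dist_real_def dist_norm norm_minus_commute abs_le_iff)
qed (use A C_nonneg in simp)

lemma value_function_dynamic_le: "V (x, t + s) \<le> V (y, t) + P s (d y x)"
proof -
  have "V (x, t + s) - P s (d y x) \<le> V (y, t)"
  proof (rule value_function_greatest)
    fix z
    \<comment> \<open>With excess 0 the Lipschitz estimate is monotonicity in the distance.\<close>
    have "P (t + s) (d z x) \<le> P (t + s) (d z y + d y x) + A * 0"
      by (rule truncated_action_mono_Lipschitz[OF A k]) (use d_triangle in auto)
    also have "\<dots> \<le> P t (d z y) + P s (d y x)" using truncated_action_add[OF A k] by simp
    finally show "V (x, t + s) - P s (d y x) \<le> g z + P t (d z y)" using value_function_le[of x "t + s" z] by simp
  qed
  then show ?thesis by simp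
qed

text \<open>A nearly optimal source \<open>z\<close> and a point \<open>y\<close> at fraction
  \<open>\<theta>\<close> of the way to \<open>x\<close>; homogeneity of the action shares the cost
  in the same proportion. A cut near \<open>x\<close> yields the dynamic programming inequality, a
  cut near \<open>z\<close> the bound on the decay in time.\<close>

lemma value_function_split:
  assumes "0 \<le> \<theta>" "\<theta> \<le> 1" "\<delta> > 0"
  obtains y z where "d y x \<le> (1 - \<theta>) * d z x + \<delta>" "d z y \<le> \<theta> * d z x + \<delta>"
    "g z + P t (d z x) < V (x, t) + A * \<delta>"
    "P ((1 - \<theta>) * t) (d y x) \<le> (1 - \<theta>) * P t (d z x) + A * \<delta>"
    "P (\<theta> * t) (d z y) \<le> \<theta> * P t (d z x) + A * \<delta>"
proof -
  obtain z where z: "g z + P t (d z x) < V (x, t) + A * \<delta>"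
    using value_function_near_optimal[of "A * \<delta>" t x] A assms by auto
  obtain y where y: "d z y \<le> \<theta> * d z x + \<delta>" "d y x \<le> (1 - \<theta>) * d z x + \<delta>"
    using d_between[of \<theta> \<delta> z x] assms by auto
  show thesis
  proof (rule that[OF y(2,1) z])
    show "P ((1 - \<theta>) * t) (d y x) \<le> (1 - \<theta>) * P t (d z x) + A * \<delta>"
      using truncated_action_mono_Lipschitz[OF A k y(2), of "(1 - \<theta>) * t"]
        truncated_action_scale[OF A k, of "1 - \<theta>" t "d z x"] assms by simp
    show "P (\<theta> * t) (d z y) \<le> \<theta> * P t (d z x) + A * \<delta>"
      using truncated_action_mono_Lipschitz[OF A k y(1), of "\<theta> * t"]
        truncated_action_scale[OF A k, of \<theta> t "d z x"] assms by simp
  qed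
qed

text \<open>Both quantitative additions serve the test function argument: the error
  \<open>s\<^sup>2\<close> is of smaller order than \<open>s\<close>, and
  \<open>d y x \<le> D * s\<close> keeps the predecessor within the range of a first-order
  expansion.\<close>

lemma value_function_dynamic_ge:
  assumes t: "t > 0"
  obtains D where "D \<ge> 0" "\<And>s. 0 < s \<Longrightarrow> s < t \<Longrightarrow>
    \<exists>y. d y x \<le> D * s \<and> V (y, t - s) + P s (d y x) \<le> V (x, t) + s\<^sup>2"
proof -
  \<comment> \<open>A bound on the distance from a nearly optimal source: testing the action with
    the slope \<open>A\<close> gives \<open>A * d z x \<le> P t (d z x) + t * A powr k\<close>, and
    near-optimality bounds the action by \<open>2 * B + t\<^sup>2\<close>.\<close>
  define D0 where "D0 = (2 * B + t\<^sup>2 + t * A powr k) / A"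
  have B: "B \<ge> 0" using gB[of 0] by linarith
  have D0: "D0 \<ge> 0" using A B t by (simp add: D0_def)
  show thesis
  proof (rule that[of "D0 / t + t / (3 * A)"])
    show "0 \<le> D0 / t + t / (3 * A)" using A t D0 by simp
    fix s assume s: "0 < s" "s < t"
    define \<theta> where "\<theta> = 1 - s / t"
    have \<theta>: "0 \<le> \<theta>" "\<theta> \<le> 1" "(1 - \<theta>) * t = s" "\<theta> * t = t - s"
      using s by (auto simp: \<theta>_def field_simps)
    have \<delta>: "s\<^sup>2 / (3 * A) > 0" using s A by simp
    obtain y z where y: "d y x \<le> (1 - \<theta>) * d z x + s\<^sup>2 / (3 * A)" "d z y \<le> \<theta> * d z x + s\<^sup>2 / (3 * A)"
      and z: "g z + P t (d z x) < V (x, t) + A * (s\<^sup>2 / (3 * A))"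
      and P1: "P s (d y x) \<le> (1 - \<theta>) * P t (d z x) + A * (s\<^sup>2 / (3 * A))"
      and P2: "P (t - s) (d z y) \<le> \<theta> * P t (d z x) + A * (s\<^sup>2 / (3 * A))"
      using value_function_split[OF \<theta>(1,2) \<delta>, of x t] unfolding \<theta>(3,4) by metis
    have Aq: "A * (s\<^sup>2 / (3 * A)) = s\<^sup>2 / 3" using A by simp
    have "s\<^sup>2 \<le> t\<^sup>2" using s by (intro power_mono) auto
    have "V (x, t) \<le> g x + P t (d x x)" by (rule value_function_le)
    then have "V (x, t) \<le> B" using truncated_action_0[OF A k, of t] t gB[of x] by (simp add: d_self)
    then have "P t (d z x) \<le> 2 * B + t\<^sup>2"
      using z gB[of z] \<open>s\<^sup>2 \<le> t\<^sup>2\<close> s zero_le_power2[of s] unfolding Aq by linarith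
    then have "A * d z x \<le> 2 * B + t\<^sup>2 + t * A powr k"
      using truncated_action_upper[OF A k, of A "d z x" t] A by simp
    then have "d z x \<le> D0" using A by (simp add: D0_def field_simps)
    then have "(1 - \<theta>) * d z x \<le> (1 - \<theta>) * D0" using \<theta> by (intro mult_left_mono) auto
    then have "(1 - \<theta>) * d z x \<le> s / t * D0" by (simp add: \<theta>_def)
    moreover have "s\<^sup>2 / (3 * A) \<le> t * s / (3 * A)"
      using s A by (intro divide_right_mono) (auto simp: power2_eq_square)
    ultimately have "d y x \<le> (D0 / t + t / (3 * A)) * s" using y(1) by (simp add: algebra_simps)
    moreover have "V (y, t - s) + P s (d y x) \<le> V (x, t) + s\<^sup>2"
      using value_function_le[of y "t - s" z] P1 P2 z unfolding Aq by (simp add: algebra_simps)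
    ultimately show "\<exists>y. d y x \<le> (D0 / t + t / (3 * A)) * s \<and> V (y, t - s) + P s (d y x) \<le> V (x, t) + s\<^sup>2"
      by blast
  qed
qed

text \<open>The first piece of an almost optimal trajectory is cut off and \<open>y\<close> becomes
  the new source. Measured by \<open>d\<close>, the function \<open>g\<close> has slope at most
  \<open>f = M / c\<close>, and this slope is admissible in the action, so the cut saves no more
  than \<open>s * f powr k\<close>.\<close>

lemma value_function_decay:
  assumes t: "t \<ge> 0" and s: "s > 0"
  shows "V (x, t) \<le> V (x, t + s) + s * (M / c) powr k"
proof (rule field_le_epsilon)
  fix e :: real assume "e > 0"
  define f where "f = M / c"
  have f: "0 \<le> f" "f \<le> A" using M_nonneg MA c_pos by (auto simp: f_def field_simps)
  define \<theta> where "\<theta> = s / (t + s)"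
  have \<theta>: "0 \<le> \<theta>" "\<theta> \<le> 1" "\<theta> * (t + s) = s" "(1 - \<theta>) * (t + s) = t"
    using t s by (auto simp: \<theta>_def field_simps)
  have "e / (3 * A) > 0" using \<open>e > 0\<close> A by simp
  from value_function_split[OF \<theta>(1,2) this, of x "t + s"] obtain y z where
    y: "d z y \<le> \<theta> * d z x + e / (3 * A)"
    and z: "g z + P (t + s) (d z x) < V (x, t + s) + A * (e / (3 * A))"
    and P1: "P t (d y x) \<le> (1 - \<theta>) * P (t + s) (d z x) + A * (e / (3 * A))"
    and P2: "P s (d z y) \<le> \<theta> * P (t + s) (d z x) + A * (e / (3 * A))"
    unfolding \<theta>(3,4) by metis
  have Aq: "A * (e / (3 * A)) = e / 3" using A by simp
  have "M * norm (y - z) = f * (c * norm (y - z))" using c_pos by (simp add: f_def)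
  also have "\<dots> \<le> f * d z y" using f d_lower by (intro mult_left_mono)
  also have "\<dots> \<le> P s (d z y) + s * f powr k" using truncated_action_upper[OF A k f, of "d z y" s] by simp
  finally have "g y \<le> g z + P s (d z y) + s * f powr k" using g_Lipschitz[of y z] by simp
  then show "V (x, t) \<le> V (x, t + s) + s * (M / c) powr k + e"
    using value_function_le[of x t y] P1 P2 z unfolding Aq f_def[symmetric] by (simp add: algebra_simps)
qed

text \<open>Arriving at \<open>x\<close> with any velocity \<open>r *\<^sub>R q\<close> along the
  direction dual to \<open>p\<close> gives \<open>a + r * F x p \<le> P 1 r\<close>. If
  \<open>F x p \<le> A\<close>, the conjugate velocity turns this into the equation; otherwise the
  left side grows faster in \<open>r\<close> than the slope \<open>A\<close> of the action
  allows.\<close>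

lemma value_function_subsolution: "viscosity_subsolution (\<lambda>(x, t) (q, a). a + F x q powr k) (UNIV \<times> {0<..}) V"
  unfolding viscosity_subsolution_def
proof (intro conjI allI ballI impI)
  show "continuous_on (UNIV \<times> {0<..}) V"
    by (rule lipschitz_on_continuous_on[OF value_function_Lipschitz])
  fix \<phi> and z :: "'a \<times> real"
  assume z: "z \<in> UNIV \<times> {0<..}" and H: "C1_on (UNIV \<times> {0<..}) \<phi> \<and> (\<forall>\<^sub>F z' in nhds z. V z' - \<phi> z' \<le> V z - \<phi> z)"
  obtain x t where xt: "z = (x, t)" "t > 0" using z by auto
  obtain p a where pa: "gradient \<phi> z = (p, a)" by fastforce
  obtain q where q: "N x q = 1" "p \<bullet> q = F x p" using dual_attained by blast
  obtain r0 where r0: "r0 > 0" "\<And>z'. norm (z' - z) < r0 \<Longrightarrow> V z' - \<phi> z' \<le> V z - \<phi> z"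
    using H unfolding eventually_nhds_metric dist_norm by blast
  have key: "a + r * F x p \<le> P 1 r" if r: "r \<ge> 0" for r
  proof -
    define n where "n = norm (r *\<^sub>R q, 1::real)"
    have n: "n > 0" by (simp add: n_def zero_prod_def)
    have "a + r * F x p \<le> P 1 r + (A + n) * e" if e: "e > 0" for e
    proof -
      obtain r1 where r1: "r1 > 0" "\<And>y. norm (y - z) < r1 \<Longrightarrow>
          \<bar>\<phi> y - \<phi> z - (y - z) \<bullet> gradient \<phi> z\<bar> \<le> e * norm (y - z)"
        using C1_on_first_order[OF conjunct1[OF H] z e] by metis
      have "\<forall>\<^sub>F s in at_right 0. d (x - s *\<^sub>R (r *\<^sub>R q)) x \<le> s * (N x (r *\<^sub>R q) + e)"
        by (rule d_tangent_upper[OF e])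
      moreover have "\<forall>\<^sub>F s in at_right 0. s \<in> {0<..<min t (min (r0 / n) (r1 / n))}"
        using xt r0 r1 n by (intro eventually_at_right_real) auto
      ultimately have "\<forall>\<^sub>F s in at_right 0. d (x - s *\<^sub>R (r *\<^sub>R q)) x \<le> s * (N x (r *\<^sub>R q) + e)
          \<and> s \<in> {0<..<min t (min (r0 / n) (r1 / n))}"
        by (rule eventually_conj)
      then obtain s where ds: "d (x - s *\<^sub>R (r *\<^sub>R q)) x \<le> s * (N x (r *\<^sub>R q) + e)"
        and s: "0 < s" "s < t" "s < r0 / n" "s < r1 / n"
        using eventually_happens' trivial_limit_at_right_real by fastforce
      define y where "y = x - s *\<^sub>R (r *\<^sub>R q)"
      have diff: "(y, t - s) - z = (- s) *\<^sub>R (r *\<^sub>R q, 1)" by (simp add: y_def xt)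
      have ny: "norm ((y, t - s) - z) = s * n" unfolding diff norm_scaleR n_def using s by simp
      then have "norm ((y, t - s) - z) < r0" "norm ((y, t - s) - z) < r1"
        using s n by (auto simp: field_simps)
      then have "V (y, t - s) - \<phi> (y, t - s) \<le> V z - \<phi> z"
        and fo: "\<bar>\<phi> (y, t - s) - \<phi> z - ((y, t - s) - z) \<bullet> gradient \<phi> z\<bar> \<le> e * (s * n)"
        using r0(2) r1(2) ny by metis+
      have "((y, t - s) - z) \<bullet> gradient \<phi> z = - (s * (r * F x p + a))"
        unfolding diff pa using q(2) by (simp add: inner_commute algebra_simps)
      then have "s * (r * F x p + a) - e * (s * n) \<le> \<phi> z - \<phi> (y, t - s)"
        using fo by linarith
      also have "\<dots> \<le> V (x, (t - s) + s) - V (y, t - s)"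
        using \<open>V (y, t - s) - \<phi> (y, t - s) \<le> V z - \<phi> z\<close> by (simp add: xt)
      also have "\<dots> \<le> P s (d y x)" using value_function_dynamic_le[of x "t - s" s y] by simp
      also have "\<dots> \<le> P (s * 1) (s * (r + e)) + A * 0"
      proof -
        have "d y x \<le> s * (r + e) + 0" using ds q r by (simp add: y_def N_scale)
        from truncated_action_mono_Lipschitz[OF A k this, of s] show ?thesis by simp
      qed
      also have "\<dots> \<le> s * P 1 (r + e)" using truncated_action_scale[OF A k, of s 1 "r + e"] s by simp
      also have "\<dots> \<le> s * (P 1 r + A * e)"
        using s e by (intro mult_left_mono truncated_action_mono_Lipschitz[OF A k]) auto
      finally have "s * (a + r * F x p) \<le> s * (P 1 r + (A + n) * e)" by (simp add: algebra_simps)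
      then show ?thesis using s by simp
    qed
    note * = this
    show ?thesis
    proof (rule field_le_epsilon)
      fix e :: real assume "e > 0"
      have "A + n > 0" using A n by simp
      with *[of "e / (A + n)"] \<open>e > 0\<close> show "a + r * F x p \<le> P 1 r + e" by simp
    qed
  qed
  have "a + F x p powr k \<le> 0"
  proof (cases "F x p \<le> A")
    case True
    have "0 \<le> k * F x p powr (k - 1)" using k by simp
    from key[OF this] truncated_action_conjugate[OF A k F_nonneg True]
    show ?thesis by simp
  next
    case False
    \<comment> \<open>Chosen so that the excess slope contributes \<open>\<bar>a\<bar> + 1\<close>,
      which no value of \<open>a\<close> can compensate; this case is contradictory.\<close>
    define r where "r = (\<bar>a\<bar> + 1) / (F x p - A)"
    have r: "r \<ge> 0" "r * (F x p - A) = \<bar>a\<bar> + 1" using False by (auto simp: r_def)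
    have "P 1 r \<le> P 1 0 + A * r" using r by (intro truncated_action_mono_Lipschitz[OF A k]) auto
    then have "a + r * (F x p - A) \<le> 0"
      using key[OF r(1)] truncated_action_0[OF A k, of 1] by (simp add: algebra_simps)
    with r(2) show ?thesis by linarith
  qed
  then show "(case z of (x, t) \<Rightarrow> \<lambda>(q, a). a + F x q powr k) (gradient \<phi> z) \<le> 0"
    by (simp add: xt pa[unfolded xt])
qed

text \<open>For \<open>F x p \<le> A\<close> the slope \<open>F x p\<close> is itself admissible in
  the action of the last short piece of a nearly optimal trajectory. For \<open>F x p > A\<close>
  the limited decay in time suffices, since \<open>M / c \<le> A\<close>.\<close>

lemma value_function_supersolution: "viscosity_supersolution (\<lambda>(x, t) (q, a). a + F x q powr k) (UNIV \<times> {0<..}) V"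
  unfolding viscosity_supersolution_def
proof (intro conjI allI ballI impI)
  show "continuous_on (UNIV \<times> {0<..}) V"
    by (rule lipschitz_on_continuous_on[OF value_function_Lipschitz])
  fix \<phi> and z :: "'a \<times> real"
  assume z: "z \<in> UNIV \<times> {0<..}" and H: "C1_on (UNIV \<times> {0<..}) \<phi> \<and> (\<forall>\<^sub>F z' in nhds z. V z' - \<phi> z' \<ge> V z - \<phi> z)"
  obtain x t where xt: "z = (x, t)" "t > 0" using z by auto
  obtain p a where pa: "gradient \<phi> z = (p, a)" by fastforce
  obtain r0 where r0: "r0 > 0" "\<And>z'. norm (z' - z) < r0 \<Longrightarrow> V z' - \<phi> z' \<ge> V z - \<phi> z"
    using H unfolding eventually_nhds_metric dist_norm by blast
  have "0 \<le> a + F x p powr k"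
  proof (cases "F x p \<le> A")
    case False
    have "- ((M / c) powr k) - e \<le> a" if e: "e > 0" for e
    proof -
      obtain r1 where r1: "r1 > 0" "\<And>y. norm (y - z) < r1 \<Longrightarrow>
          \<bar>\<phi> y - \<phi> z - (y - z) \<bullet> gradient \<phi> z\<bar> \<le> e * norm (y - z)"
        using C1_on_first_order[OF conjunct1[OF H] z e] by metis
      define s where "s = min t (min r0 r1) / 2"
      have s: "0 < s" "s < t" "s < r0" "s < r1" using xt r0 r1 by (auto simp: s_def)
      have diff: "(x, t - s) - z = (0, - s)" by (simp add: xt)
      have ny: "norm ((x, t - s) - z) = s" unfolding diff using s by (simp add: norm_Pair)
      have "\<bar>\<phi> (x, t - s) - \<phi> z - ((x, t - s) - z) \<bullet> gradient \<phi> z\<bar> \<le> e * s"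
        using r1(2)[of "(x, t - s)"] ny s by simp
      moreover have "((x, t - s) - z) \<bullet> gradient \<phi> z = - (s * a)" unfolding diff pa by simp
      moreover have "V (x, t - s) - \<phi> (x, t - s) \<ge> V z - \<phi> z" using r0(2) ny s by simp
      moreover have "V (x, t - s) \<le> V z + s * (M / c) powr k"
        using value_function_decay[of "t - s" s x] s by (simp add: xt)
      ultimately have "s * (- ((M / c) powr k) - e) \<le> s * a" by (simp add: algebra_simps)
      then show ?thesis using s by simp
    qed
    then have "- ((M / c) powr k) \<le> a" by (meson field_le_epsilon diff_le_eq)
    moreover have "(M / c) powr k \<le> F x p powr k"
      using False MA c_pos k M_nonneg by (intro powr_mono2) (auto simp: field_simps intro: order_trans)
    ultimately show ?thesis by simp
  next
    case True
    obtain D where D: "D \<ge> 0" "\<And>s. 0 < s \<Longrightarrow> s < t \<Longrightarrow>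
        \<exists>y. d y x \<le> D * s \<and> V (y, t - s) + P s (d y x) \<le> V (x, t) + s\<^sup>2"
      using value_function_dynamic_ge[OF xt(2)] by metis
    define E where "E = D / c"
    have E: "E \<ge> 0" using D c_pos by (simp add: E_def)
    define n where "n = E + 1"
    have n: "n > 0" "n \<ge> 1" using E by (auto simp: n_def)
    have *: "0 \<le> a + F x p powr k + (1 + n + F x p * E) * e" if e: "e > 0" for e
    proof -
      obtain r1 where r1: "r1 > 0" "\<And>y. norm (y - z) < r1 \<Longrightarrow>
          \<bar>\<phi> y - \<phi> z - (y - z) \<bullet> gradient \<phi> z\<bar> \<le> e * norm (y - z)"
        using C1_on_first_order[OF conjunct1[OF H] z e] by metis
      obtain r2 where r2: "r2 > 0" "\<And>y. norm (y - x) < r2 \<Longrightarrow> N x (x - y) - e * norm (x - y) \<le> d y x"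
        using d_tangent_lower[OF e, of x] unfolding eventually_nhds_metric dist_norm by blast
      \<comment> \<open>\<open>s < e\<close> turns the near-optimality error
        \<open>s\<^sup>2\<close> into \<open>e * s\<close>; the division by \<open>n\<close> keeps
        the predecessor, at distance at most \<open>n * s\<close>, within all three radii.\<close>
      define s where "s = min (min t e) (min (min r0 r1) r2 / n) / 2"
      have "0 < s" using xt e r0 r1 r2 n by (simp add: s_def)
      moreover have "s < min t e" "s < min (min r0 r1) r2 / n" using \<open>0 < s\<close> unfolding s_def by linarith+
      moreover from this(2) n have "n * s < min (min r0 r1) r2" by (simp add: field_simps)
      ultimately have s: "0 < s" "s < t" "s < e" "n * s < r0" "n * s < r1" "n * s < r2" by auto
      obtain y where y: "d y x \<le> D * s" "V (y, t - s) + P s (d y x) \<le> V (x, t) + s\<^sup>2"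
        using D(2)[OF s(1,2)] by blast
      have "c * norm (x - y) \<le> D * s" using d_lower[of x y] y by simp
      then have nxy: "norm (x - y) \<le> E * s" using c_pos by (simp add: E_def field_simps)
      have "norm ((y, t - s) - z) \<le> norm (y - x) + s"
        using norm_Pair_le[of "y - x" "- s"] s by (simp add: xt)
      then have ny: "norm ((y, t - s) - z) \<le> n * s" using nxy by (simp add: n_def norm_minus_commute algebra_simps)
      have nn: "norm (y - x) < r2" using nxy s by (simp add: n_def norm_minus_commute algebra_simps)
      have "\<bar>\<phi> (y, t - s) - \<phi> z - ((y, t - s) - z) \<bullet> gradient \<phi> z\<bar> \<le> e * norm ((y, t - s) - z)"
        using r1(2)[of "(y, t - s)"] ny s by linarith
      also have "\<dots> \<le> e * (n * s)" using ny e by simp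
      finally have fo: "\<bar>\<phi> (y, t - s) - \<phi> z - ((y, t - s) - z) \<bullet> gradient \<phi> z\<bar> \<le> e * (n * s)" .
      have gr: "((y, t - s) - z) \<bullet> gradient \<phi> z = - (p \<bullet> (x - y)) - s * a"
        by (simp add: pa xt inner_commute inner_diff_right pa[unfolded xt])
      have tch: "V (y, t - s) - \<phi> (y, t - s) \<ge> V z - \<phi> z" using r0(2)[of "(y, t - s)"] ny s by linarith
      have "p \<bullet> (x - y) \<le> F x p * N x (x - y)" by (rule dual_le)
      also have "\<dots> \<le> F x p * (d y x + e * (E * s))"
        using r2(2)[OF nn] nxy e by (intro mult_left_mono F_nonneg) (smt (verit) mult_left_mono)
      finally have 1: "p \<bullet> (x - y) \<le> F x p * d y x + F x p * e * (E * s)" by (simp add: algebra_simps)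
      have 2: "F x p * d y x - s * F x p powr k \<le> P s (d y x)"
        by (rule truncated_action_upper[OF A k F_nonneg True])
      have 3: "s\<^sup>2 \<le> e * s" using s by (simp add: power2_eq_square)
      have "0 \<le> s * (a + F x p powr k) + s * ((1 + n + F x p * E) * e)"
        using fo[unfolded gr] tch y(2) 1 2 3 by (simp add: xt algebra_simps)
      then have "s * 0 \<le> s * (a + F x p powr k + (1 + n + F x p * E) * e)" by (simp add: algebra_simps)
      then show ?thesis using s(1) by (simp only: mult_le_cancel_left_pos)
    qed
    have m: "1 + n + F x p * E > 0" using n E F_nonneg by (simp add: add_pos_nonneg)
    show ?thesis
    proof (rule field_le_epsilon)
      fix e :: real assume "e > 0"
      with *[of "e / (1 + n + F x p * E)"] m show "0 \<le> a + F x p powr k + e" by simp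
    qed
  qed
  then show "0 \<le> (case z of (x, t) \<Rightarrow> \<lambda>(q, a). a + F x q powr k) (gradient \<phi> z)"
    by (simp add: xt pa[unfolded xt])
qed

theorem Lipschitz_solution_eq_value_function:
  assumes uc: "\<And>R. uniformly_continuous_on (UNIV \<times> cball 0 R) (\<lambda>(x, p). F x p powr k)"
    and u: "L-lipschitz_on (UNIV \<times> {0..}) u" and u0: "\<And>x. u (x, 0) = g x"
    and sol: "viscosity_solution (\<lambda>(x, t) (q, a). a + F x q powr k) (UNIV \<times> {0<..}) u"
    and t: "t \<ge> 0"
  shows "u (x, t) = V (x, t)"
proof -
  let ?L = "max L (A * C + A powr k)"
  have l: "?L-lipschitz_on (UNIV \<times> {0..}) u" "?L-lipschitz_on (UNIV \<times> {0..}) V"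
    using lipschitz_on_le[OF u] lipschitz_on_le[OF value_function_Lipschitz] by auto
  show ?thesis
  proof (rule antisym)
    show "u (x, t) \<le> V (x, t)"
      by (rule Lipschitz_comparison[OF uc l _ value_function_supersolution _ t])
        (use sol in \<open>auto simp: viscosity_solution_def u0 value_function_initial\<close>)
    show "V (x, t) \<le> u (x, t)"
      by (rule Lipschitz_comparison[OF uc l(2,1) value_function_subsolution _ _ t])
        (use sol in \<open>auto simp: viscosity_solution_def u0 value_function_initial\<close>)
  qed
qed

end

end

section \<open>The Finsler distance of a homogeneous Hamiltonian\<close>

definition lattice_point :: "real^2 \<Rightarrow> bool" where
  "lattice_point z \<longleftrightarrow> (\<forall>i. z $ i \<in> \<int>)"

definition floor_vec :: "real^2 \<Rightarrow> real^2" where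
  "floor_vec y = (\<chi> i. of_int \<lfloor>y $ i\<rfloor>)"

lemma lattice_point_floor_vec [simp]: "lattice_point (floor_vec y)"
  by (simp add: lattice_point_def floor_vec_def)

lemma lattice_point_minus [simp]: "lattice_point (- z) \<longleftrightarrow> lattice_point z"
  by (simp add: lattice_point_def)

lemma lattice_point_diff: "lattice_point y \<Longrightarrow> lattice_point z \<Longrightarrow> lattice_point (y - z)"
  by (simp add: lattice_point_def)

lemma frac_vec_in_cbox: "y - floor_vec y \<in> cbox 0 1"
proof -
  have "0 \<le> (y - floor_vec y) $ i \<and> (y - floor_vec y) $ i \<le> 1" for i
    using of_int_floor_le[of "y $ i"] real_of_int_floor_add_one_ge[of "y $ i"]
    unfolding floor_vec_def vector_minus_component vec_lambda_beta by linarith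
  then show ?thesis by (simp add: mem_box_cart)
qed

lemma norm_frac_vec: "norm (y - floor_vec y) \<le> 2"
proof -
  have "norm (y - floor_vec y) \<le> (\<Sum>i\<in>UNIV. \<bar>(y - floor_vec y) $ i\<bar>)"
    by (rule norm_le_l1_cart)
  also have "\<dots> \<le> (\<Sum>i\<in>(UNIV::2 set). 1)"
    using frac_vec_in_cbox[of y] by (intro sum_mono) (auto simp: mem_box_cart)
  finally show ?thesis by simp
qed

lemma Z2_periodicD: "Z2_periodic f \<Longrightarrow> lattice_point z \<Longrightarrow> f (y + z) = f y"
  by (simp add: Z2_periodic_def lattice_point_def)

lemma Z2_periodic_frac: "Z2_periodic f \<Longrightarrow> f (y - floor_vec y) = f y"
  using Z2_periodicD[of f "- floor_vec y" y] by simp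

text \<open>Both points are moved by the same lattice vector. One lands in the unit cell and a
  neighbour within distance 1 stays in the enlarged square \<open>?Q\<close>, which is
  compact.\<close>

lemma periodic_uniformly_continuous:
  fixes K :: "real^2 \<Rightarrow> 'a::euclidean_space \<Rightarrow> real"
  assumes cont: "continuous_on UNIV (\<lambda>(y, p). K y p)" and per: "\<And>p. Z2_periodic (\<lambda>y. K y p)"
  shows "uniformly_continuous_on (UNIV \<times> cball 0 R) (\<lambda>(y, p). K y p)"
proof -
  let ?f = "\<lambda>(y, p). K y p"
  let ?Q = "cbox (- 1) 2 :: (real^2) set"
  have "uniformly_continuous_on (?Q \<times> cball 0 R) ?f"
    by (intro compact_uniformly_continuous continuous_on_subset[OF cont] compact_Times) auto
  note uc = this[unfolded uniformly_continuous_on_def, rule_format]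
  show ?thesis
    unfolding uniformly_continuous_on_def
  proof (intro allI impI)
    fix e :: real assume "e > 0"
    then obtain m where m: "m > 0" "\<And>z z'. z \<in> ?Q \<times> cball 0 R \<Longrightarrow> z' \<in> ?Q \<times> cball 0 R \<Longrightarrow>
        dist z' z < m \<Longrightarrow> dist (?f z') (?f z) < e"
      using uc by metis
    show "\<exists>m>0. \<forall>z\<in>UNIV \<times> cball 0 R. \<forall>z'\<in>UNIV \<times> cball 0 R. dist z' z < m \<longrightarrow> dist (?f z') (?f z) < e"
    proof (intro exI[of _ "min m 1"] conjI ballI impI)
      fix z z' :: "(real^2) \<times> 'a"
      assume zz: "z \<in> UNIV \<times> cball 0 R" "z' \<in> UNIV \<times> cball 0 R" "dist z' z < min m 1"
      obtain y p y' p' where z: "z = (y, p)" "z' = (y', p')" by (cases z, cases z')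
      define m where "m = floor_vec y"
      have "norm (y' - y) < 1"
        using zz(3) norm_fst_le[of "y' - y" "p' - p"] by (simp add: z dist_norm)
      then have "\<bar>(y' - y) $ i\<bar> < 1" for i using component_le_norm_cart[of "y' - y" i] by linarith
      then have "y' - m \<in> ?Q" "y - m \<in> ?Q"
        using frac_vec_in_cbox[of y] by (auto simp: m_def mem_box_cart abs_less_iff) (smt (verit))+
      moreover have "dist (y' - m, p') (y - m, p) = dist z' z"
        by (simp add: z dist_Pair_Pair dist_norm)
      ultimately have "dist (?f (y' - m, p')) (?f (y - m, p)) < e"
        using zz z by (intro m(2)) auto
      moreover have "K (y' - m) p' = K y' p'" "K (y - m) p = K y p"
        using Z2_periodicD[OF per, of "- m"] by (simp_all add: m_def)
      ultimately show "dist (?f z') (?f z) < e" by (simp add: z)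
    qed (use m in auto)
  qed
qed

section \<open>The gauge of a homogeneous Hamiltonian\<close>

locale homogeneous_Hamiltonian =
  fixes H :: "real^2 \<Rightarrow> real^2 \<Rightarrow> real" and k :: real
  assumes cont: "continuous_on UNIV (\<lambda>(y, p). H y p)"
    and periodic: "\<And>p. Z2_periodic (\<lambda>y. H y p)"
    and coercive: "\<forall>M. \<exists>R. \<forall>y p. norm p \<ge> R \<longrightarrow> H y p \<ge> M"
    and convex: "\<And>y. convex_on UNIV (H y)"
    and k: "k \<ge> 1"
    and homogeneous: "\<And>\<mu> y p. \<mu> \<ge> 0 \<Longrightarrow> H y (\<mu> *\<^sub>R p) = \<mu> powr k * H y p"
begin

lemma H_0: "H y 0 = 0"
  using homogeneous[of 0 y 0] by simp

text \<open>Coercivity makes \<open>H\<close> at least 1 at a distant positive multiple of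
  \<open>p\<close>, and homogeneity carries the sign back to \<open>p\<close>.\<close>

lemma H_pos:
  assumes "p \<noteq> 0" shows "H y p > 0"
proof -
  obtain R where R: "\<And>y p. norm p \<ge> R \<Longrightarrow> H y p \<ge> 1" using coercive by blast
  define \<mu> where "\<mu> = max R 1 / norm p"
  have \<mu>: "\<mu> > 0" using assms by (simp add: \<mu>_def)
  have "norm (\<mu> *\<^sub>R p) \<ge> R" using assms by (simp add: \<mu>_def)
  then have "\<mu> powr k * H y p \<ge> 1" using R[of "\<mu> *\<^sub>R p" y] homogeneous[of \<mu> y p] \<mu> by simp
  then show ?thesis using \<mu> by (smt (verit) mult_nonneg_nonpos powr_ge_zero)
qed

lemma H_nonneg: "H y p \<ge> 0"
  using H_pos[of p y] H_0 by (cases "p = 0") auto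

definition gauge :: "real^2 \<Rightarrow> real^2 \<Rightarrow> real" where
  "gauge y p = H y p powr (1 / k)"

lemma gauge_powr: "gauge y p powr k = H y p"
  using k H_nonneg by (simp add: gauge_def powr_powr)

lemma gauge_nonneg: "gauge y p \<ge> 0"
  by (simp add: gauge_def)

lemma gauge_scale: "\<mu> \<ge> 0 \<Longrightarrow> gauge y (\<mu> *\<^sub>R p) = \<mu> * gauge y p"
  using k H_nonneg by (simp add: gauge_def homogeneous powr_mult powr_powr)

lemma gauge_0 [simp]: "gauge y 0 = 0"
  using gauge_scale[of 0 y 0] by simp

lemma gauge_pos: "p \<noteq> 0 \<Longrightarrow> gauge y p > 0"
  using H_pos[of p y] by (simp add: gauge_def)

lemma gauge_cont: "continuous_on UNIV (\<lambda>(y, p). gauge y p)"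
proof -
  have "continuous_on UNIV (\<lambda>z. (\<lambda>(y, p). H y p) z powr (1 / k))"
    by (rule continuous_on_powr'[OF cont]) (use k H_nonneg in \<open>auto intro!: continuous_intros\<close>)
  then show ?thesis by (simp add: gauge_def split_beta)
qed

lemma gauge_periodic: "Z2_periodic (\<lambda>y. gauge y p)"
  using periodic by (simp add: Z2_periodic_def gauge_def)

lemma gauge_bounds:
  obtains a b where "0 < a" "0 < b" "\<And>y p. a * norm p \<le> gauge y p" "\<And>y p. gauge y p \<le> b * norm p"
proof -
  let ?S = "cbox 0 1 \<times> sphere 0 1 :: ((real^2) \<times> (real^2)) set"
  let ?f = "\<lambda>(y, p). gauge y p"
  have S: "compact ?S" by (intro compact_Times) auto
  obtain e :: "real^2" where e: "norm e = 1" using norm_axis_1 by blast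
  have "(0, e) \<in> ?S" using e by (simp add: mem_box_cart)
  then have ne: "?S \<noteq> {}" by blast
  have c: "continuous_on ?S ?f" by (rule continuous_on_subset[OF gauge_cont]) simp
  obtain z0 where z0: "z0 \<in> ?S" "\<And>z. z \<in> ?S \<Longrightarrow> ?f z0 \<le> ?f z"
    using continuous_attains_inf[OF S ne c] by blast
  obtain z1 where z1: "z1 \<in> ?S" "\<And>z. z \<in> ?S \<Longrightarrow> ?f z \<le> ?f z1"
    using continuous_attains_sup[OF S ne c] by blast
  have pos: "0 < ?f z" if "z \<in> ?S" for z
  proof -
    obtain y q where z: "z = (y, q)" by (cases z)
    then have "q \<noteq> 0" using that by auto
    then show ?thesis using gauge_pos z by simp
  qed
  have "?f z0 * norm p \<le> gauge y p \<and> gauge y p \<le> ?f z1 * norm p" for y p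
  proof (cases "p = 0")
    case False
    have "(y - floor_vec y, sgn p) \<in> ?S" using frac_vec_in_cbox False by (simp add: norm_sgn)
    from z0(2)[OF this] z1(2)[OF this] have "?f z0 \<le> gauge y (sgn p)" "gauge y (sgn p) \<le> ?f z1"
      using Z2_periodic_frac[OF gauge_periodic] by auto
    moreover have "gauge y p = norm p * gauge y (sgn p)"
      using gauge_scale[of "norm p" y "sgn p"] False by (simp add: sgn_div_norm)
    ultimately show ?thesis by (simp add: mult.commute mult_left_mono)
  qed simp
  then show thesis using that[of "?f z0" "?f z1"] pos z0(1) z1(1) by blast
qed

text \<open>A multiplicative modulus, uniform in \<open>p\<close>: on unit vectors the gauge is
  bounded below by \<open>a > 0\<close>, so an additive error \<open>\<delta> * a\<close> is a
  relative one, and homogeneity extends it to all \<open>p\<close>.\<close>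

lemma gauge_oscillation:
  assumes "\<delta> > 0"
  obtains \<rho> where "\<rho> > 0" "\<And>x y p. dist x y < \<rho> \<Longrightarrow> gauge x p \<le> (1 + \<delta>) * gauge y p"
proof -
  obtain a where a: "0 < a" "\<And>y p. a * norm p \<le> gauge y p" using gauge_bounds by metis
  have "uniformly_continuous_on (UNIV \<times> cball 0 1) (\<lambda>(y, p). gauge y p)"
    by (rule periodic_uniformly_continuous[OF gauge_cont gauge_periodic])
  moreover have "\<delta> * a > 0" using assms a by simp
  ultimately obtain \<rho> where \<rho>: "\<rho> > 0" "\<And>z z'. z \<in> UNIV \<times> cball 0 1 \<Longrightarrow> z' \<in> UNIV \<times> cball 0 1 \<Longrightarrow>
      dist z' z < \<rho> \<Longrightarrow> dist ((\<lambda>(y, p). gauge y p) z') ((\<lambda>(y, p). gauge y p) z) < \<delta> * a"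
    unfolding uniformly_continuous_on_def by metis
  show thesis
  proof (rule that[OF \<rho>(1)])
    fix x y p :: "real^2" assume d: "dist x y < \<rho>"
    show "gauge x p \<le> (1 + \<delta>) * gauge y p"
    proof (cases "p = 0")
      case False
      have "\<bar>gauge x (sgn p) - gauge y (sgn p)\<bar> < \<delta> * a"
        using \<rho>(2)[of "(y, sgn p)" "(x, sgn p)"] d by (simp add: norm_sgn dist_Pair_Pair dist_real_def)
      moreover have "\<delta> * a \<le> \<delta> * gauge y (sgn p)"
        using a(2)[of "sgn p" y] assms False by (simp add: norm_sgn)
      ultimately have "gauge x (sgn p) \<le> (1 + \<delta>) * gauge y (sgn p)" by (simp add: algebra_simps)
      then have "norm p * gauge x (sgn p) \<le> norm p * ((1 + \<delta>) * gauge y (sgn p))" by (rule mult_left_mono) simp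
      then show ?thesis
        using gauge_scale[of "norm p" x "sgn p"] gauge_scale[of "norm p" y "sgn p"] False
        by (simp add: sgn_div_norm algebra_simps)
    qed simp
  qed
qed

section \<open>The dual norm of the gauge\<close>

definition speed :: "real^2 \<Rightarrow> real^2 \<Rightarrow> real" where
  "speed y q = (SUP p\<in>{p. gauge y p \<le> 1}. p \<bullet> q)"

text \<open>A choice operator fixes the constants once for the whole locale, so that they depend on
  the Hamiltonian alone. The reciprocals anticipate duality: an upper bound of the gauge becomes a
  lower bound of the speed.\<close>

definition lower_const :: real where
  "lower_const = (SOME c. 0 < c \<and> (\<forall>y p. gauge y p \<le> 1 / c * norm p))"

definition upper_const :: real where
  "upper_const = (SOME C. 0 < C \<and> (\<forall>y p. 1 / C * norm p \<le> gauge y p))"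

lemma lower_const: "0 < lower_const" "gauge y p \<le> 1 / lower_const * norm p"
proof -
  obtain b where "0 < b" "\<And>y p. gauge y p \<le> b * norm p" using gauge_bounds by metis
  then have "\<exists>c>0. \<forall>y p. gauge y p \<le> 1 / c * norm p" by (intro exI[of _ "1 / b"]) auto
  from someI_ex[OF this] show "0 < lower_const" "gauge y p \<le> 1 / lower_const * norm p"
    unfolding lower_const_def by auto
qed

lemma upper_const: "0 < upper_const" "1 / upper_const * norm p \<le> gauge y p"
proof -
  obtain a where "0 < a" "\<And>y p. a * norm p \<le> gauge y p" using gauge_bounds by metis
  then have "\<exists>C>0. \<forall>y p. 1 / C * norm p \<le> gauge y p" by (intro exI[of _ "1 / a"]) auto
  from someI_ex[OF this] show "0 < upper_const" "1 / upper_const * norm p \<le> gauge y p"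
    unfolding upper_const_def by auto
qed

lemma inner_le_upper:
  assumes "gauge y p \<le> 1" shows "p \<bullet> q \<le> upper_const * norm q"
proof -
  have "1 / upper_const * norm p \<le> 1" using upper_const(2)[of p y] assms by linarith
  then have "norm p \<le> upper_const" using upper_const(1) by (simp add: field_simps)
  then have "norm p * norm q \<le> upper_const * norm q" by (rule mult_right_mono) simp
  then show ?thesis using norm_cauchy_schwarz[of p q] by linarith
qed

lemma speed_upper: "gauge y p \<le> 1 \<Longrightarrow> p \<bullet> q \<le> speed y q"
  unfolding speed_def using inner_le_upper by (intro cSUP_upper bdd_aboveI2) auto

lemma speed_least: "(\<And>p. gauge y p \<le> 1 \<Longrightarrow> p \<bullet> q \<le> X) \<Longrightarrow> speed y q \<le> X"
  unfolding speed_def by (rule cSUP_least) (auto intro: exI[of _ 0])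

lemma speed_le: "speed y q \<le> upper_const * norm q"
  by (rule speed_least) (rule inner_le_upper)

lemma speed_nonneg: "0 \<le> speed y q"
  using speed_upper[of y 0 q] by simp

lemma speed_scale:
  assumes "0 \<le> r" shows "speed y (r *\<^sub>R q) = r * speed y q"
proof -
  have *: "speed y (r *\<^sub>R q) \<le> r * speed y q" if "r \<ge> 0" for r q
    using mult_left_mono[OF speed_upper that] by (intro speed_least) simp
  show ?thesis
  proof (cases "r = 0")
    case True
    then show ?thesis using *[of 0] speed_nonneg[of y "r *\<^sub>R q"] by auto
  next
    case False
    then have "speed y q \<le> 1 / r * speed y (r *\<^sub>R q)"
      using *[of "1 / r" "r *\<^sub>R q"] assms by simp
    then show ?thesis using *[OF assms, of q] False assms by (simp add: field_simps)
  qed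
qed

lemma speed_add: "speed y (q + q') \<le> speed y q + speed y q'"
  using speed_upper[of y _ q] speed_upper[of y _ q']
  by (intro speed_least) (simp add: inner_add_right add_mono)

lemma speed_lower: "lower_const * norm q \<le> speed y q"
proof (cases "q = 0")
  case False
  have "gauge y (lower_const *\<^sub>R sgn q) \<le> 1"
    using lower_const(1) lower_const(2)[of y "lower_const *\<^sub>R sgn q"] False by (simp add: norm_sgn)
  moreover have "sgn q \<bullet> q = norm q"
    using False by (simp add: sgn_div_norm dot_square_norm power2_eq_square)
  ultimately show ?thesis using speed_upper[of y "lower_const *\<^sub>R sgn q" q] by simp
qed (use speed_nonneg in simp)

lemma gauge_speed: "p \<bullet> q \<le> gauge y p * speed y q"
proof (cases "p = 0")
  case False
  then have g: "gauge y p > 0" by (rule gauge_pos)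
  have "gauge y ((1 / gauge y p) *\<^sub>R p) \<le> 1" using g gauge_scale[of "1 / gauge y p" y p] by simp
  from speed_upper[OF this, of q] show ?thesis using g by (simp add: field_simps)
qed simp

text \<open>The outer normal of a hyperplane supporting the unit sublevel set at
  \<open>p / gauge y p\<close> is the optimal direction. Convexity of the Hamiltonian enters
  here.\<close>

lemma speed_attained: "\<exists>q. speed y q = 1 \<and> p \<bullet> q = gauge y p"
proof (cases "p = 0")
  case True
  obtain e :: "real^2" where e: "norm e = 1" using norm_axis_1 by blast
  have "speed y e > 0" using speed_lower[of e y] lower_const(1) e by simp
  then show ?thesis using True speed_scale[of "1 / speed y e" y e]
    by (intro exI[of _ "(1 / speed y e) *\<^sub>R e"]) simp
next
  case False
  define S where "S = {p. gauge y p \<le> 1}"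
  \<comment> \<open>Convexity is assumed for \<open>H\<close>, not for its root, but both have the
    same unit sublevel set.\<close>
  have S: "S = {p. H y p \<le> 1}"
  proof -
    have "gauge y p \<le> 1 \<longleftrightarrow> H y p \<le> 1" for p
    proof
      assume "gauge y p \<le> 1"
      then have "gauge y p powr k \<le> 1 powr k" using k gauge_nonneg by (intro powr_mono2) auto
      then show "H y p \<le> 1" by (simp add: gauge_powr)
    next
      assume "H y p \<le> 1"
      then have "H y p powr (1 / k) \<le> 1 powr (1 / k)" using k H_nonneg by (intro powr_mono2) auto
      then show "gauge y p \<le> 1" by (simp add: gauge_def)
    qed
    then show ?thesis by (simp add: S_def)
  qed
  have cS: "convex S"
  proof (rule convexI)
    fix p q and u v :: real assume *: "p \<in> S" "q \<in> S" "0 \<le> u" "0 \<le> v" "u + v = 1"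
    have "H y (u *\<^sub>R p + v *\<^sub>R q) \<le> u * H y p + v * H y q"
      using convex[of y] * unfolding convex_on_def by blast
    also have "\<dots> \<le> u * 1 + v * 1" using * by (intro add_mono mult_left_mono) (auto simp: S)
    finally show "u *\<^sub>R p + v *\<^sub>R q \<in> S" using * by (simp add: S)
  qed
  have g: "gauge y p > 0" by (rule gauge_pos[OF False])
  define p1 where "p1 = (1 / gauge y p) *\<^sub>R p"
  have p1: "gauge y p1 = 1" using g gauge_scale[of "1 / gauge y p" y p] by (simp add: p1_def)
  have "p1 \<notin> interior S"
  proof
    assume "p1 \<in> interior S"
    then obtain e where e: "e > 0" "ball p1 e \<subseteq> S" by (meson mem_interior)
    define s where "s = e / (2 * norm p1)"
    have "p1 \<noteq> 0" using p1 by auto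
    then have s: "s > 0" "norm (s *\<^sub>R p1) = e / 2" using e by (auto simp: s_def)
    have "(1 + s) *\<^sub>R p1 = p1 + s *\<^sub>R p1" by (simp add: algebra_simps)
    then have "(1 + s) *\<^sub>R p1 \<in> ball p1 e" using s e by (simp add: dist_norm)
    then have "gauge y ((1 + s) *\<^sub>R p1) \<le> 1" using e by (auto simp: S_def)
    then show False using p1 s gauge_scale[of "1 + s" y p1] by simp
  qed
  moreover have "0 \<in> interior S"
  proof -
    have "ball 0 lower_const \<subseteq> S"
    proof
      fix q :: "real^2" assume "q \<in> ball 0 lower_const"
      then have "1 / lower_const * norm q \<le> 1" using lower_const(1) by (simp add: field_simps)
      then show "q \<in> S" using lower_const(2)[of y q] by (simp add: S_def)
    qed
    then show ?thesis using lower_const(1) by (meson mem_interior)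
  qed
  then have "rel_interior S = interior S" by (metis empty_iff rel_interior_nonempty_interior)
  ultimately have "p1 \<notin> rel_interior S" by simp
  moreover have "p1 \<in> S" using p1 by (simp add: S_def)
  ultimately obtain a where a: "a \<noteq> 0" "\<And>q. q \<in> S \<Longrightarrow> a \<bullet> p1 \<le> a \<bullet> q"
    using supporting_hyperplane_rel_boundary[OF cS] by metis
  have sp: "speed y (- a) = p1 \<bullet> (- a)"
  proof (rule antisym)
    show "speed y (- a) \<le> p1 \<bullet> (- a)"
      using a(2) by (intro speed_least) (simp add: S_def inner_commute)
    show "p1 \<bullet> (- a) \<le> speed y (- a)" using speed_upper[of y p1 "- a"] p1 by simp
  qed
  have pos: "speed y (- a) > 0"
    using speed_lower[of "- a" y] lower_const(1) a(1) by (smt (verit) norm_minus_cancel mult_pos_pos zero_less_norm_iff)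
  \<comment> \<open>The supporting functional \<open>a\<close> is smallest at \<open>p1\<close>, so
    its negative points outwards; normalization makes the speed 1.\<close>
  define q where "q = (1 / speed y (- a)) *\<^sub>R (- a)"
  have "speed y q = 1" using pos speed_scale[of "1 / speed y (- a)" y "- a"] by (simp add: q_def)
  moreover have "p1 \<bullet> q = 1 / speed y (- a) * (p1 \<bullet> (- a))" unfolding q_def by (rule inner_scaleR_right)
  then have "p1 \<bullet> q = 1" using pos unfolding sp[symmetric] by simp
  then have "1 / gauge y p * (p \<bullet> q) = 1" by (simp add: p1_def)
  then have "p \<bullet> q = gauge y p" using g by (simp add: field_simps)
  ultimately show ?thesis by blast
qed

lemma speed_oscillation:
  assumes "\<delta> > 0"
  obtains \<rho> where "\<rho> > 0" "\<And>x y q. dist x y < \<rho> \<Longrightarrow> speed x q \<le> (1 + \<delta>) * speed y q"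
proof -
  obtain \<rho> where \<rho>: "\<rho> > 0" "\<And>x y p. dist x y < \<rho> \<Longrightarrow> gauge x p \<le> (1 + \<delta>) * gauge y p"
    using gauge_oscillation[OF assms] by metis
  show thesis
  proof (rule that[OF \<rho>(1)])
    fix x y q :: "real^2" assume d: "dist x y < \<rho>"
    show "speed x q \<le> (1 + \<delta>) * speed y q"
    proof (rule speed_least)
      fix p assume p: "gauge x p \<le> 1"
      have "gauge y p \<le> (1 + \<delta>) * gauge x p" using \<rho>(2)[of y x p] d by (simp add: dist_commute)
      also have "\<dots> \<le> 1 + \<delta>" using p assms by (simp add: mult_left_le)
      finally have "gauge y p * speed y q \<le> (1 + \<delta>) * speed y q"
        using speed_nonneg by (rule mult_right_mono)
      then show "p \<bullet> q \<le> (1 + \<delta>) * speed y q" using gauge_speed[of p q y] by linarith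
    qed
  qed
qed

lemma speed_periodic: "lattice_point m \<Longrightarrow> speed (y + m) q = speed y q"
  using Z2_periodicD[OF gauge_periodic] by (simp add: speed_def)

text \<open>The largest speed on the segment in place of the integral of the speed, so that nothing
  has to be integrated. Subdividing a segment cannot raise the total, by
  \<open>cost_linepath\<close>, and short chains see nearly constant speeds; hence the infimum over
  chains still has \<open>speed\<close> as its infinitesimal form.\<close>

definition cost :: "real^2 \<Rightarrow> real^2 \<Rightarrow> real" where
  "cost a b = (SUP z\<in>closed_segment a b. speed z (b - a))"

lemma cost_upper: "z \<in> closed_segment a b \<Longrightarrow> speed z (b - a) \<le> cost a b"
  unfolding cost_def using speed_le by (intro cSUP_upper bdd_aboveI2) auto

lemma cost_least: "(\<And>z. z \<in> closed_segment a b \<Longrightarrow> speed z (b - a) \<le> X) \<Longrightarrow> cost a b \<le> X"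
  unfolding cost_def by (rule cSUP_least) auto

lemma cost_le: "cost a b \<le> upper_const * norm (b - a)"
  by (rule cost_least) (rule speed_le)

lemma cost_lower: "lower_const * norm (b - a) \<le> cost a b"
  using speed_lower[of "b - a" a] cost_upper[of a a b] by simp

lemma cost_nonneg: "0 \<le> cost a b"
  using speed_nonneg[of a "b - a"] cost_upper[of a a b] by simp

lemma cost_linepath:
  assumes "0 \<le> s" "s \<le> t" "t \<le> 1"
  shows "cost (linepath a b s) (linepath a b t) \<le> (t - s) * cost a b"
proof (rule cost_least)
  have lp: "linepath a b r \<in> closed_segment a b" if "0 \<le> r" "r \<le> 1" for r
    using that by (auto simp: linepath_image_01[symmetric])
  fix z assume "z \<in> closed_segment (linepath a b s) (linepath a b t)"
  then have "z \<in> closed_segment a b"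
    using lp[of s] lp[of t] assms by (meson closed_segment_subset convex_closed_segment in_mono order_trans)
  then have "(t - s) * speed z (b - a) \<le> (t - s) * cost a b"
    using assms by (intro mult_left_mono cost_upper) auto
  moreover have "linepath a b t - linepath a b s = (t - s) *\<^sub>R (b - a)"
    by (simp add: linepath_def algebra_simps)
  ultimately show "speed z (linepath a b t - linepath a b s) \<le> (t - s) * cost a b"
    using assms by (simp add: speed_scale)
qed

lemma cost_periodic:
  assumes "lattice_point m" shows "cost (a + m) (b + m) = cost a b"
proof -
  have "closed_segment (a + m) (b + m) = (\<lambda>z. z + m) ` closed_segment a b"
    using closed_segment_translation[of m a b] by (simp add: add.commute)
  then show ?thesis using assms by (simp add: cost_def image_image speed_periodic)
qed

section \<open>Polygonal chains and the distance they define\<close>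

inductive chain :: "real^2 \<Rightarrow> real^2 \<Rightarrow> real \<Rightarrow> bool" for x where
  chain_refl: "chain x x 0"
| chain_step: "chain x y l \<Longrightarrow> chain x z (l + cost y z)"

lemma chain_trans:
  assumes "chain y z l'" "chain x y l" shows "chain x z (l + l')"
  using assms
proof (induction rule: chain.induct)
  case (chain_step y' l' z)
  then show ?case using chain.chain_step[of x y' "l + l'" z] by (simp add: add.assoc)
qed simp

lemma chain_lower: "chain x y l \<Longrightarrow> lower_const * norm (y - x) \<le> l"
proof (induction rule: chain.induct)
  case (chain_step y l z)
  have "lower_const * norm (z - x) \<le> lower_const * (norm (y - x) + norm (z - y))"
    using lower_const(1) norm_triangle_ineq[of "y - x" "z - y"] by (intro mult_left_mono) auto
  then show ?case using chain_step cost_lower[of z y] by (simp add: algebra_simps)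
qed simp

lemma chain_nonneg: "chain x y l \<Longrightarrow> 0 \<le> l"
  using chain_lower lower_const(1) by (meson mult_nonneg_nonneg norm_ge_zero order_trans less_imp_le)

lemma chain_cost: "chain x y (cost x y)"
  using chain_step[OF chain_refl, of x y] by simp

definition distance :: "real^2 \<Rightarrow> real^2 \<Rightarrow> real" where
  "distance x y = Inf {l. chain x y l}"

lemma distance_le: "chain x y l \<Longrightarrow> distance x y \<le> l"
  unfolding distance_def using chain_nonneg by (intro cInf_lower bdd_belowI[of _ 0]) auto

lemma distance_greatest: "(\<And>l. chain x y l \<Longrightarrow> X \<le> l) \<Longrightarrow> X \<le> distance x y"
  unfolding distance_def using chain_cost by (intro cInf_greatest) auto

lemma distance_near:
  assumes "e > 0" obtains l where "chain x y l" "l < distance x y + e"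
proof (rule ccontr)
  assume "\<not> thesis"
  then have "distance x y + e \<le> distance x y" using that by (intro distance_greatest) (meson not_less)
  with assms show False by simp
qed

lemma distance_lower: "lower_const * norm (y - x) \<le> distance x y"
  by (rule distance_greatest) (rule chain_lower)

lemma distance_le_cost: "distance x y \<le> cost x y"
  by (rule distance_le) (rule chain_cost)

lemma distance_upper: "distance x y \<le> upper_const * norm (y - x)"
  using distance_le_cost cost_le by (rule order_trans)

lemma distance_self [simp]: "distance x x = 0"
  using distance_lower[of x x] distance_upper[of x x] by simp

lemma distance_triangle: "distance x z \<le> distance x y + distance y z"
proof -
  have "distance x z - distance x y \<le> distance y z"
  proof (rule distance_greatest)
    fix l' assume l': "chain y z l'"
    have "distance x z - l' \<le> distance x y"
    proof (rule distance_greatest)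
      fix l assume "chain x y l"
      from distance_le[OF chain_trans[OF l' this]] show "distance x z - l' \<le> l" by simp
    qed
    then show "distance x z - distance x y \<le> l'" by simp
  qed
  then show ?thesis by simp
qed

lemma chain_periodic: "chain x y l \<Longrightarrow> lattice_point m \<Longrightarrow> chain (x + m) (y + m) l"
proof (induction rule: chain.induct)
  case (chain_step y l z)
  then show ?case using chain.chain_step[of "x + m" "y + m" l "z + m"] by (simp add: cost_periodic)
qed (rule chain.chain_refl)

lemma distance_periodic:
  assumes "lattice_point m" shows "distance (x + m) (y + m) = distance x y"
proof -
  have *: "distance (x + m) (y + m) \<le> distance x y" if "lattice_point m" for x y m
    using that by (intro distance_greatest distance_le chain_periodic)
  show ?thesis using *[OF assms, of x y] *[of "- m" "x + m" "y + m"] assms by simp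
qed

text \<open>Any two parameters cut the path into three pieces whose endpoint distances add up to at
  most the cost of the chain. This inequality stands in for arc length.\<close>

lemma chain_path:
  assumes "chain x y l"
  shows "\<exists>\<gamma>. path \<gamma> \<and> \<gamma> 0 = x \<and> \<gamma> 1 = y \<and> (\<forall>a b. 0 \<le> a \<longrightarrow> a \<le> b \<longrightarrow> b \<le> 1 \<longrightarrow>
    distance x (\<gamma> a) + distance (\<gamma> a) (\<gamma> b) + distance (\<gamma> b) y \<le> l)"
  using assms
proof (induction rule: chain.induct)
  case chain_refl
  show ?case by (intro exI[of _ "\<lambda>_. x"]) (simp add: path_def)
next
  case (chain_step y l z)
  then obtain \<gamma> where \<gamma>: "path \<gamma>" "\<gamma> 0 = x" "\<gamma> 1 = y" and le: "\<And>a b. 0 \<le> a \<Longrightarrow> a \<le> b \<Longrightarrow> b \<le> 1 \<Longrightarrow>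
      distance x (\<gamma> a) + distance (\<gamma> a) (\<gamma> b) + distance (\<gamma> b) y \<le> l" by blast
  let ?l = "linepath y z" and ?\<gamma> = "\<gamma> +++ linepath y z"
  have yz: "distance (?l s) (?l t) \<le> (t - s) * cost y z" if "0 \<le> s" "s \<le> t" "t \<le> 1" for s t
    using distance_le_cost cost_linepath[OF that] by (rule order_trans)
  have y: "distance y (?l t) \<le> t * cost y z" if "0 \<le> t" "t \<le> 1" for t
    using yz[of 0 t] that by (simp add: linepath_def)
  have z: "distance (?l t) z \<le> (1 - t) * cost y z" if "0 \<le> t" "t \<le> 1" for t
    using yz[of t 1] that by (simp add: linepath_def)
  have xy: "distance x y \<le> l" using le[of 0 0] \<gamma> by simp
  show ?case
  proof (intro exI[of _ ?\<gamma>] conjI allI impI)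
    show "path ?\<gamma>" using \<gamma> by (intro path_join_imp) (auto simp: pathfinish_def)
    show "?\<gamma> 0 = x" "?\<gamma> 1 = z" using \<gamma> by (auto simp: joinpaths_def linepath_def)
    fix a b :: real assume ab: "0 \<le> a" "a \<le> b" "b \<le> 1"
    consider "b \<le> 1 / 2" | "a \<le> 1 / 2" "b > 1 / 2" | "a > 1 / 2" using ab by linarith
    then show "distance x (?\<gamma> a) + distance (?\<gamma> a) (?\<gamma> b) + distance (?\<gamma> b) z \<le> l + cost y z"
    proof cases
      case 1
      have "distance (\<gamma> (2 * b)) z \<le> distance (\<gamma> (2 * b)) y + cost y z"
        using distance_triangle[of "\<gamma> (2 * b)" z y] distance_le_cost[of y z] by simp
      then show ?thesis using 1 ab le[of "2 * a" "2 * b"] by (simp add: joinpaths_def)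
    next
      case 2
      let ?t = "2 * b - 1"
      have "distance (\<gamma> (2 * a)) (?l ?t) \<le> distance (\<gamma> (2 * a)) y + ?t * cost y z"
        using distance_triangle[of "\<gamma> (2 * a)" "?l ?t" y] y[of ?t] 2 ab by simp
      then show ?thesis using 2 ab le[of "2 * a" 1] z[of ?t] \<gamma>(3) by (simp add: joinpaths_def algebra_simps)
    next
      case 3
      let ?s = "2 * a - 1" and ?t = "2 * b - 1"
      have "distance x (?l ?s) \<le> l + ?s * cost y z"
        using distance_triangle[of x "?l ?s" y] y[of ?s] xy 3 ab by simp
      then show ?thesis using 3 ab yz[of ?s ?t] z[of ?t] by (simp add: joinpaths_def algebra_simps)
    qed
  qed
qed

lemma almost_geodesic:
  assumes "e > 0"
  obtains \<gamma> where "path \<gamma>" "\<gamma> 0 = x" "\<gamma> 1 = y" "\<And>a b. 0 \<le> a \<Longrightarrow> a \<le> b \<Longrightarrow> b \<le> 1 \<Longrightarrow>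
    distance x (\<gamma> a) + distance (\<gamma> a) (\<gamma> b) + distance (\<gamma> b) y \<le> distance x y + e"
proof -
  obtain l where l: "chain x y l" "l < distance x y + e" using distance_near[OF assms] by metis
  from chain_path[OF l(1)] obtain \<gamma> where "path \<gamma>" "\<gamma> 0 = x" "\<gamma> 1 = y"
    and le: "\<And>a b. 0 \<le> a \<Longrightarrow> a \<le> b \<Longrightarrow> b \<le> 1 \<Longrightarrow>
      distance x (\<gamma> a) + distance (\<gamma> a) (\<gamma> b) + distance (\<gamma> b) y \<le> l" by blast
  then show thesis using that[of \<gamma>] l(2) by (meson order_trans less_imp_le)
qed

lemma distance_Lipschitz: "upper_const-lipschitz_on U (distance x)" "upper_const-lipschitz_on U (\<lambda>y. distance y x)"
proof -
  have 1: "distance x y \<le> distance x z + upper_const * dist y z" for y z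
    using distance_triangle[of x y z] distance_upper[of z y] by (simp add: dist_norm)
  have 2: "distance y x \<le> distance z x + upper_const * dist y z" for y z
    using distance_triangle[of y x z] distance_upper[of y z] by (simp add: dist_norm norm_minus_commute)
  show "upper_const-lipschitz_on U (distance x)" "upper_const-lipschitz_on U (\<lambda>y. distance y x)"
    using upper_const(1) 1 2
    by (auto intro!: lipschitz_onI simp: dist_real_def abs_le_iff) (smt (verit) dist_commute)+
qed

text \<open>Intermediate value theorem for the distance from \<open>x\<close> along an almost
  geodesic; near-additivity then controls the rest of the way.\<close>

lemma distance_between:
  assumes "0 \<le> \<theta>" "\<theta> \<le> 1" "0 < \<delta>"
  shows "\<exists>z. distance x z \<le> \<theta> * distance x y + \<delta> \<and> distance z y \<le> (1 - \<theta>) * distance x y + \<delta>"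
proof -
  obtain \<gamma> where \<gamma>: "path \<gamma>" "\<gamma> 0 = x" "\<gamma> 1 = y" and le: "\<And>a b. 0 \<le> a \<Longrightarrow> a \<le> b \<Longrightarrow> b \<le> 1 \<Longrightarrow>
      distance x (\<gamma> a) + distance (\<gamma> a) (\<gamma> b) + distance (\<gamma> b) y \<le> distance x y + \<delta>"
    using almost_geodesic[OF assms(3)] by metis
  have d: "0 \<le> distance x y" using chain_nonneg by (intro distance_greatest)
  have "continuous_on {0..1} (\<lambda>t. distance x (\<gamma> t))"
    by (rule continuous_on_compose2[OF lipschitz_on_continuous_on[OF distance_Lipschitz(1)[of UNIV]]])
      (use \<gamma> in \<open>auto simp: path_def\<close>)
  then obtain t where t: "0 \<le> t" "t \<le> 1" "distance x (\<gamma> t) = \<theta> * distance x y"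
    using IVT'[of "\<lambda>t. distance x (\<gamma> t)" 0 "\<theta> * distance x y" 1] \<gamma> assms d by (auto simp: mult_left_le_one_le)
  then show ?thesis using le[of t t] assms by (intro exI[of _ "\<gamma> t"]) (simp add: algebra_simps)
qed

section \<open>First-order behaviour of the distance\<close>

lemma distance_tangent_upper:
  assumes "0 < \<delta>"
  shows "\<forall>\<^sub>F s in at_right 0. distance (x - s *\<^sub>R q) x \<le> s * (speed x q + \<delta>)"
proof -
  \<comment> \<open>A relative error, scaled so that it amounts to at most \<open>\<delta>\<close>
    at speed \<open>speed x q\<close>; the summand 1 excludes a zero denominator.\<close>
  define \<delta>' where "\<delta>' = \<delta> / (speed x q + 1)"
  have \<delta>': "\<delta>' > 0" "\<delta>' * speed x q \<le> \<delta>"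
    using assms speed_nonneg[of x q] by (auto simp: \<delta>'_def field_simps add_nonneg_pos)
  obtain \<rho> where \<rho>: "\<rho> > 0" "\<And>x y q. dist x y < \<rho> \<Longrightarrow> speed x q \<le> (1 + \<delta>') * speed y q"
    using speed_oscillation[OF \<delta>'(1)] by metis
  have "\<forall>\<^sub>F s in at_right 0. s \<in> {0<..<\<rho> / (norm q + 1)}"
    using \<rho>(1) by (intro eventually_at_right_real) (simp add: add_nonneg_pos)
  then show ?thesis
  proof eventually_elim
    case (elim s)
    then have "s * (norm q + 1) < \<rho>" by (simp add: pos_less_divide_eq add_nonneg_pos)
    with elim have s: "0 < s" "s * norm q < \<rho>" by (auto simp: algebra_simps)
    have "cost (x - s *\<^sub>R q) x \<le> s * (speed x q + \<delta>)"
    proof (rule cost_least)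
      fix z assume "z \<in> closed_segment (x - s *\<^sub>R q) x"
      then have "dist z x \<le> norm (s *\<^sub>R q)"
        using dist_in_closed_segment[of z "x - s *\<^sub>R q" x] by (simp add: dist_norm norm_minus_commute)
      then have "speed z q \<le> (1 + \<delta>') * speed x q" using s by (intro \<rho>(2)) simp
      then have "speed z q \<le> speed x q + \<delta>" using \<delta>'(2) by (simp add: algebra_simps)
      then have "s * speed z q \<le> s * (speed x q + \<delta>)" using s by simp
      then show "speed z (x - (x - s *\<^sub>R q)) \<le> s * (speed x q + \<delta>)" using s by (simp add: speed_scale)
    qed
    then show ?case using distance_le_cost order_trans by blast
  qed
qed

text \<open>A chain of cost below \<open>lower_const * \<rho>\<close> cannot leave the ball of
  radius \<open>\<rho>\<close>. There the speed frozen at \<open>x\<close> is comparable with the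
  true one, and its subadditivity replaces the chain by its chord.\<close>

lemma chain_local:
  assumes "\<And>z q. dist z y < \<rho> \<Longrightarrow> speed x q \<le> (1 + \<delta>) * speed z q" and "\<delta> \<ge> 0"
  shows "chain y z l \<Longrightarrow> l < lower_const * \<rho> \<Longrightarrow> speed x (z - y) \<le> (1 + \<delta>) * l"
proof (induction rule: chain.induct)
  case (chain_step z' l z)
  have l: "l < lower_const * \<rho>" using chain_step.prems cost_nonneg[of z' z] by linarith
  have "lower_const * norm (z' - y) < lower_const * \<rho>"
    using chain_lower[OF chain_step.hyps] l by linarith
  then have "dist z' y < \<rho>" using lower_const(1) by (simp add: dist_norm)
  then have "speed x (z - z') \<le> (1 + \<delta>) * speed z' (z - z')" by (rule assms(1))
  also have "\<dots> \<le> (1 + \<delta>) * cost z' z" using cost_upper[of z' z' z] assms(2) by (intro mult_left_mono) auto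
  finally show ?case
    using speed_add[of x "z' - y" "z - z'"] chain_step.IH[OF l] by (simp add: algebra_simps)
qed (use speed_scale[of 0 x 0] in simp)

text \<open>A cheap chain stays close to \<open>x\<close> and is handled by
  \<open>chain_local\<close>; an expensive one already costs more than the upper bound for the
  straight segment, because \<open>y\<close> is close enough to \<open>x\<close>.\<close>

lemma distance_tangent_lower:
  assumes "0 < \<delta>"
  shows "\<forall>\<^sub>F y in nhds x. speed x (x - y) - \<delta> * norm (x - y) \<le> distance y x"
proof -
  define \<delta>' where "\<delta>' = \<delta> / upper_const"
  have \<delta>': "\<delta>' > 0" "\<delta>' * upper_const = \<delta>" using assms upper_const(1) by (auto simp: \<delta>'_def)
  obtain \<rho> where \<rho>: "\<rho> > 0" "\<And>x y q. dist x y < \<rho> \<Longrightarrow> speed x q \<le> (1 + \<delta>') * speed y q"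
    using speed_oscillation[OF \<delta>'(1)] by metis
  define r where "r = min (\<rho> / 2) (lower_const * \<rho> / (2 * upper_const))"
  have "r > 0" using \<rho> lower_const(1) upper_const(1) by (simp add: r_def)
  moreover have "speed x (x - y) - \<delta> * norm (x - y) \<le> distance y x" if y: "dist y x < r" for y
  proof -
    have small: "upper_const * norm (x - y) \<le> lower_const * (\<rho> / 2)"
      using y upper_const(1) by (simp add: r_def dist_norm norm_minus_commute field_simps)
    have "speed x (x - y) / (1 + \<delta>') \<le> distance y x"
    proof (rule distance_greatest)
      fix l assume l: "chain y x l"
      show "speed x (x - y) / (1 + \<delta>') \<le> l"
      proof (cases "l < lower_const * (\<rho> / 2)")
        case True
        have "speed x (x - y) \<le> (1 + \<delta>') * l"
        proof (rule chain_local[OF _ _ l True])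
          fix z q assume "dist z y < \<rho> / 2"
          then have "dist x z < \<rho>" using y dist_triangle[of x z y] by (simp add: r_def dist_commute)
          then show "speed x q \<le> (1 + \<delta>') * speed z q" by (rule \<rho>(2))
        qed (use \<delta>' in simp)
        then show ?thesis using \<delta>' by (simp add: field_simps add_pos_pos)
      next
        case False
        have "speed x (x - y) / (1 + \<delta>') \<le> speed x (x - y)"
          using \<delta>'(1) speed_nonneg[of x "x - y"] by (simp add: field_simps add_pos_pos)
        then show ?thesis using False small speed_le[of x "x - y"] by linarith
      qed
    qed
    then have "speed x (x - y) \<le> distance y x + \<delta>' * distance y x"
      using \<delta>'(1) by (simp add: field_simps add_pos_pos)
    moreover have "\<delta>' * distance y x \<le> \<delta>' * (upper_const * norm (x - y))"
      using \<delta>'(1) distance_upper by (intro mult_left_mono) auto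
    moreover have "\<delta>' * (upper_const * norm (x - y)) = \<delta> * norm (x - y)"
      using \<delta>'(2) by (metis mult.assoc)
    ultimately show ?thesis by linarith
  qed
  ultimately show ?thesis unfolding eventually_nhds_metric by blast
qed

sublocale Finsler_distance distance speed gauge lower_const upper_const
  by unfold_locales
    (fact lower_const(1) distance_triangle distance_lower distance_upper distance_between
      distance_tangent_upper distance_tangent_lower speed_scale speed_lower gauge_nonneg
      gauge_speed speed_attained)+

end

section \<open>The stable norm and the effective Hamiltonian\<close>

lemma continuous_periodic_bounded:
  fixes v :: "real^2 \<Rightarrow> real"
  assumes "continuous_on UNIV v" "Z2_periodic v"
  obtains B where "\<And>y. \<bar>v y\<bar> \<le> B"
proof -
  have "compact (v ` cbox 0 1)"
    by (intro compact_continuous_image continuous_on_subset[OF assms(1)]) auto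
  then have "bounded (v ` cbox 0 1)" by (rule compact_imp_bounded)
  then obtain B where B: "\<And>y. y \<in> cbox 0 1 \<Longrightarrow> \<bar>v y\<bar> \<le> B"
    unfolding bounded_iff by (metis imageI real_norm_def)
  have "\<bar>v y\<bar> \<le> B" for y
    using B[OF frac_vec_in_cbox, of y] Z2_periodic_frac[OF assms(2)] by simp
  then show thesis by (rule that)
qed

lemma limit_of_halving_steps:
  fixes f :: "nat \<Rightarrow> real"
  assumes "\<And>n. \<bar>f (Suc n) - f n\<bar> \<le> K / 2 ^ Suc n"
  shows "\<exists>l. f \<longlonglongrightarrow> l \<and> \<bar>l - f 0\<bar> \<le> K"
proof -
  have "(\<lambda>n. K * (1 / 2) ^ Suc n) sums (K * 1)"
    by (rule sums_mult[OF power_half_series])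
  then have sK: "(\<Sum>n. K * (1 / 2) ^ Suc n) = K" "summable (\<lambda>n. K * (1 / 2) ^ Suc n)"
    by (simp_all add: sums_iff)
  have K: "K * (1 / 2) ^ Suc n = K / 2 ^ Suc n" for n by (simp add: power_divide)
  have 1: "norm (f (Suc n) - f n) \<le> K * (1 / 2) ^ Suc n" for n using assms[of n] K[of n] by simp
  have s: "summable (\<lambda>n. f (Suc n) - f n)"
    by (rule summable_comparison_test[OF _ sK(2)]) (use 1 in blast)
  have "(\<lambda>n. \<Sum>i<n. f (Suc i) - f i) \<longlonglongrightarrow> (\<Sum>n. f (Suc n) - f n)"
    using s by (rule summable_LIMSEQ)
  then have "(\<lambda>n. f 0 + (f n - f 0)) \<longlonglongrightarrow> f 0 + (\<Sum>n. f (Suc n) - f n)"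
    unfolding sum_lessThan_telescope by (intro tendsto_intros)
  then have "f \<longlonglongrightarrow> f 0 + (\<Sum>n. f (Suc n) - f n)" by simp
  moreover have "\<bar>\<Sum>n. f (Suc n) - f n\<bar> \<le> K"
    using norm_suminf_le[OF 1 sK(2)] sK(1) by simp
  ultimately show ?thesis by (intro exI[of _ "f 0 + (\<Sum>n. f (Suc n) - f n)"]) simp
qed

context homogeneous_Hamiltonian
begin

text \<open>Translation by the integer part of \<open>x\<close> moves the start into the unit cell,
  at norm at most 2 from the origin. Shifting each of the two endpoints then costs at most
  \<open>2 * upper_const\<close>.\<close>

lemma distance_shift: "\<bar>distance x y - distance 0 (y - x)\<bar> \<le> 4 * upper_const"
proof -
  define m where "m = floor_vec x"
  have d: "distance x y = distance (x - m) (y - m)"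
    using distance_periodic[of "- m" x y] by (simp add: m_def)
  have n: "upper_const * norm (x - m) \<le> 2 * upper_const"
    using upper_const(1) norm_frac_vec[of x] by (simp add: m_def)
  have s: "distance (x - m) 0 \<le> 2 * upper_const" "distance 0 (x - m) \<le> 2 * upper_const"
    "distance (y - x) (y - m) \<le> 2 * upper_const" "distance (y - m) (y - x) \<le> 2 * upper_const"
    using distance_upper[of "x - m" 0] distance_upper[of 0 "x - m"]
      distance_upper[of "y - x" "y - m"] distance_upper[of "y - m" "y - x"] n
    by (simp_all add: norm_minus_commute)
  show ?thesis
    using s distance_triangle[of "x - m" "y - m" 0] distance_triangle[of 0 "y - m" "y - x"]
      distance_triangle[of 0 "y - x" "x - m"] distance_triangle[of "x - m" "y - x" "y - m"]
    unfolding d by linarith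
qed

lemma distance_0_add: "distance 0 (v + w) \<le> distance 0 v + distance 0 w + 4 * upper_const"
  using distance_triangle[of 0 "v + w" v] distance_shift[of v "v + w"] by simp

text \<open>Removing from an almost minimal path from \<open>0\<close> to \<open>2 v\<close> a piece with increment \<open>v\<close>
  and closing the gap leaves another path with increment \<open>v\<close>.\<close>

lemma distance_0_double: "\<bar>distance 0 (2 *\<^sub>R v) - 2 * distance 0 v\<bar> \<le> 12 * upper_const"
proof -
  have "2 * distance 0 v \<le> distance 0 (2 *\<^sub>R v) + 12 * upper_const"
  proof (rule field_le_epsilon)
    fix e :: real assume "e > 0"
    from almost_geodesic[OF this, of 0 "2 *\<^sub>R v"] obtain \<gamma> where
      \<gamma>: "path \<gamma>" "\<gamma> 0 = 0" "\<gamma> 1 = 2 *\<^sub>R v" and le: "\<And>a b. 0 \<le> a \<Longrightarrow> a \<le> b \<Longrightarrow> b \<le> 1 \<Longrightarrow>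
        distance 0 (\<gamma> a) + distance (\<gamma> a) (\<gamma> b) + distance (\<gamma> b) (2 *\<^sub>R v) \<le> distance 0 (2 *\<^sub>R v) + e"
      by metis
    obtain a b where ab: "0 \<le> a" "a \<le> b" "b \<le> 1" "2 *\<^sub>R (\<gamma> b - \<gamma> a) = \<gamma> 1 - \<gamma> 0"
      using half_chord[of \<gamma>] \<gamma>(1) by (auto simp: path_def)
    have v: "\<gamma> b - \<gamma> a = v" using ab(4) \<gamma> by simp
    then have v': "2 *\<^sub>R v - \<gamma> b = v - \<gamma> a" by (simp add: algebra_simps scaleR_2)
    \<comment> \<open>Three errors of \<open>4 * upper_const\<close>: moving the middle piece to the
      origin, moving the last piece to the origin, and joining the first and last pieces into one
      connection with increment \<open>v\<close>.\<close>
    show "2 * distance 0 v \<le> distance 0 (2 *\<^sub>R v) + 12 * upper_const + e"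
      using le[OF ab(1-3)] distance_shift[of "\<gamma> a" "\<gamma> b"] distance_shift[of "\<gamma> b" "2 *\<^sub>R v"]
        distance_0_add[of "\<gamma> a" "v - \<gamma> a"] unfolding v v' by simp
  qed
  moreover have "distance 0 (2 *\<^sub>R v) \<le> 2 * distance 0 v + 4 * upper_const"
    using distance_0_add[of v v] by (simp add: scaleR_2)
  ultimately show ?thesis using upper_const(1) by simp
qed

text \<open>Only dyadic multiples are used: consecutive terms then differ by at most
  \<open>12 * upper_const / 2 ^ Suc n\<close>, and the geometric series gives convergence together
  with a bounded total error.\<close>

definition stable_norm :: "real^2 \<Rightarrow> real" where
  "stable_norm v = lim (\<lambda>n. distance 0 (2 ^ n *\<^sub>R v) / 2 ^ n)"

lemma stable_norm_limit: "(\<lambda>n. distance 0 (2 ^ n *\<^sub>R v) / 2 ^ n) \<longlonglongrightarrow> stable_norm v"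
  and stable_norm_near: "\<bar>stable_norm v - distance 0 v\<bar> \<le> 12 * upper_const"
proof -
  let ?f = "\<lambda>n. distance 0 (2 ^ n *\<^sub>R v) / 2 ^ n"
  have "\<bar>?f (Suc n) - ?f n\<bar> \<le> 12 * upper_const / 2 ^ Suc n" for n
  proof -
    have eq: "?f (Suc n) - ?f n = (distance 0 (2 *\<^sub>R (2 ^ n *\<^sub>R v)) - 2 * distance 0 (2 ^ n *\<^sub>R v)) / 2 ^ Suc n"
      by (simp add: diff_divide_distrib)
    have "\<bar>?f (Suc n) - ?f n\<bar> =
        \<bar>distance 0 (2 *\<^sub>R (2 ^ n *\<^sub>R v)) - 2 * distance 0 (2 ^ n *\<^sub>R v)\<bar> / 2 ^ Suc n"
      unfolding eq abs_divide by simp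
    also have "\<dots> \<le> 12 * upper_const / 2 ^ Suc n"
      by (intro divide_right_mono distance_0_double) simp
    finally show ?thesis .
  qed
  from limit_of_halving_steps[of ?f, OF this] obtain l where
    l: "?f \<longlonglongrightarrow> l" "\<bar>l - ?f 0\<bar> \<le> 12 * upper_const" by blast
  from l(1) have "stable_norm v = l" unfolding stable_norm_def by (rule limI)
  with l show "?f \<longlonglongrightarrow> stable_norm v" "\<bar>stable_norm v - distance 0 v\<bar> \<le> 12 * upper_const" by simp_all
qed

text \<open>The 16 is 4 from translating the starting point to the origin plus 12 from the doubling
  series. It reappears as the factor in the final rate.\<close>

lemma distance_stable_norm: "\<bar>distance x y - stable_norm (y - x)\<bar> \<le> 16 * upper_const"
  using distance_shift[of x y] stable_norm_near[of "y - x"] by linarith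

lemma stable_norm_lower: "lower_const * norm v \<le> stable_norm v"
proof (rule LIMSEQ_le_const[OF stable_norm_limit], intro exI allI impI)
  fix n :: nat
  show "lower_const * norm v \<le> distance 0 (2 ^ n *\<^sub>R v) / 2 ^ n"
    using distance_lower[of "2 ^ n *\<^sub>R v" 0] by (simp add: field_simps)
qed

lemma stable_norm_upper: "stable_norm v \<le> upper_const * norm v"
proof (rule LIMSEQ_le_const2[OF stable_norm_limit], intro exI allI impI)
  fix n :: nat
  show "distance 0 (2 ^ n *\<^sub>R v) / 2 ^ n \<le> upper_const * norm v"
    using distance_upper[of 0 "2 ^ n *\<^sub>R v"] by (simp add: field_simps)
qed

lemma stable_norm_nonneg: "0 \<le> stable_norm v"
  using stable_norm_lower[of v] lower_const(1) by (smt (verit) mult_nonneg_nonneg norm_ge_zero)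

lemma stable_norm_0 [simp]: "stable_norm 0 = 0"
  using stable_norm_lower[of 0] stable_norm_upper[of 0] by simp

lemma stable_norm_add: "stable_norm (v + w) \<le> stable_norm v + stable_norm w"
proof (rule LIMSEQ_le[OF stable_norm_limit])
  have "(\<lambda>n. 4 * upper_const * (1 / 2) ^ n) \<longlonglongrightarrow> 4 * upper_const * 0"
    by (intro tendsto_mult_left LIMSEQ_power_zero) simp
  then have "(\<lambda>n. 4 * upper_const / 2 ^ n) \<longlonglongrightarrow> 0" by (simp add: power_divide)
  from tendsto_add[OF tendsto_add[OF stable_norm_limit[of v] stable_norm_limit[of w]] this]
  show "(\<lambda>n. distance 0 (2 ^ n *\<^sub>R v) / 2 ^ n + distance 0 (2 ^ n *\<^sub>R w) / 2 ^ n + 4 * upper_const / 2 ^ n)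
      \<longlonglongrightarrow> stable_norm v + stable_norm w" by simp
  show "\<exists>N. \<forall>n\<ge>N. distance 0 (2 ^ n *\<^sub>R (v + w)) / 2 ^ n
      \<le> distance 0 (2 ^ n *\<^sub>R v) / 2 ^ n + distance 0 (2 ^ n *\<^sub>R w) / 2 ^ n + 4 * upper_const / 2 ^ n"
    using distance_0_add by (intro exI allI impI)
      (simp add: scaleR_add_right add_divide_distrib[symmetric] divide_right_mono)
qed

lemma stable_norm_double: "stable_norm (2 *\<^sub>R v) = 2 * stable_norm v"
proof (rule LIMSEQ_unique[OF stable_norm_limit])
  from tendsto_mult_left[OF LIMSEQ_Suc[OF stable_norm_limit[of v]], of 2]
  show "(\<lambda>n. distance 0 (2 ^ n *\<^sub>R 2 *\<^sub>R v) / 2 ^ n) \<longlonglongrightarrow> 2 * stable_norm v"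
    by (simp add: mult.commute)
qed

lemma stable_norm_power: "stable_norm (2 ^ n *\<^sub>R v) = 2 ^ n * stable_norm v"
proof (induction n)
  case (Suc n)
  have "stable_norm (2 ^ Suc n *\<^sub>R v) = stable_norm (2 *\<^sub>R (2 ^ n *\<^sub>R v))" by simp
  also have "\<dots> = 2 ^ Suc n * stable_norm v" unfolding stable_norm_double Suc by simp
  finally show ?case .
qed simp

lemma stable_norm_of_nat: "stable_norm (of_nat n *\<^sub>R v) \<le> of_nat n * stable_norm v"
proof (induction n)
  case (Suc n)
  then show ?case
    using stable_norm_add[of v "of_nat n *\<^sub>R v"] by (simp add: algebra_simps)
qed simp

text \<open>The definition yields homogeneity for powers of 2 only. Rounding
  \<open>2 ^ m * r\<close> down to a natural number leaves an error of at most
  \<open>upper_const * norm v / 2 ^ m\<close>; applying the resulting inequality to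
  \<open>1 / r\<close> gives its converse.\<close>

lemma stable_norm_scale:
  assumes "0 \<le> r" shows "stable_norm (r *\<^sub>R v) = r * stable_norm v"
proof -
  have *: "stable_norm (r *\<^sub>R v) \<le> r * stable_norm v" if r: "0 \<le> r" for r v
  proof -
    have "stable_norm (r *\<^sub>R v) \<le> r * stable_norm v + upper_const * norm v * (1 / 2) ^ m" for m
    proof -
      define n where "n = nat \<lfloor>2 ^ m * r\<rfloor>"
      have "real n = of_int \<lfloor>2 ^ m * r\<rfloor>" using r by (simp add: n_def)
      then have n: "real n \<le> 2 ^ m * r" "2 ^ m * r - real n \<le> 1"
        using of_int_floor_le[of "2 ^ m * r"] real_of_int_floor_add_one_ge[of "2 ^ m * r"] by linarith+
      have "2 ^ m * stable_norm (r *\<^sub>R v) = stable_norm (real n *\<^sub>R v + (2 ^ m * r - real n) *\<^sub>R v)"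
        by (simp add: stable_norm_power[symmetric] algebra_simps)
      also have "\<dots> \<le> real n * stable_norm v + upper_const * norm ((2 ^ m * r - real n) *\<^sub>R v)"
        using stable_norm_add[of "real n *\<^sub>R v" "(2 ^ m * r - real n) *\<^sub>R v"] stable_norm_of_nat[of n v]
          stable_norm_upper[of "(2 ^ m * r - real n) *\<^sub>R v"] by linarith
      also have "\<dots> \<le> 2 ^ m * r * stable_norm v + upper_const * norm v"
        using n stable_norm_nonneg[of v] upper_const(1)
        by (intro add_mono mult_right_mono mult_left_mono) (auto simp: mult_left_le_one_le)
      finally show ?thesis by (simp add: field_simps power_divide)
    qed
    moreover have "(\<lambda>m. r * stable_norm v + upper_const * norm v * (1 / 2) ^ m) \<longlonglongrightarrow>
        r * stable_norm v + upper_const * norm v * 0"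
      by (intro tendsto_intros LIMSEQ_power_zero) simp
    ultimately show ?thesis using LIMSEQ_le_const[of _ "r * stable_norm v + upper_const * norm v * 0"] by auto
  qed
  show ?thesis
  proof (cases "r = 0")
    case False
    have "stable_norm v \<le> 1 / r * stable_norm (r *\<^sub>R v)"
      using *[of "1 / r" "r *\<^sub>R v"] False assms by simp
    then show ?thesis using *[OF assms, of v] False assms by (simp add: field_simps)
  qed simp
qed

lemma stable_norm_Lipschitz: "upper_const-lipschitz_on U stable_norm"
proof (rule lipschitz_onI)
  have "stable_norm v \<le> stable_norm w + upper_const * norm (v - w)" for v w
    using stable_norm_add[of w "v - w"] stable_norm_upper[of "v - w"] by simp
  then show "dist (stable_norm v) (stable_norm w) \<le> upper_const * dist v w" for v w
    by (simp add: dist_real_def dist_norm abs_le_iff) (smt (verit) norm_minus_commute)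
qed (use upper_const(1) in simp)

section \<open>The dual of the stable norm\<close>

definition effective_gauge :: "real^2 \<Rightarrow> real" where
  "effective_gauge p = (SUP q\<in>{q. stable_norm q = 1}. p \<bullet> q)"

lemma stable_sphere_norm: "stable_norm q = 1 \<Longrightarrow> norm q \<le> 1 / lower_const"
  using stable_norm_lower[of q] lower_const(1) by (simp add: field_simps)

lemma stable_norm_normalize:
  assumes "q \<noteq> 0" shows "stable_norm q > 0" "stable_norm ((1 / stable_norm q) *\<^sub>R q) = 1"
proof -
  show "stable_norm q > 0"
    using stable_norm_lower[of q] lower_const(1) assms by (smt (verit) mult_pos_pos zero_less_norm_iff)
  then show "stable_norm ((1 / stable_norm q) *\<^sub>R q) = 1" by (simp add: stable_norm_scale)
qed

lemma effective_gauge_unit: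
  assumes "stable_norm q = 1" shows "p \<bullet> q \<le> effective_gauge p"
proof -
  have "p \<bullet> q \<le> norm p * (1 / lower_const)" if "stable_norm q = 1" for q
    using norm_cauchy_schwarz[of p q] mult_left_mono[OF stable_sphere_norm[OF that], of "norm p"] by simp
  then show ?thesis
    using assms unfolding effective_gauge_def by (intro cSUP_upper bdd_aboveI2) auto
qed

lemma effective_gauge_inner: "p \<bullet> q \<le> effective_gauge p * stable_norm q"
proof (cases "q = 0")
  case False
  from effective_gauge_unit[OF stable_norm_normalize(2)[OF this], of p] stable_norm_normalize(1)[OF False]
  show ?thesis by (simp add: field_simps)
qed simp

lemma effective_gauge_attained: "\<exists>q. stable_norm q = 1 \<and> p \<bullet> q = effective_gauge p"
proof -
  have ne: "{q. stable_norm q = 1} \<noteq> {}"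
    using stable_norm_normalize(2)[of 1] by auto
  have "closed {q. stable_norm q = 1}"
    by (intro closed_Collect_eq lipschitz_on_continuous_on[OF stable_norm_Lipschitz] continuous_intros)
  moreover have "bounded {q. stable_norm q = 1}"
    using stable_sphere_norm by (auto simp: bounded_iff)
  ultimately have "compact {q. stable_norm q = 1}" by (simp add: compact_eq_bounded_closed)
  moreover have "continuous_on {q. stable_norm q = 1} (\<lambda>q. p \<bullet> q)" by (intro continuous_intros)
  ultimately obtain q where q: "stable_norm q = 1" "\<And>q'. stable_norm q' = 1 \<Longrightarrow> p \<bullet> q' \<le> p \<bullet> q"
    using continuous_attains_sup[of "{q. stable_norm q = 1}" "\<lambda>q. p \<bullet> q"] ne by auto
  have "effective_gauge p \<le> p \<bullet> q"
    unfolding effective_gauge_def using ne q by (intro cSUP_least) auto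
  with effective_gauge_unit[OF q(1), of p] q(1) show ?thesis by (intro exI[of _ q]) simp
qed

lemma effective_gauge_nonneg: "0 \<le> effective_gauge p"
proof (cases "p = 0")
  case True
  then show ?thesis using effective_gauge_attained[of p] by auto
next
  case False
  have "0 < p \<bullet> p" using False by simp
  then have "0 < effective_gauge p * stable_norm p" using effective_gauge_inner[of p p] by linarith
  then show ?thesis using stable_norm_nonneg[of p] by (simp add: zero_less_mult_iff)
qed

lemma effective_gauge_continuous: "continuous_on U effective_gauge"
proof -
  have *: "effective_gauge p \<le> effective_gauge p' + 1 / lower_const * norm (p - p')" for p p'
  proof -
    obtain q where q: "stable_norm q = 1" "p \<bullet> q = effective_gauge p" using effective_gauge_attained by blast
    have "p \<bullet> q = p' \<bullet> q + (p - p') \<bullet> q" by (simp add: inner_diff_left)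
    moreover have "(p - p') \<bullet> q \<le> norm (p - p') * (1 / lower_const)"
      using norm_cauchy_schwarz[of "p - p'" q] mult_left_mono[OF stable_sphere_norm[OF q(1)], of "norm (p - p')"]
      by simp
    ultimately show ?thesis using effective_gauge_unit[OF q(1), of p'] q(2) by (simp add: mult.commute)
  qed
  have "(1 / lower_const)-lipschitz_on U effective_gauge"
  proof (rule lipschitz_onI)
    show "dist (effective_gauge p) (effective_gauge p') \<le> 1 / lower_const * dist p p'" for p p'
      using *[of p p'] *[of p' p] by (simp add: dist_real_def dist_norm norm_minus_commute abs_le_iff)
  qed (use lower_const(1) in simp)
  then show ?thesis by (rule lipschitz_on_continuous_on)
qed

text \<open>For a translation-invariant distance straight segments are exact geodesics and the
  distance is its own infinitesimal form.\<close>

lemma stable_Finsler_distance: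
  "Finsler_distance (\<lambda>x y. stable_norm (y - x)) (\<lambda>_. stable_norm) (\<lambda>_. effective_gauge) lower_const upper_const"
proof
  show "0 < lower_const" by (rule lower_const(1))
  show "stable_norm (z - x) \<le> stable_norm (y - x) + stable_norm (z - y)" for x y z
    using stable_norm_add[of "y - x" "z - y"] by simp
  show "\<exists>z. stable_norm (z - x) \<le> \<theta> * stable_norm (y - x) + \<delta> \<and>
      stable_norm (y - z) \<le> (1 - \<theta>) * stable_norm (y - x) + \<delta>"
    if "0 \<le> \<theta>" "\<theta> \<le> 1" "0 < \<delta>" for \<theta> \<delta> x y
  proof (intro exI[of _ "x + \<theta> *\<^sub>R (y - x)"])
    have "y - (x + \<theta> *\<^sub>R (y - x)) = (1 - \<theta>) *\<^sub>R (y - x)" by (simp add: algebra_simps)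
    then show "stable_norm (x + \<theta> *\<^sub>R (y - x) - x) \<le> \<theta> * stable_norm (y - x) + \<delta> \<and>
        stable_norm (y - (x + \<theta> *\<^sub>R (y - x))) \<le> (1 - \<theta>) * stable_norm (y - x) + \<delta>"
      using that by (simp add: stable_norm_scale)
  qed
  show "\<forall>\<^sub>F s in at_right 0. stable_norm (x - (x - s *\<^sub>R q)) \<le> s * (stable_norm q + \<delta>)"
    if "0 < \<delta>" for \<delta> x q
    using eventually_at_right_less[of "0::real"]
    by eventually_elim (use that in \<open>simp add: stable_norm_scale\<close>)
  show "\<forall>\<^sub>F y in nhds x. stable_norm (x - y) - \<delta> * norm (x - y) \<le> stable_norm (x - y)"
    if "0 < \<delta>" for \<delta> x using that by (intro always_eventually) simp
qed (fact stable_norm_lower stable_norm_upper stable_norm_scale effective_gauge_nonneg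
    effective_gauge_inner effective_gauge_attained)+

text \<open>Doubling of variables on the torus. The subsolution inequality and coercivity bound the
  common momentum \<open>P\<close>, hence the distance of the doubled points; no Lipschitz bound on
  the correctors is assumed. Exchanging the two solutions gives uniqueness of the constant.\<close>

lemma cell_constant_le:
  assumes 1: "cell_problem_solution H p c1 v1" and 2: "cell_problem_solution H p c2 v2"
  shows "c2 \<le> c1"
proof (rule ccontr)
  assume "\<not> ?thesis"
  then have c: "c1 < c2" by simp
  have v1: "continuous_on UNIV v1" "Z2_periodic v1"
    and sub: "viscosity_subsolution (\<lambda>y q. H y (p + q) - c1) UNIV v1"
    using 1 by (auto simp: cell_problem_solution_def viscosity_solution_def)
  have v2: "continuous_on UNIV v2" "Z2_periodic v2"
    and super: "viscosity_supersolution (\<lambda>y q. H y (p + q) - c2) UNIV v2"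
    using 2 by (auto simp: cell_problem_solution_def viscosity_solution_def)
  obtain B1 B2 where B12: "\<And>y. \<bar>v1 y\<bar> \<le> B1" "\<And>y. \<bar>v2 y\<bar> \<le> B2"
    using continuous_periodic_bounded[OF v1] continuous_periodic_bounded[OF v2] by metis
  define B where "B = max (max B1 B2) 1"
  have B: "\<And>y. \<bar>v1 y\<bar> \<le> B" "\<And>y. \<bar>v2 y\<bar> \<le> B" "B > 0"
    using B12 unfolding B_def by (auto simp: le_max_iff_disj)
  obtain R0 where R0: "\<And>y q. norm q \<ge> R0 \<Longrightarrow> H y q \<ge> c1 + 1" using coercive by blast
  define R where "R = max R0 1"
  have R: "norm q < R" if "H y q \<le> c1" for y q using R0[of q y] that by (force simp: R_def)
  have "R > 0" by (simp add: R_def)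
  have "uniformly_continuous_on (UNIV \<times> cball 0 R) (\<lambda>(y, p). H y p)"
    by (rule periodic_uniformly_continuous[OF cont periodic])
  moreover have "c2 - c1 > 0" using c by simp
  ultimately obtain m where m: "m > 0" "\<And>z z'. z \<in> UNIV \<times> cball 0 R \<Longrightarrow> z' \<in> UNIV \<times> cball 0 R \<Longrightarrow>
      dist z' z < m \<Longrightarrow> dist ((\<lambda>(y, p). H y p) z') ((\<lambda>(y, p). H y p) z) < c2 - c1"
    unfolding uniformly_continuous_on_def by metis
  \<comment> \<open>The doubled points satisfy \<open>x - y = \<delta> *\<^sub>R (P - p)\<close>
    with \<open>norm P < R\<close>, so this choice puts them within the modulus
    \<open>m\<close>.\<close>
  define \<delta> where "\<delta> = m / (2 * (R + norm p))"
  have Rp: "R + norm p > 0" using \<open>R > 0\<close> by (simp add: add_pos_nonneg)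
  have "m / (2 * a) * a = m / 2" if "a > 0" for a using that by simp
  from this[OF Rp] have "\<delta> * (R + norm p) = m / 2" unfolding \<delta>_def .
  moreover have "\<delta> > 0" using m(1) Rp by (simp add: \<delta>_def)
  ultimately have \<delta>: "\<delta> > 0" "\<delta> * (R + norm p) < m" using m(1) by linarith+
  define \<Psi> where "\<Psi> = (\<lambda>(x, y). v1 x - v2 y - (norm (x - y))\<^sup>2 / (2 * \<delta>))"
  \<comment> \<open>Beyond separation \<open>b\<close> the penalty exceeds \<open>4 * B\<close>,
    more than the functions can compensate. The first point is reduced to the unit cell by
    translating both points, so the maximum over \<open>A\<close> is global.\<close>
  define b where "b = sqrt (8 * \<delta> * B)"
  define A where "A = (\<lambda>(x, z). (x, x + z)) ` (cbox 0 1 \<times> cball 0 b :: ((real^2) \<times> (real^2)) set)"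
  have "compact A" unfolding A_def split_beta
    by (intro compact_continuous_image compact_Times continuous_intros) auto
  moreover have "b \<ge> 0" using \<delta> B(3) by (simp add: b_def)
  then have A0: "(0, 0) \<in> A" unfolding A_def by (force simp: mem_box_cart)
  moreover have "continuous_on A \<Psi>"
    unfolding \<Psi>_def split_beta
    by (intro continuous_intros continuous_on_compose2[OF v1(1)] continuous_on_compose2[OF v2(1)]) (use \<delta> in auto)
  ultimately obtain z where z: "z \<in> A" "\<And>z'. z' \<in> A \<Longrightarrow> \<Psi> z' \<le> \<Psi> z"
    using continuous_attains_sup[of A \<Psi>] by blast
  obtain x y where xy: "z = (x, y)" by (cases z)
  have max: "\<Psi> (x', y') \<le> \<Psi> (x, y)" for x' y'
  proof (cases "norm (y' - x') \<le> b")
    case True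
    define n where "n = floor_vec x'"
    have "(x' - n, (x' - n) + (y' - x')) \<in> A"
      unfolding A_def using True frac_vec_in_cbox[of x'] by (force simp: n_def)
    then have "\<Psi> (x' - n, y' - n) \<le> \<Psi> (x, y)" using z xy by (simp add: algebra_simps)
    moreover have "v1 (x' - n) = v1 x'" "v2 (y' - n) = v2 y'"
      using Z2_periodicD[OF v1(2), of "- n"] Z2_periodicD[OF v2(2), of "- n"] by (simp_all add: n_def)
    ultimately show ?thesis by (simp add: \<Psi>_def)
  next
    case False
    then have "b\<^sup>2 \<le> (norm (y' - x'))\<^sup>2" using \<open>b \<ge> 0\<close> by (intro power_mono) auto
    then have "8 * \<delta> * B \<le> (norm (x' - y'))\<^sup>2" using \<delta> B(3) by (simp add: b_def norm_minus_commute)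
    then have "4 * B \<le> (norm (x' - y'))\<^sup>2 / (2 * \<delta>)" using \<delta> by (simp add: field_simps)
    then have "\<Psi> (x', y') \<le> \<Psi> (0, 0)"
      using B(1)[of x'] B(2)[of y'] B(1)[of 0] B(2)[of 0] unfolding \<Psi>_def by (simp add: abs_le_iff)
    also have "\<dots> \<le> \<Psi> (x, y)" using z A0 xy by blast
    finally show ?thesis .
  qed
  define P where "P = p + (1 / \<delta>) *\<^sub>R (x - y)"
  have GD: "GDERIV (\<lambda>x'. 1 / (2 * \<delta>) * (norm (x' - y))\<^sup>2) x' :> (2 * (1 / (2 * \<delta>))) *\<^sub>R (x' - y)"
    "GDERIV (\<lambda>y'. - 1 / (2 * \<delta>) * (norm (y' - x))\<^sup>2) x' :> (2 * (- 1 / (2 * \<delta>))) *\<^sub>R (x' - x)" for x'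
    by (rule GDERIV_norm_diff_sq)+
  have "H x (p + (2 * (1 / (2 * \<delta>))) *\<^sub>R (x - y)) - c1 \<le> 0"
  proof (rule viscosity_subsolutionD[OF sub UNIV_I GD(1)])
    show "\<forall>\<^sub>F x' in nhds x. v1 x' - 1 / (2 * \<delta>) * (norm (x' - y))\<^sup>2 \<le> v1 x - 1 / (2 * \<delta>) * (norm (x - y))\<^sup>2"
      using max[of _ y] by (intro always_eventually allI) (simp add: \<Psi>_def)
  qed (intro continuous_intros)
  then have H1: "H x P \<le> c1" by (simp add: P_def)
  have "H y (p + (2 * (- 1 / (2 * \<delta>))) *\<^sub>R (y - x)) - c2 \<ge> 0"
  proof (rule viscosity_supersolutionD[OF super UNIV_I GD(2)])
    show "\<forall>\<^sub>F y' in nhds y. v2 y' - - 1 / (2 * \<delta>) * (norm (y' - x))\<^sup>2 \<ge> v2 y - - 1 / (2 * \<delta>) * (norm (y - x))\<^sup>2"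
    proof (intro always_eventually allI)
      fix y'
      show "v2 y' - - 1 / (2 * \<delta>) * (norm (y' - x))\<^sup>2 \<ge> v2 y - - 1 / (2 * \<delta>) * (norm (y - x))\<^sup>2"
        using max[of x y'] by (simp add: \<Psi>_def norm_minus_commute)
    qed
  qed (intro continuous_intros)
  moreover have "p + (2 * (- 1 / (2 * \<delta>))) *\<^sub>R (y - x) = P"
    by (simp add: P_def scaleR_diff_right)
  ultimately have H2: "H y P \<ge> c2" by simp
  have nP: "norm P < R" by (rule R[OF H1])
  have "x - y = \<delta> *\<^sub>R (P - p)" using \<delta> by (simp add: P_def)
  then have "norm (x - y) = \<delta> * norm (P - p)" using \<delta> by simp
  also have "\<dots> \<le> \<delta> * (R + norm p)"
    using nP \<delta> norm_triangle_ineq4[of P p] by (intro mult_left_mono) auto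
  finally have "dist (x, P) (y, P) < m" using \<delta> by (simp add: dist_Pair_Pair dist_norm)
  then have "\<bar>H x P - H y P\<bar> < c2 - c1" using m(2)[of "(y, P)" "(x, P)"] nP by (simp add: dist_real_def)
  with H1 H2 show False by linarith
qed

section \<open>Busemann functions as correctors\<close>

definition far_lattice :: "nat \<Rightarrow> (real^2) set" where
  "far_lattice R = {z. lattice_point z \<and> real R \<le> norm z}"

text \<open>The periodic corrector for \<open>p\<close> is \<open>Busemann p y - p \<bullet> y\<close>.\<close>

definition Busemann_level :: "real^2 \<Rightarrow> nat \<Rightarrow> real^2 \<Rightarrow> real" where
  "Busemann_level p R y = (INF z\<in>far_lattice R. effective_gauge p * distance z y + p \<bullet> z)"

text \<open>The levels increase with \<open>R\<close>, so this is a lower limit as the source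
  recedes to infinity. No direction of escape is prescribed; the infimum finds the favourable
  sources.\<close>

definition Busemann :: "real^2 \<Rightarrow> real^2 \<Rightarrow> real" where
  "Busemann p y = (SUP R. Busemann_level p R y)"

context
  fixes p :: "real^2"
begin

abbreviation "\<Lambda> \<equiv> effective_gauge p"

text \<open>Duality bounds \<open>p \<bullet> (y - z)\<close> by the stable norm, which differs from
  the distance by a constant. The bound is uniform in the source, and so survives when the source
  goes to infinity.\<close>

lemma far_lattice_lower:
  "p \<bullet> y - \<Lambda> * (16 * upper_const) \<le> \<Lambda> * distance z y + p \<bullet> z"
proof -
  have "\<Lambda> * stable_norm (y - z) \<le> \<Lambda> * (distance z y + 16 * upper_const)"
    using distance_stable_norm[of z y] by (intro mult_left_mono effective_gauge_nonneg) auto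
  then show ?thesis using effective_gauge_inner[of p "y - z"] by (simp add: inner_diff_right algebra_simps)
qed

text \<open>For \<open>q\<close> dual to \<open>p\<close> the source near \<open>- n q\<close> is
  favourable: the linear growth of the distance and that of \<open>p \<bullet> z\<close> cancel,
  leaving only the rounding to the lattice and the bounded error of the stable norm.\<close>

lemma far_lattice_upper:
  "\<exists>z\<in>far_lattice R. \<Lambda> * distance z y + p \<bullet> z
    \<le> \<Lambda> * (upper_const * (norm y + 2) + 16 * upper_const) + 2 * norm p"
proof -
  obtain q where q: "stable_norm q = 1" "p \<bullet> q = \<Lambda>" using effective_gauge_attained by blast
  then have "q \<noteq> 0" by auto
  \<comment> \<open>The extra 2 pays for rounding to a lattice point.\<close>
  then obtain n where n: "real R + 2 \<le> real n * norm q"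
    using reals_Archimedean3[of "norm q"] by (meson less_imp_le zero_less_norm_iff)
  define z where "z = floor_vec (- (real n *\<^sub>R q))"
  define f where "f = - (real n *\<^sub>R q) - z"
  have f: "norm f \<le> 2" unfolding f_def z_def by (rule norm_frac_vec)
  have z: "z = - (real n *\<^sub>R q) - f" by (simp add: f_def)
  have "real n * norm q - norm f \<le> norm z"
    using norm_triangle_ineq2[of "- (real n *\<^sub>R q)" f] by (simp add: z)
  then have "z \<in> far_lattice R" using n f by (simp add: far_lattice_def z_def)
  moreover have "\<Lambda> * distance z y + p \<bullet> z
      \<le> \<Lambda> * (upper_const * (norm y + 2) + 16 * upper_const) + 2 * norm p"
  proof -
    have yz: "y - z = (y + f) + real n *\<^sub>R q" by (simp add: z)
    have "stable_norm (y - z) \<le> upper_const * norm (y + f) + real n"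
      using stable_norm_add[of "y + f" "real n *\<^sub>R q"] stable_norm_upper[of "y + f"] stable_norm_of_nat[of n q] q
      unfolding yz by simp
    also have "upper_const * norm (y + f) \<le> upper_const * (norm y + 2)"
      using upper_const(1) f norm_triangle_ineq[of y f] by (intro mult_left_mono) auto
    finally have "distance z y \<le> upper_const * (norm y + 2) + real n + 16 * upper_const"
      using distance_stable_norm[of z y] by simp
    from mult_left_mono[OF this effective_gauge_nonneg[of p]]
    have "\<Lambda> * distance z y \<le> \<Lambda> * (upper_const * (norm y + 2) + 16 * upper_const) + \<Lambda> * real n"
      by (simp add: algebra_simps)
    moreover have "- (p \<bullet> f) \<le> 2 * norm p"
      using norm_cauchy_schwarz[of p "- f"] mult_left_mono[OF f, of "norm p"] by simp
    moreover have "p \<bullet> z = - (real n * \<Lambda>) - p \<bullet> f" unfolding z using q by (simp add: inner_diff_right)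
    ultimately show ?thesis by (simp add: mult.commute)
  qed
  ultimately show ?thesis by blast
qed

lemma Busemann_level_le: "z \<in> far_lattice R \<Longrightarrow> Busemann_level p R y \<le> \<Lambda> * distance z y + p \<bullet> z"
  unfolding Busemann_level_def using far_lattice_lower by (intro cINF_lower bdd_belowI2) auto

lemma Busemann_level_greatest:
  "(\<And>z. z \<in> far_lattice R \<Longrightarrow> X \<le> \<Lambda> * distance z y + p \<bullet> z) \<Longrightarrow> X \<le> Busemann_level p R y"
  unfolding Busemann_level_def using far_lattice_upper by (intro cINF_greatest) auto

lemma Busemann_level_near:
  assumes "e > 0"
  obtains z where "z \<in> far_lattice R" "\<Lambda> * distance z y + p \<bullet> z < Busemann_level p R y + e"
proof (rule ccontr)
  assume "\<not> thesis"
  then have "Busemann_level p R y + e \<le> Busemann_level p R y"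
    using that by (intro Busemann_level_greatest) (meson not_less)
  with assms show False by simp
qed

lemma Busemann_level_Busemann: "Busemann_level p R y \<le> Busemann p y"
  unfolding Busemann_def
proof (rule cSUP_upper)
  have "Busemann_level p R y \<le> \<Lambda> * (upper_const * (norm y + 2) + 16 * upper_const) + 2 * norm p" for R
    using far_lattice_upper[of R y] Busemann_level_le by (meson order_trans)
  then show "bdd_above (range (\<lambda>R. Busemann_level p R y))" by (rule bdd_aboveI2)
qed simp

lemma Busemann_least: "(\<And>R. Busemann_level p R y \<le> X) \<Longrightarrow> Busemann p y \<le> X"
  unfolding Busemann_def by (rule cSUP_least) auto

lemma Busemann_level_mono: "R \<le> R' \<Longrightarrow> Busemann_level p R y \<le> Busemann_level p R' y"
  by (intro Busemann_level_greatest Busemann_level_le) (auto simp: far_lattice_def)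

lemma Busemann_level_distance: "Busemann_level p R y' \<le> Busemann_level p R y + \<Lambda> * distance y y'"
proof -
  have "Busemann_level p R y' - \<Lambda> * distance y y' \<le> Busemann_level p R y"
  proof (rule Busemann_level_greatest)
    fix z assume z: "z \<in> far_lattice R"
    have "\<Lambda> * distance z y' \<le> \<Lambda> * (distance z y + distance y y')"
      by (intro mult_left_mono distance_triangle effective_gauge_nonneg)
    then show "Busemann_level p R y' - \<Lambda> * distance y y' \<le> \<Lambda> * distance z y + p \<bullet> z"
      using Busemann_level_le[OF z, of y'] by (simp add: algebra_simps)
  qed
  then show ?thesis by simp
qed

lemma Busemann_distance: "Busemann p y' \<le> Busemann p y + \<Lambda> * distance y y'"
  using Busemann_level_distance Busemann_level_Busemann by (intro Busemann_least) (smt (verit))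

lemma continuous_of_distance_bound:
  assumes "\<And>y y'. f y' \<le> f y + \<Lambda> * distance y y'"
  shows "continuous_on U (f :: real^2 \<Rightarrow> real)"
proof -
  have *: "f y' \<le> f y + \<Lambda> * upper_const * dist y' y" for y y'
  proof -
    have "\<Lambda> * distance y y' \<le> \<Lambda> * (upper_const * norm (y' - y))"
      by (intro mult_left_mono distance_upper effective_gauge_nonneg)
    then show ?thesis using assms[of y' y] by (simp add: dist_norm)
  qed
  have "(\<Lambda> * upper_const)-lipschitz_on U f"
  proof (rule lipschitz_onI)
    show "dist (f y) (f y') \<le> \<Lambda> * upper_const * dist y y'" for y y'
      using *[of y y'] *[of y' y] by (simp add: dist_real_def abs_le_iff dist_commute)
  qed (use effective_gauge_nonneg upper_const(1) in simp)
  then show ?thesis by (rule lipschitz_on_continuous_on)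
qed

text \<open>Sources are lattice points, so a lattice translation moves sources to sources and
  changes their norms by at most \<open>norm m\<close>; raising the level by that much makes up for
  it.\<close>

lemma Busemann_translate:
  assumes m: "lattice_point m"
  shows "Busemann p (y + m) = Busemann p y + p \<bullet> m"
proof -
  have *: "Busemann p y + p \<bullet> m \<le> Busemann p (y + m)" if m: "lattice_point m" for y m
  proof -
    have "Busemann p y \<le> Busemann p (y + m) - p \<bullet> m"
    proof (rule Busemann_least)
      fix R
      define R' where "R' = R + nat \<lceil>norm m\<rceil>"
      have R': "real R + norm m \<le> real R'" unfolding R'_def by (simp add: real_nat_ceiling_ge)
      have "Busemann_level p R y + p \<bullet> m \<le> Busemann_level p R' (y + m)"
      proof (rule Busemann_level_greatest)
        fix z assume z: "z \<in> far_lattice R'"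
        then have "z - m \<in> far_lattice R"
          using R' norm_triangle_ineq2[of z m] m by (auto simp: far_lattice_def lattice_point_diff)
        from Busemann_level_le[OF this, of y]
        show "Busemann_level p R y + p \<bullet> m \<le> \<Lambda> * distance z (y + m) + p \<bullet> z"
          using distance_periodic[OF m, of "z - m" y] by (simp add: inner_diff_right)
      qed
      then show "Busemann_level p R y \<le> Busemann p (y + m) - p \<bullet> m"
        using Busemann_level_Busemann[of R' "y + m"] by linarith
    qed
    then show ?thesis by simp
  qed
  show ?thesis using *[OF m, of y] *[of "- m" "y + m"] m by (simp add: inner_minus_right)
qed

text \<open>An almost geodesic from a distant source to \<open>y\<close> crosses every sphere around
  \<open>y\<close>, and at the crossing point the distance is nearly additive. This is the reverse
  of \<open>Busemann_distance\<close> and carries the supersolution property.\<close>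

lemma Busemann_sphere_level:
  assumes r: "r > 0" and e: "e > 0"
  shows "\<exists>y'. norm (y' - y) = r \<and> Busemann_level p R y' + \<Lambda> * distance y' y \<le> Busemann p y + e"
proof -
  \<comment> \<open>The source has to lie outside the ball of radius \<open>r\<close> around
    \<open>y\<close>, while remaining admissible at level \<open>R\<close>.\<close>
  define R' where "R' = R + nat \<lceil>norm y + r\<rceil>"
  have R': "norm y + r \<le> real R'" "R \<le> R'"
    using real_nat_ceiling_ge[of "norm y + r"] by (auto simp: R'_def)
  have l: "0 \<le> \<Lambda>" by (rule effective_gauge_nonneg)
  have "e / 2 > 0" using e by simp
  then obtain z where z: "z \<in> far_lattice R'" "\<Lambda> * distance z y + p \<bullet> z < Busemann_level p R' y + e / 2"
    by (rule Busemann_level_near)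
  define e' where "e' = e / (2 * (\<Lambda> + 1))"
  have e': "e' > 0" "\<Lambda> * e' \<le> e / 2" using e l by (auto simp: e'_def field_simps add_nonneg_pos)
  obtain \<gamma> where \<gamma>: "path \<gamma>" "\<gamma> 0 = z" "\<gamma> 1 = y" and le: "\<And>a b. 0 \<le> a \<Longrightarrow> a \<le> b \<Longrightarrow> b \<le> 1 \<Longrightarrow>
      distance z (\<gamma> a) + distance (\<gamma> a) (\<gamma> b) + distance (\<gamma> b) y \<le> distance z y + e'"
    using almost_geodesic[OF e'(1)] by metis
  have "r \<le> norm (z - y)"
    using z(1) R'(1) norm_triangle_ineq2[of z y] by (simp add: far_lattice_def)
  moreover have "continuous_on {0..1} (\<lambda>t. norm (\<gamma> t - y))"
    using \<gamma>(1) unfolding path_def by (intro continuous_intros)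
  ultimately obtain t where t: "0 \<le> t" "t \<le> 1" "norm (\<gamma> t - y) = r"
    using IVT2'[of "\<lambda>t. norm (\<gamma> t - y)" 1 r 0] \<gamma>(2,3) r by auto
  have "distance z (\<gamma> t) + distance (\<gamma> t) y \<le> distance z y + e'" using le[of t t] t by simp
  from mult_left_mono[OF this l]
  have "\<Lambda> * distance z (\<gamma> t) + \<Lambda> * distance (\<gamma> t) y \<le> \<Lambda> * distance z y + e / 2"
    using e'(2) by (simp add: algebra_simps)
  moreover have "Busemann_level p R (\<gamma> t) \<le> \<Lambda> * distance z (\<gamma> t) + p \<bullet> z"
    using z(1) R'(2) by (intro Busemann_level_le) (auto simp: far_lattice_def)
  ultimately have "Busemann_level p R (\<gamma> t) + \<Lambda> * distance (\<gamma> t) y \<le> Busemann p y + e"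
    using z(2) Busemann_level_Busemann[of R' y] by linarith
  with t(3) show ?thesis by blast
qed

text \<open>The crossing point found above depends on the level. A subsequence converges on the
  compact sphere, and monotonicity of the levels lets each fixed level pass to the limit.\<close>

lemma Busemann_sphere:
  assumes r: "r > 0" and e: "e > 0"
  shows "\<exists>y'. norm (y' - y) = r \<and> Busemann p y' + \<Lambda> * distance y' y \<le> Busemann p y + e"
proof -
  obtain Y where Y: "\<And>R. norm (Y R - y) = r"
    "\<And>R. Busemann_level p R (Y R) + \<Lambda> * distance (Y R) y \<le> Busemann p y + e"
    using Busemann_sphere_level[OF r e] by metis
  have "Y R \<in> sphere y r" for R using Y(1) by (simp add: dist_norm norm_minus_commute)
  then obtain y' \<sigma> where y': "y' \<in> sphere y r" "strict_mono \<sigma>" "(Y \<circ> \<sigma>) \<longlonglongrightarrow> y'"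
    using compact_sphere[of y r] unfolding compact_def by metis
  have "Busemann p y' \<le> Busemann p y + e - \<Lambda> * distance y' y"
  proof (rule Busemann_least)
    fix R
    have "continuous_on UNIV (\<lambda>x. Busemann_level p R x + \<Lambda> * distance x y)"
      by (intro continuous_intros lipschitz_on_continuous_on[OF distance_Lipschitz(2)]
          continuous_of_distance_bound[OF Busemann_level_distance])
    then have "isCont (\<lambda>x. Busemann_level p R x + \<Lambda> * distance x y) y'"
      by (simp add: continuous_on_eq_continuous_at)
    then have lim: "(\<lambda>j. Busemann_level p R (Y (\<sigma> j)) + \<Lambda> * distance (Y (\<sigma> j)) y)
        \<longlonglongrightarrow> Busemann_level p R y' + \<Lambda> * distance y' y"
      using y'(3) by (auto simp: isCont_def o_def intro: isCont_tendsto_compose[unfolded isCont_def])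
    have "Busemann_level p R y' + \<Lambda> * distance y' y \<le> Busemann p y + e"
    proof (rule LIMSEQ_le_const2[OF lim], intro exI[of _ R] allI impI)
      fix j assume "R \<le> j"
      then have "R \<le> \<sigma> j" using seq_suble[OF y'(2), of j] by simp
      then show "Busemann_level p R (Y (\<sigma> j)) + \<Lambda> * distance (Y (\<sigma> j)) y \<le> Busemann p y + e"
        using Busemann_level_mono[of R "\<sigma> j" "Y (\<sigma> j)"] Y(2)[of "\<sigma> j"] by linarith
    qed
    then show "Busemann_level p R y' \<le> Busemann p y + e - \<Lambda> * distance y' y" by simp
  qed
  moreover have "norm (y' - y) = r" using y'(1) by (simp add: dist_norm norm_minus_commute)
  ultimately show ?thesis by (intro exI[of _ y']) simp
qed

text \<open>\<open>Busemann_distance\<close> bounds the increment along the direction dual to the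
  tested momentum by \<open>\<Lambda>\<close> times the distance, hence the gauge of that momentum
  by \<open>\<Lambda>\<close>.\<close>

lemma corrector_subsolution:
  "viscosity_subsolution (\<lambda>y q. H y (p + q) - \<Lambda> powr k) UNIV (\<lambda>y. Busemann p y - p \<bullet> y)"
  unfolding viscosity_subsolution_def
proof (intro conjI allI ballI impI)
  show "continuous_on UNIV (\<lambda>y. Busemann p y - p \<bullet> y)"
    by (intro continuous_intros continuous_of_distance_bound Busemann_distance)
  fix \<phi> y
  assume T: "C1_on UNIV \<phi> \<and> (\<forall>\<^sub>F y' in nhds y. Busemann p y' - p \<bullet> y' - \<phi> y' \<le> Busemann p y - p \<bullet> y - \<phi> y)"
  obtain r0 where r0: "r0 > 0" "\<And>y'. norm (y' - y) < r0 \<Longrightarrow>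
      Busemann p y' - p \<bullet> y' - \<phi> y' \<le> Busemann p y - p \<bullet> y - \<phi> y"
    using T unfolding eventually_nhds_metric dist_norm by blast
  define P where "P = p + gradient \<phi> y"
  obtain q where q: "speed y q = 1" "P \<bullet> q = gauge y P" using speed_attained by blast
  define n where "n = norm q"
  have n: "n > 0" using q(1) speed_scale[of 0 y q] by (auto simp: n_def)
  have l: "0 \<le> \<Lambda>" by (rule effective_gauge_nonneg)
  have key: "gauge y P \<le> \<Lambda> + (\<Lambda> + n) * e" if e: "e > 0" for e
  proof -
    obtain r1 where r1: "r1 > 0" "\<And>y'. norm (y' - y) < r1 \<Longrightarrow>
        \<bar>\<phi> y' - \<phi> y - (y' - y) \<bullet> gradient \<phi> y\<bar> \<le> e * norm (y' - y)"
      using C1_on_first_order[OF conjunct1[OF T] UNIV_I e] by metis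
    have "\<forall>\<^sub>F s in at_right 0. distance (y - s *\<^sub>R q) y \<le> s * (speed y q + e)"
      by (rule distance_tangent_upper[OF e])
    moreover have "\<forall>\<^sub>F s in at_right 0. s \<in> {0<..<min (r0 / n) (r1 / n)}"
      using r0 r1 n by (intro eventually_at_right_real) auto
    ultimately have "\<forall>\<^sub>F s in at_right 0. distance (y - s *\<^sub>R q) y \<le> s * (speed y q + e)
        \<and> s \<in> {0<..<min (r0 / n) (r1 / n)}"
      by (rule eventually_conj)
    then obtain s where ds: "distance (y - s *\<^sub>R q) y \<le> s * (speed y q + e)"
      and s: "0 < s" "s < r0 / n" "s < r1 / n"
      using eventually_happens' trivial_limit_at_right_real by fastforce
    define y' where "y' = y - s *\<^sub>R q"
    have ny: "norm (y' - y) = s * n" using s by (simp add: y'_def n_def)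
    then have "norm (y' - y) < r0" "norm (y' - y) < r1" using s n by (auto simp: field_simps)
    then have tch: "Busemann p y' - p \<bullet> y' - \<phi> y' \<le> Busemann p y - p \<bullet> y - \<phi> y"
      and fo: "\<bar>\<phi> y' - \<phi> y - (y' - y) \<bullet> gradient \<phi> y\<bar> \<le> e * (s * n)"
      using r0(2) r1(2) ny by metis+
    have gr: "(y' - y) \<bullet> gradient \<phi> y = - (s * (gradient \<phi> y \<bullet> q))" "p \<bullet> y' = p \<bullet> y - s * (p \<bullet> q)"
      by (simp_all add: y'_def inner_commute inner_diff_right)
    have "\<Lambda> * distance y' y \<le> \<Lambda> * (s * (1 + e))" using ds q l by (intro mult_left_mono) (auto simp: y'_def)
    then have "s * (P \<bullet> q) \<le> s * (\<Lambda> + (\<Lambda> + n) * e)"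
      using Busemann_distance[of y y'] tch fo[unfolded gr(1)] gr(2)
      by (simp add: P_def inner_add_left algebra_simps)
    then show ?thesis using s q by simp
  qed
  have "gauge y P \<le> \<Lambda>"
  proof (rule field_le_epsilon)
    fix e :: real assume "e > 0"
    have "\<Lambda> + n > 0" using l n by simp
    with key[of "e / (\<Lambda> + n)"] \<open>e > 0\<close> show "gauge y P \<le> \<Lambda> + e" by simp
  qed
  then have "gauge y P powr k \<le> \<Lambda> powr k" using gauge_nonneg k by (intro powr_mono2) auto
  then show "H y (p + gradient \<phi> y) - \<Lambda> powr k \<le> 0" by (simp add: gauge_powr P_def)
qed

text \<open>\<open>Busemann_sphere\<close> provides points at every prescribed small radius where
  the full slope \<open>\<Lambda>\<close> is almost realized. A smaller gauge would leave a gap of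
  order \<open>r\<close>, against an error of order \<open>e * r\<close>.\<close>

lemma corrector_supersolution:
  "viscosity_supersolution (\<lambda>y q. H y (p + q) - \<Lambda> powr k) UNIV (\<lambda>y. Busemann p y - p \<bullet> y)"
  unfolding viscosity_supersolution_def
proof (intro conjI allI ballI impI)
  show "continuous_on UNIV (\<lambda>y. Busemann p y - p \<bullet> y)"
    by (intro continuous_intros continuous_of_distance_bound Busemann_distance)
  fix \<phi> y
  assume T: "C1_on UNIV \<phi> \<and> (\<forall>\<^sub>F y' in nhds y. Busemann p y' - p \<bullet> y' - \<phi> y' \<ge> Busemann p y - p \<bullet> y - \<phi> y)"
  obtain r0 where r0: "r0 > 0" "\<And>y'. norm (y' - y) < r0 \<Longrightarrow>
      Busemann p y' - p \<bullet> y' - \<phi> y' \<ge> Busemann p y - p \<bullet> y - \<phi> y"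
    using T unfolding eventually_nhds_metric dist_norm by blast
  define P where "P = p + gradient \<phi> y"
  have l: "0 \<le> \<Lambda>" by (rule effective_gauge_nonneg)
  have key: "(\<Lambda> - gauge y P) * lower_const \<le> (\<Lambda> + 2) * e" if e: "e > 0" and lt: "gauge y P < \<Lambda>" for e
  proof -
    obtain r1 where r1: "r1 > 0" "\<And>y'. norm (y' - y) < r1 \<Longrightarrow>
        \<bar>\<phi> y' - \<phi> y - (y' - y) \<bullet> gradient \<phi> y\<bar> \<le> e * norm (y' - y)"
      using C1_on_first_order[OF conjunct1[OF T] UNIV_I e] by metis
    obtain r2 where r2: "r2 > 0" "\<And>y'. norm (y' - y) < r2 \<Longrightarrow>
        speed y (y - y') - e * norm (y - y') \<le> distance y' y"
      using distance_tangent_lower[OF e, of y] unfolding eventually_nhds_metric dist_norm by blast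
    define r where "r = min (min r0 r1) r2 / 2"
    have r: "0 < r" "r < r0" "r < r1" "r < r2" using r0 r1 r2 by (auto simp: r_def)
    obtain y' where y': "norm (y' - y) = r" "Busemann p y' + \<Lambda> * distance y' y \<le> Busemann p y + e * r"
      using Busemann_sphere[OF r(1), of "e * r" y] e r by auto
    have tch: "Busemann p y' - p \<bullet> y' - \<phi> y' \<ge> Busemann p y - p \<bullet> y - \<phi> y"
      and fo: "\<bar>\<phi> y' - \<phi> y - (y' - y) \<bullet> gradient \<phi> y\<bar> \<le> e * r"
      and lo: "speed y (y - y') - e * r \<le> distance y' y"
      using r0(2)[of y'] r1(2)[of y'] r2(2)[of y'] y'(1) r by (simp_all add: norm_minus_commute)
    have "\<Lambda> * (speed y (y - y') - e * r) \<le> \<Lambda> * distance y' y" by (intro mult_left_mono lo l)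
    moreover have "P \<bullet> (y - y') = p \<bullet> y - p \<bullet> y' - (y' - y) \<bullet> gradient \<phi> y"
      by (simp add: P_def inner_add_left inner_diff_right inner_diff_left inner_commute[of "gradient \<phi> y"])
    moreover have "P \<bullet> (y - y') \<le> gauge y P * speed y (y - y')" by (rule gauge_speed)
    ultimately have "(\<Lambda> - gauge y P) * speed y (y - y') \<le> (\<Lambda> + 2) * e * r"
      using tch fo y'(2) by (simp add: algebra_simps)
    moreover have "(\<Lambda> - gauge y P) * (lower_const * r) \<le> (\<Lambda> - gauge y P) * speed y (y - y')"
      using speed_lower[of "y - y'" y] y'(1) lt by (intro mult_left_mono) (auto simp: norm_minus_commute)
    ultimately have "((\<Lambda> - gauge y P) * lower_const) * r \<le> ((\<Lambda> + 2) * e) * r" by (simp add: mult.assoc)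
    then show ?thesis using r(1) by simp
  qed
  have "\<Lambda> \<le> gauge y P"
  proof (rule ccontr)
    assume "\<not> ?thesis"
    then have lt: "gauge y P < \<Lambda>" by simp
    have "(\<Lambda> - gauge y P) * lower_const \<le> 0"
    proof (rule field_le_epsilon)
      fix e :: real assume "e > 0"
      have "\<Lambda> + 2 > 0" using l by simp
      with key[OF _ lt, of "e / (\<Lambda> + 2)"] \<open>e > 0\<close> show "(\<Lambda> - gauge y P) * lower_const \<le> 0 + e" by simp
    qed
    then show False using lt lower_const(1) by (simp add: mult_le_0_iff)
  qed
  then have "\<Lambda> powr k \<le> gauge y P powr k" using l k by (intro powr_mono2) auto
  then show "H y (p + gradient \<phi> y) - \<Lambda> powr k \<ge> 0" by (simp add: gauge_powr P_def)
qed

lemma corrector: "cell_problem_solution H p (\<Lambda> powr k) (\<lambda>y. Busemann p y - p \<bullet> y)"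
proof -
  have "Z2_periodic (\<lambda>y. Busemann p y - p \<bullet> y)"
    unfolding Z2_periodic_def using Busemann_translate
    by (auto simp: lattice_point_def inner_add_right)
  then show ?thesis
    using corrector_subsolution corrector_supersolution
    by (simp add: cell_problem_solution_def viscosity_solution_def viscosity_subsolution_def)
qed

end

theorem effective_Hamiltonian_eq: "effective_Hamiltonian H p = effective_gauge p powr k"
  unfolding effective_Hamiltonian_def
proof (rule the_equality)
  show "\<exists>v. cell_problem_solution H p (effective_gauge p powr k) v" using corrector by blast
  fix c assume "\<exists>v. cell_problem_solution H p c v"
  then obtain v where v: "cell_problem_solution H p c v" ..
  show "c = effective_gauge p powr k"
    using cell_constant_le[OF v corrector] cell_constant_le[OF corrector v] by (rule antisym[rotated])
qed

end

section \<open>Lipschitz functions and the essential supremum of the gradient\<close>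

text \<open>The weak derivative is a Radon--Nikodym density: adding a large multiple of the first
  coordinate to \<open>f\<close> gives a bi-Lipschitz homeomorphism \<open>\<Psi>\<close> of the plane, and the area of the
  \<open>\<Psi>\<close>-image of a rectangle is an integral of increments of \<open>f\<close>.\<close>

lemma Lipschitz_weak_partial:
  fixes f :: "real \<times> real \<Rightarrow> real"
  assumes L: "M-lipschitz_on UNIV f"
  shows "\<exists>G. (\<forall>a b c d. a \<le> b \<longrightarrow> c \<le> d \<longrightarrow>
      (G has_integral integral {c..d} (\<lambda>y. f (b, y) - f (a, y))) (cbox (a, c) (b, d)))
    \<and> (\<forall>u v q. (\<lambda>p. \<bar>G p - q\<bar>) integrable_on cbox u v)"
proof -
  have M: "0 \<le> M" using L by (rule lipschitz_on_nonneg)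
  have fL: "\<bar>f p - f q\<bar> \<le> M * norm (p - q)" for p q
    using lipschitz_onD[OF L, of p q] by (simp add: dist_real_def dist_norm)
  have cf: "continuous_on UNIV f" by (rule lipschitz_on_continuous_on[OF L])
  \<comment> \<open>The slope \<open>M + 1\<close> makes \<open>F\<close> increase in its first
    argument at rate at least 1, so that \<open>\<Psi>\<close> is invertible on every horizontal
    line.\<close>
  define F where "F = (\<lambda>x y. f (x, y) + (M + 1) * x)"
  have F_incr: "x' - x \<le> F x' y - F x y" if "x \<le> x'" for x x' y
    using fL[of "(x, y)" "(x', y)"] that by (auto simp: F_def norm_Pair algebra_simps abs_le_iff)
  have F_mono: "F x y \<le> F x' y \<longleftrightarrow> x \<le> x'" for x x' y
    using F_incr[of x x' y] F_incr[of x' x y] by (cases "x \<le> x'") auto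
  have cF: "continuous_on U (\<lambda>x. F x y)" "continuous_on U (\<lambda>y. F x y)" for U x y
    unfolding F_def by (intro continuous_intros continuous_on_compose2[OF cf]; simp)+
  define \<Psi> where "\<Psi> = (\<lambda>p. (F (fst p) (snd p), snd p))"
  have expand: "norm (p - q) \<le> (M + 2) * norm (\<Psi> p - \<Psi> q)" for p q
  proof -
    obtain x y x' y' where pq: "p = (x, y)" "q = (x', y')" by (cases p, cases q)
    have "\<bar>x - x'\<bar> \<le> \<bar>F x y' - F x' y'\<bar>"
      using F_incr[of x x' y'] F_incr[of x' x y'] by linarith
    also have "\<dots> \<le> \<bar>F x y - F x' y'\<bar> + M * \<bar>y - y'\<bar>"
      using fL[of "(x, y')" "(x, y)"] by (simp add: F_def norm_Pair abs_minus_commute)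
    finally have 1: "\<bar>x - x'\<bar> \<le> \<bar>F x y - F x' y'\<bar> + M * \<bar>y - y'\<bar>" .
    have n: "\<bar>F x y - F x' y'\<bar> \<le> norm (\<Psi> p - \<Psi> q)" "\<bar>y - y'\<bar> \<le> norm (\<Psi> p - \<Psi> q)"
      using norm_fst_le[of "F x y - F x' y'" "y - y'"] norm_snd_le[of "y - y'" "F x y - F x' y'"]
      by (simp_all add: \<Psi>_def pq)
    have "norm (p - q) \<le> \<bar>x - x'\<bar> + \<bar>y - y'\<bar>"
      using norm_Pair_le[of "x - x'" "y - y'"] by (simp add: pq)
    also have "\<dots> \<le> \<bar>F x y - F x' y'\<bar> + (M + 1) * \<bar>y - y'\<bar>" using 1 by (simp add: algebra_simps)
    also have "\<dots> \<le> norm (\<Psi> p - \<Psi> q) + (M + 1) * norm (\<Psi> p - \<Psi> q)"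
      using n M by (intro add_mono mult_left_mono) auto
    finally show ?thesis by (simp add: algebra_simps)
  qed
  have bound: "norm (\<Psi> p - \<Psi> q) \<le> (2 * M + 2) * norm (p - q)" for p q
  proof -
    obtain x y x' y' where pq: "p = (x, y)" "q = (x', y')" by (cases p, cases q)
    have n: "\<bar>x - x'\<bar> \<le> norm (p - q)" "\<bar>y - y'\<bar> \<le> norm (p - q)"
      using norm_fst_le[of "x - x'" "y - y'"] norm_snd_le[of "y - y'" "x - x'"] by (simp_all add: pq)
    have "norm (\<Psi> p - \<Psi> q) \<le> \<bar>F x y - F x' y'\<bar> + \<bar>y - y'\<bar>"
      using norm_Pair_le[of "F x y - F x' y'" "y - y'"] by (simp add: \<Psi>_def pq)
    also have "F x y - F x' y' = (f p - f q) + (M + 1) * (x - x')" by (simp add: F_def pq algebra_simps)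
    also have "\<bar>\<dots>\<bar> \<le> \<bar>f p - f q\<bar> + (M + 1) * \<bar>x - x'\<bar>"
      using M abs_triangle_ineq[of "f p - f q" "(M + 1) * (x - x')"] by (simp add: abs_mult)
    also have "\<dots> \<le> M * norm (p - q) + (M + 1) * norm (p - q)"
      using fL[of p q] n M by (intro add_mono mult_left_mono) auto
    finally show ?thesis using n by (simp add: algebra_simps)
  qed
  have "inj \<Psi>"
  proof (rule injI)
    fix p q assume "\<Psi> p = \<Psi> q"
    then show "p = q" using expand[of p q] by simp
  qed
  moreover have "\<exists>p. \<Psi> p = (u, y)" for u y
  proof -
    define t where "t = \<bar>u - F 0 y\<bar>"
    have "F (- t) y \<le> u" "u \<le> F t y"
      using F_incr[of "- t" 0 y] F_incr[of 0 t y] unfolding t_def by linarith+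
    then obtain x where "F x y = u"
      using IVT'[of "\<lambda>x. F x y" "- t" u t] cF(1) by (auto simp: t_def)
    then show ?thesis by (intro exI[of _ "(x, y)"]) (simp add: \<Psi>_def)
  qed
  ultimately have bij: "bij \<Psi>" by (metis bijI surjI surj_def surj_pair)
  define \<Phi> where "\<Phi> = inv \<Psi>"
  have \<Psi>\<Phi>: "\<Psi> (\<Phi> q) = q" "\<Phi> (\<Psi> q) = q" for q
    using bij unfolding \<Phi>_def by (simp_all add: bij_is_surj surj_f_inv_f bij_is_inj inv_f_f)
  have vimage: "\<Phi> -` A = \<Psi> ` A" for A
    using \<Psi>\<Phi> by (auto simp: image_iff) metis
  have "(M + 2)-lipschitz_on UNIV \<Phi>"
  proof (rule lipschitz_onI)
    show "dist (\<Phi> p) (\<Phi> q) \<le> (M + 2) * dist p q" for p q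
      using expand[of "\<Phi> p" "\<Phi> q"] by (simp add: \<Psi>\<Phi> dist_norm)
  qed (use M in simp)
  then have [measurable]: "\<Phi> \<in> borel_measurable borel"
    by (intro borel_measurable_continuous_onI lipschitz_on_continuous_on)
  define \<mu> where "\<mu> = distr lborel borel \<Phi>"
  have em: "emeasure \<mu> A = emeasure lborel (\<Psi> ` A)" if "A \<in> sets borel" for A
    using that by (simp add: \<mu>_def emeasure_distr vimage)
  have "null_sets lborel \<subseteq> null_sets \<mu>"
  proof
    fix A :: "(real \<times> real) set" assume A: "A \<in> null_sets lborel"
    then have Ab: "A \<in> sets borel" by (simp add: null_sets_def)
    have "negligible A" using A by (simp add: negligible_iff_null_sets null_sets_completionI)
    then have "negligible (\<Psi> ` A)"
    proof (rule negligible_locally_Lipschitz_image[rotated])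
      fix x show "\<exists>T B. open T \<and> x \<in> T \<and> (\<forall>y\<in>A \<inter> T. norm (\<Psi> y - \<Psi> x) \<le> B * norm (y - x))"
        using bound by (intro exI[of _ UNIV] exI[of _ "2 * M + 2"]) auto
    qed simp
    moreover have "\<Psi> ` A \<in> sets lborel"
      using measurable_sets[OF \<open>\<Phi> \<in> borel_measurable borel\<close> Ab] by (simp add: vimage)
    ultimately have "\<Psi> ` A \<in> null_sets lborel"
      by (simp add: negligible_iff_null_sets null_sets_completion_iff)
    then show "A \<in> null_sets \<mu>" using em[OF Ab] Ab by (auto simp: null_sets_def \<mu>_def)
  qed
  then obtain \<rho> where \<rho>[measurable]: "\<rho> \<in> borel_measurable lborel" and dens: "density lborel \<rho> = \<mu>"
    using sigma_finite_measure.Radon_Nikodym[OF lborel.sigma_finite_measure_axioms, of \<mu>] by (auto simp: absolutely_continuous_def \<mu>_def)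
  \<comment> \<open>\<open>enn2real\<close> sends infinity to 0; the finite integral over each
    rectangle shows that this alters \<open>\<rho>\<close> only on a null set there.\<close>
  define r where "r = (\<lambda>p. enn2real (\<rho> p))"
  have r0: "0 \<le> r p" for p by (simp add: r_def)
  have r[measurable]: "r \<in> borel_measurable borel" using \<rho> unfolding r_def by measurable
  have int_r: "(r has_integral integral {c..d} (\<lambda>y. F b y - F a y)) (cbox (a, c) (b, d))"
    if ab: "a \<le> b" and cd: "c \<le> d" for a b c d
  proof -
    let ?B = "cbox (a, c) (b, d) :: (real \<times> real) set"
    define I where "I = integral {c..d} (\<lambda>y. F b y - F a y)"
    have nonneg: "0 \<le> F b y - F a y" for y using F_mono[of a y b] ab by simp
    have "(\<lambda>y. F b y - F a y) integrable_on {c..d}"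
      by (intro integrable_continuous_real continuous_intros cF)
    then have hI: "((\<lambda>y. F b y - F a y) has_integral I) {c..d}" unfolding I_def by (rule integrable_integral)
    have I0: "0 \<le> I" by (rule has_integral_nonneg[OF hI]) (rule nonneg)
    have Bm: "?B \<in> sets borel" by simp
    \<comment> \<open>\<open>\<Psi>\<close> preserves horizontal lines and their order, so each
      slice of the image is an interval whose length is an increment of \<open>F\<close>.\<close>
    have im: "\<Psi> ` ?B = {q. snd q \<in> {c..d} \<and> F a (snd q) \<le> fst q \<and> fst q \<le> F b (snd q)}" (is "_ = ?S")
    proof (rule set_eqI)
      fix q
      obtain x y where xy: "\<Phi> q = (x, y)" by fastforce
      then have "q = \<Psi> (x, y)" using \<Psi>\<Phi>(1) by metis
      then have q: "q = (F x y, y)" by (simp add: \<Psi>_def)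
      have "q \<in> \<Psi> ` ?B \<longleftrightarrow> (x, y) \<in> ?B" unfolding vimage[symmetric] by (simp add: xy)
      also have "\<dots> \<longleftrightarrow> q \<in> ?S" by (auto simp: q cbox_Pair_eq F_mono)
      finally show "q \<in> \<Psi> ` ?B \<longleftrightarrow> q \<in> ?S" .
    qed
    have Sm: "\<Psi> ` ?B \<in> sets (lborel \<Otimes>\<^sub>M lborel)"
      unfolding lborel_prod using measurable_sets[OF \<open>\<Phi> \<in> borel_measurable borel\<close> Bm]
      by (simp add: vimage)
    have "(\<integral>\<^sup>+p. \<rho> p * indicator ?B p \<partial>lborel) = emeasure \<mu> ?B"
      unfolding dens[symmetric] by (rule emeasure_density[symmetric]) auto
    also have "\<dots> = emeasure (lborel \<Otimes>\<^sub>M lborel) (\<Psi> ` ?B)" unfolding em[OF Bm] lborel_prod ..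
    also have "\<dots> = (\<integral>\<^sup>+y. emeasure lborel ((\<lambda>x. (x, y)) -` (\<Psi> ` ?B)) \<partial>lborel)"
      by (rule lborel_pair.emeasure_pair_measure_alt2[OF Sm])
    also have "\<dots> = (\<integral>\<^sup>+y. indicator {c..d} y * ennreal (F b y - F a y) \<partial>lborel)"
    proof (rule nn_integral_cong)
      fix y
      have "(\<lambda>x. (x, y)) -` (\<Psi> ` ?B) = (if y \<in> {c..d} then {F a y..F b y} else {})"
        unfolding im by auto
      then show "emeasure lborel ((\<lambda>x. (x, y)) -` (\<Psi> ` ?B)) = indicator {c..d} y * ennreal (F b y - F a y)"
        using nonneg[of y] by (auto simp: indicator_def)
    qed
    also have "\<dots> = (\<integral>\<^sup>+y. ennreal (indicator {c..d} y * (F b y - F a y)) \<partial>lborel)"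
      by (intro nn_integral_cong) (auto simp: indicator_def)
    also have "\<dots> = ennreal I" by (rule nn_integral_has_integral_lebesgue[OF nonneg hI])
    finally have nn: "(\<integral>\<^sup>+p. \<rho> p * indicator ?B p \<partial>lborel) = ennreal I" .
    have "AE p in lborel. \<rho> p * indicator ?B p \<noteq> \<infinity>"
      by (rule nn_integral_PInf_AE) (use nn in auto)
    then have "(\<integral>\<^sup>+p. ennreal (r p * indicator ?B p) \<partial>lborel) = (\<integral>\<^sup>+p. \<rho> p * indicator ?B p \<partial>lborel)"
      by (intro nn_integral_cong_AE, elim AE_mp)
        (auto simp: r_def indicator_def less_top[symmetric] ennreal_enn2real)
    then have "((\<lambda>p. r p * indicator ?B p) has_integral I) UNIV"
      using nn r0 I0 by (intro nn_integral_has_integral) auto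
    moreover have "(\<lambda>p. r p * indicator ?B p) = (\<lambda>p. if p \<in> ?B then r p else 0)" by (auto simp: indicator_def)
    ultimately have "((\<lambda>p. if p \<in> ?B then r p else 0) has_integral I) UNIV" by simp
    then show ?thesis unfolding I_def by (simp only: has_integral_restrict_UNIV)
  qed
  have abs_r: "r absolutely_integrable_on cbox u v" for u v
  proof (cases "cbox u v = {}")
    case False
    obtain a c b d where uv: "u = (a, c)" "v = (b, d)" by (cases u, cases v)
    have "a \<le> b" "c \<le> d" using False by (auto simp: uv cbox_Pair_eq)
    then have "r integrable_on cbox u v" using int_r unfolding uv by blast
    then show ?thesis using r0 by (intro nonnegative_absolutely_integrable_1) auto
  qed simp
  show ?thesis
  \<comment> \<open>Subtracting the slope \<open>M + 1\<close> of the added coordinate returns from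
    \<open>F\<close> to \<open>f\<close>.\<close>
  proof (intro exI[of _ "\<lambda>p. r p - (M + 1)"] conjI allI impI)
    fix a b c d :: real assume ab: "a \<le> b" "c \<le> d"
    have "((\<lambda>p. M + 1) has_integral (M + 1) * ((b - a) * (d - c))) (cbox (a, c) (b, d))"
      using has_integral_const[of "M + 1" "(a, c)" "(b, d)"] ab by (simp add: content_Pair mult.commute)
    from has_integral_diff[OF int_r[OF ab] this]
    have "((\<lambda>p. r p - (M + 1)) has_integral integral {c..d} (\<lambda>y. F b y - F a y) - (M + 1) * ((b - a) * (d - c)))
      (cbox (a, c) (b, d))" .
    moreover have "integral {c..d} (\<lambda>y. F b y - F a y) =
        integral {c..d} (\<lambda>y. f (b, y) - f (a, y)) + integral {c..d} (\<lambda>y. (M + 1) * (b - a))"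
    proof -
      have eq: "(\<lambda>y. F b y - F a y) = (\<lambda>y. (f (b, y) - f (a, y)) + (M + 1) * (b - a))"
        by (simp add: F_def fun_eq_iff algebra_simps)
      have "(\<lambda>y. f (b, y) - f (a, y)) integrable_on {c..d}"
        by (intro integrable_continuous_real continuous_intros continuous_on_compose2[OF cf]; simp)
      then show ?thesis unfolding eq by (rule integral_add[OF _ integrable_const_ivl])
    qed
    ultimately show "((\<lambda>p. r p - (M + 1)) has_integral integral {c..d} (\<lambda>y. f (b, y) - f (a, y))) (cbox (a, c) (b, d))"
      using ab by (simp add: algebra_simps)
  next
    fix u v q
    have "(\<lambda>p. r p - (M + 1 + q)) absolutely_integrable_on cbox u v"
      by (intro set_integral_diff abs_r) auto
    from absolutely_integrable_norm[OF this]
    show "(\<lambda>p. \<bar>r p - (M + 1) - q\<bar>) integrable_on cbox u v"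
      by (simp add: o_def absolutely_integrable_on_def algebra_simps)
  qed
qed

text \<open>Integrals over rectangles replace test functions, since increments over rectangles are
  all that is used. Integrability of the deviation from every constant prepares the Lebesgue point
  argument.\<close>

definition weak_gradient :: "(real \<times> real \<Rightarrow> real) \<Rightarrow> (real \<times> real \<Rightarrow> real) \<Rightarrow> (real \<times> real \<Rightarrow> real) \<Rightarrow> bool" where
  "weak_gradient f G1 G2 \<longleftrightarrow>
    (\<forall>a b c d. a \<le> b \<longrightarrow> c \<le> d \<longrightarrow>
      (G1 has_integral integral {c..d} (\<lambda>y. f (b, y) - f (a, y))) (cbox (a, c) (b, d)) \<and>
      (G2 has_integral integral {a..b} (\<lambda>x. f (x, d) - f (x, c))) (cbox (a, c) (b, d))) \<and>
    (\<forall>u v q. (\<lambda>p. \<bar>G1 p - q\<bar>) integrable_on cbox u v \<and> (\<lambda>p. \<bar>G2 p - q\<bar>) integrable_on cbox u v)"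

section \<open>Behaviour of weak gradients under swaps and reflections\<close>

lemma swap_cbox: "prod.swap ` cbox (a, c) (b, d) = cbox (c, a) (d, b)"
  by (auto simp: cbox_Pair_eq image_iff)

lemma has_integral_swap:
  fixes h :: "real \<times> real \<Rightarrow> real"
  assumes "(h has_integral i) (cbox (a, c) (b, d))"
  shows "((\<lambda>p. h (prod.swap p)) has_integral i) (cbox (c, a) (d, b))"
proof -
  have 1: "\<exists>w z. prod.swap ` cbox u v = cbox w z" for u v :: "real \<times> real"
    by (cases u, cases v) (metis swap_cbox)
  have 2: "measure lborel (prod.swap ` cbox u v) = 1 * measure lborel (cbox u v)" for u v :: "real \<times> real"
    by (cases u, cases v) (simp add: swap_cbox content_Pair)
  have 3: "continuous (at x) (prod.swap :: real \<times> real \<Rightarrow> _)" for x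
    unfolding prod.swap_def by (intro continuous_intros)
  have "((\<lambda>p. h (prod.swap p)) has_integral (1 / 1) *\<^sub>R i) (prod.swap ` cbox (a, c) (b, d))"
    by (rule has_integral_twiddle[OF _ _ _ 3 1 1 2 assms]) auto
  then show ?thesis by (simp add: swap_cbox)
qed

definition reflect_fst :: "real \<times> real \<Rightarrow> real \<times> real" where
  "reflect_fst p = (- fst p, snd p)"

lemma reflect_fst_cbox: "reflect_fst ` cbox (a, c) (b, d) = cbox (- b, c) (- a, d)"
proof -
  have "x \<in> reflect_fst ` cbox (a, c) (b, d)" if "x \<in> cbox (- b, c) (- a, d)" for x
    using that by (intro image_eqI[of _ _ "reflect_fst x"]) (auto simp: reflect_fst_def cbox_Pair_eq)
  then show ?thesis by (auto simp: reflect_fst_def cbox_Pair_eq)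
qed

lemma has_integral_reflect_fst:
  fixes h :: "real \<times> real \<Rightarrow> real"
  assumes "(h has_integral i) (cbox (a, c) (b, d))"
  shows "((\<lambda>p. h (reflect_fst p)) has_integral i) (cbox (- b, c) (- a, d))"
proof -
  have 1: "\<exists>w z. reflect_fst ` cbox u v = cbox w z" for u v
    by (cases u, cases v) (metis reflect_fst_cbox)
  have 2: "measure lborel (reflect_fst ` cbox u v) = 1 * measure lborel (cbox u v)" for u v
    by (cases u, cases v) (auto simp: reflect_fst_cbox content_Pair content_real_if)
  have 3: "continuous (at x) reflect_fst" for x
    unfolding reflect_fst_def by (intro continuous_intros)
  have "((\<lambda>p. h (reflect_fst p)) has_integral (1 / 1) *\<^sub>R i) (reflect_fst ` cbox (a, c) (b, d))"
    by (rule has_integral_twiddle[OF _ _ _ 3 1 1 2 assms]) (auto simp: reflect_fst_def)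
  then show ?thesis by (simp add: reflect_fst_cbox)
qed

text \<open>Swapping coordinates and reflecting the first one generate all sign changes, so
  differentiability need only be examined in the first quadrant.\<close>

lemma weak_gradient_swap:
  assumes "weak_gradient f G1 G2"
  shows "weak_gradient (\<lambda>p. f (prod.swap p)) (\<lambda>p. G2 (prod.swap p)) (\<lambda>p. G1 (prod.swap p))"
proof -
  have int: "(\<lambda>p. h (prod.swap p)) integrable_on cbox u v"
    if "\<And>u v. h integrable_on cbox u v" for h :: "real \<times> real \<Rightarrow> real" and u v
    using has_integral_swap that by (cases u, cases v) (meson integrable_on_def)
  show ?thesis
    using assms unfolding weak_gradient_def
    by (auto intro!: has_integral_swap int[where h = "\<lambda>p. \<bar>G2 p - q\<bar>" for q] int[where h = "\<lambda>p. \<bar>G1 p - q\<bar>" for q])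
qed

lemma weak_gradient_reflect:
  assumes "weak_gradient f G1 G2"
  shows "weak_gradient (\<lambda>p. f (reflect_fst p)) (\<lambda>p. - G1 (reflect_fst p)) (\<lambda>p. G2 (reflect_fst p))"
  unfolding weak_gradient_def
proof (intro conjI allI impI)
  fix a b c d :: real assume ab: "a \<le> b" "c \<le> d"
  have G: "(G1 has_integral integral {c..d} (\<lambda>y. f (- a, y) - f (- b, y))) (cbox (- b, c) (- a, d))"
    "(G2 has_integral integral {- b..- a} (\<lambda>x. f (x, d) - f (x, c))) (cbox (- b, c) (- a, d))"
    using assms ab unfolding weak_gradient_def by simp_all
  have "integral {c..d} (\<lambda>y. f (- b, y) - f (- a, y)) = - integral {c..d} (\<lambda>y. f (- a, y) - f (- b, y))"
    by (simp flip: integral_neg)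
  then show "((\<lambda>p. - G1 (reflect_fst p)) has_integral
      integral {c..d} (\<lambda>y. f (reflect_fst (b, y)) - f (reflect_fst (a, y)))) (cbox (a, c) (b, d))"
    using has_integral_neg[OF has_integral_reflect_fst[OF G(1)]] by (simp add: reflect_fst_def)
  have "integral {a..b} (\<lambda>x. f (- x, d) - f (- x, c)) = integral {- b..- a} (\<lambda>x. f (x, d) - f (x, c))"
    using Henstock_Kurzweil_Integration.integral_reflect_real[of "- a" "- b" "\<lambda>x. f (x, d) - f (x, c)"] by simp
  then show "((\<lambda>p. G2 (reflect_fst p)) has_integral
      integral {a..b} (\<lambda>x. f (reflect_fst (x, d)) - f (reflect_fst (x, c)))) (cbox (a, c) (b, d))"
    using has_integral_reflect_fst[OF G(2)] by (simp add: reflect_fst_def)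
next
  fix u v :: "real \<times> real" and q :: real
  have int: "(\<lambda>p. h (reflect_fst p)) integrable_on cbox u v"
    if h: "\<And>u v. h integrable_on cbox u v" for h :: "real \<times> real \<Rightarrow> real"
  proof -
    obtain a c b d where uv: "u = (a, c)" "v = (b, d)" by (cases u, cases v)
    obtain i where "(h has_integral i) (cbox (- b, c) (- a, d))"
      using h[of "(- b, c)" "(- a, d)"] unfolding integrable_on_def by blast
    from has_integral_reflect_fst[OF this] show ?thesis unfolding uv integrable_on_def by auto
  qed
  have "(\<lambda>p. \<bar>G1 (reflect_fst p) - (- q)\<bar>) integrable_on cbox u v"
    using assms unfolding weak_gradient_def by (intro int[where h = "\<lambda>p. \<bar>G1 p - - q\<bar>"]) blast
  moreover have "(\<lambda>p. \<bar>G1 (reflect_fst p) - (- q)\<bar>) = (\<lambda>p. \<bar>- G1 (reflect_fst p) - q\<bar>)"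
    by (auto simp: fun_eq_iff abs_if)
  ultimately show "(\<lambda>p. \<bar>- G1 (reflect_fst p) - q\<bar>) integrable_on cbox u v" by simp
  show "(\<lambda>p. \<bar>G2 (reflect_fst p) - q\<bar>) integrable_on cbox u v"
    using assms unfolding weak_gradient_def by (intro int[where h = "\<lambda>p. \<bar>G2 p - q\<bar>"]) blast
qed

lemma Lipschitz_weak_gradient:
  fixes f :: "real \<times> real \<Rightarrow> real"
  assumes L: "M-lipschitz_on UNIV f"
  shows "\<exists>G1 G2. weak_gradient f G1 G2"
proof -
  have L': "M-lipschitz_on UNIV (\<lambda>p. f (prod.swap p))"
  proof (rule lipschitz_onI)
    fix p q :: "real \<times> real"
    have "dist (prod.swap p) (prod.swap q) = dist p q"
      by (cases p, cases q) (simp add: dist_Pair_Pair add.commute)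
    then show "dist (f (prod.swap p)) (f (prod.swap q)) \<le> M * dist p q"
      using lipschitz_onD[OF L, of "prod.swap p" "prod.swap q"] by simp
  qed (rule lipschitz_on_nonneg[OF L])
  obtain G1 where "(\<forall>a b c d. a \<le> b \<longrightarrow> c \<le> d \<longrightarrow>
      (G1 has_integral integral {c..d} (\<lambda>y. f (b, y) - f (a, y))) (cbox (a, c) (b, d)))
    \<and> (\<forall>u v q. (\<lambda>p. \<bar>G1 p - q\<bar>) integrable_on cbox u v)"
    using Lipschitz_weak_partial[OF L] by (elim exE)
  note G1 = this[THEN conjunct1, rule_format] this[THEN conjunct2, rule_format]
  obtain G where "(\<forall>a b c d. a \<le> b \<longrightarrow> c \<le> d \<longrightarrow>
      (G has_integral integral {c..d} (\<lambda>y. f (prod.swap (b, y)) - f (prod.swap (a, y)))) (cbox (a, c) (b, d)))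
    \<and> (\<forall>u v q. (\<lambda>p. \<bar>G p - q\<bar>) integrable_on cbox u v)"
    using Lipschitz_weak_partial[OF L'] by (elim exE)
  note G = this[THEN conjunct1, rule_format, unfolded swap_simp] this[THEN conjunct2, rule_format]
  have "(\<lambda>p. \<bar>G (prod.swap p) - q\<bar>) integrable_on cbox u v" for u v q
  proof -
    obtain a c b d where uv: "u = (a, c)" "v = (b, d)" by (cases u, cases v)
    obtain i where "((\<lambda>p. \<bar>G p - q\<bar>) has_integral i) (cbox (c, a) (d, b))" using G(2) by (meson integrable_on_def)
    from has_integral_swap[OF this] show ?thesis unfolding uv integrable_on_def by auto
  qed
  then have "weak_gradient f G1 (\<lambda>p. G (prod.swap p))"
    unfolding weak_gradient_def using G1 has_integral_swap[OF G(1)] by blast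
  then show ?thesis by blast
qed

section \<open>Lebesgue points and differentiability almost everywhere\<close>

lemma rectangle_mean:
  fixes h :: "real \<times> real \<Rightarrow> real"
  assumes h: "(h has_integral i) (cbox (a, c) (b, d))" and ab: "a \<le> b" "c \<le> d"
    and int: "\<And>u v. (\<lambda>p. \<bar>h p - q\<bar>) integrable_on cbox u v" and sub: "cbox (a, c) (b, d) \<subseteq> cbox u v"
  shows "\<bar>i - q * ((b - a) * (d - c))\<bar> \<le> integral (cbox u v) (\<lambda>p. \<bar>h p - q\<bar>)"
proof -
  have "((\<lambda>p. q) has_integral q * ((b - a) * (d - c))) (cbox (a, c) (b, d))"
    using has_integral_const[of q "(a, c)" "(b, d)"] ab by (simp add: content_Pair mult.commute)
  from has_integral_diff[OF h this]
  have hq: "((\<lambda>p. h p - q) has_integral i - q * ((b - a) * (d - c))) (cbox (a, c) (b, d))" .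
  then have "\<bar>i - q * ((b - a) * (d - c))\<bar> = norm (integral (cbox (a, c) (b, d)) (\<lambda>p. h p - q))"
    by (simp add: integral_unique)
  also have "\<dots> \<le> integral (cbox (a, c) (b, d)) (\<lambda>p. \<bar>h p - q\<bar>)"
    using hq int by (intro integral_norm_bound_integral) auto
  also have "\<dots> \<le> integral (cbox u v) (\<lambda>p. \<bar>h p - q\<bar>)"
    using int sub by (intro integral_subset_le) auto
  finally show ?thesis .
qed

text \<open>Convergence of cube means is applied to the deviation from each rational number; the
  countably many exceptional sets have a null union, and \<open>h x\<close> is then approximated by
  a rational. The cubes have \<open>x\<close> as a corner, as suits the first quadrant.\<close>

lemma Lebesgue_points_corner:
  fixes h :: "real \<times> real \<Rightarrow> real"
  assumes int: "\<And>u v q. (\<lambda>p. \<bar>h p - q\<bar>) integrable_on cbox u v"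
  obtains N where "negligible N" "\<And>x e. x \<notin> N \<Longrightarrow> e > 0 \<Longrightarrow>
    \<exists>d>0. \<forall>r. 0 < r \<longrightarrow> r < d \<longrightarrow> integral (cbox x (x + r *\<^sub>R (1, 1))) (\<lambda>p. \<bar>h p - h x\<bar>) \<le> e * r\<^sup>2"
proof -
  have One: "(One :: real \<times> real) = (1, 1)" by (simp add: Basis_prod_def sum.union_disjoint sum.reindex inj_on_def)
  have "\<exists>N. negligible N \<and> (\<forall>x e. x \<notin> N \<longrightarrow> 0 < e \<longrightarrow> (\<exists>d>0. \<forall>r. 0 < r \<and> r < d \<longrightarrow>
      norm (integral (cbox x (x + r *\<^sub>R One)) (\<lambda>p. \<bar>h p - q\<bar>) /\<^sub>R r ^ DIM(real \<times> real) - \<bar>h x - q\<bar>) < e))" for q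
    by (rule integrable_ccontinuous_explicit[of "\<lambda>p. \<bar>h p - q\<bar>", OF int]) blast
  then obtain N where N: "\<And>q. negligible (N q)" "\<And>q x e. x \<notin> N q \<Longrightarrow> 0 < e \<Longrightarrow> \<exists>d>0. \<forall>r. 0 < r \<and> r < d \<longrightarrow>
      norm (integral (cbox x (x + r *\<^sub>R One)) (\<lambda>p. \<bar>h p - q\<bar>) /\<^sub>R r ^ DIM(real \<times> real) - \<bar>h x - q\<bar>) < e"
    by metis
  show thesis
  proof (rule that[of "\<Union>q\<in>\<rat>. N q"])
    show "negligible (\<Union>q\<in>\<rat>. N q)"
      using N(1) countable_rat by (intro negligible_countable_Union) auto
    fix x and e :: real assume x: "x \<notin> (\<Union>q\<in>\<rat>. N q)" and e: "e > 0"
    obtain q where q: "q \<in> \<rat>" "h x - e / 3 < q" "q < h x"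
      using Rats_dense_in_real[of "h x - e / 3" "h x"] e by auto
    then have hq: "\<bar>h x - q\<bar> \<le> e / 3" by simp
    obtain d where d: "d > 0" "\<And>r. 0 < r \<Longrightarrow> r < d \<Longrightarrow>
        norm (integral (cbox x (x + r *\<^sub>R One)) (\<lambda>p. \<bar>h p - q\<bar>) /\<^sub>R r ^ DIM(real \<times> real) - \<bar>h x - q\<bar>) < e / 3"
      using N(2)[of x q "e / 3"] x q e by auto
    show "\<exists>d>0. \<forall>r. 0 < r \<longrightarrow> r < d \<longrightarrow> integral (cbox x (x + r *\<^sub>R (1, 1))) (\<lambda>p. \<bar>h p - h x\<bar>) \<le> e * r\<^sup>2"
    proof (intro exI[of _ d] conjI allI impI)
      fix r :: real assume r: "0 < r" "r < d"
      let ?Q = "cbox x (x + r *\<^sub>R (1, 1))"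
      define J where "J = integral ?Q (\<lambda>p. \<bar>h p - q\<bar>)"
      have "\<bar>J / r\<^sup>2 - \<bar>h x - q\<bar>\<bar> < e / 3"
      proof -
        have "J /\<^sub>R r ^ DIM(real \<times> real) = J / r\<^sup>2" by (simp add: divide_inverse mult.commute power2_eq_square)
        then show ?thesis using d(2)[OF r] unfolding One J_def[symmetric] by simp
      qed
      then have "J / r\<^sup>2 \<le> 2 * e / 3" using hq by linarith
      then have J: "J \<le> 2 * e / 3 * r\<^sup>2" using r by (simp add: pos_divide_le_eq)
      have cont: "measure lborel ?Q = r\<^sup>2"
        using r by (cases x) (simp add: content_Pair power2_eq_square)
      have "integral ?Q (\<lambda>p. \<bar>h p - h x\<bar>) \<le> integral ?Q (\<lambda>p. \<bar>h p - q\<bar> + \<bar>h x - q\<bar>)"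
        using int by (intro integral_le integrable_add) auto
      also have "\<dots> = J + r\<^sup>2 * \<bar>h x - q\<bar>"
        unfolding J_def cont[symmetric] using int by (subst integral_add) auto
      also have "\<dots> \<le> 2 * e / 3 * r\<^sup>2 + r\<^sup>2 * (e / 3)" using J hq by (intro add_mono mult_left_mono) auto
      finally show "integral ?Q (\<lambda>p. \<bar>h p - h x\<bar>) \<le> e * r\<^sup>2" by (simp add: algebra_simps)
    qed (rule d(1))
  qed
qed

lemma mean_increment:
  fixes \<phi> :: "real \<Rightarrow> real"
  assumes "continuous_on {c..d} \<phi>" "c \<le> d" "y0 \<in> {c..d}" "\<And>y. y \<in> {c..d} \<Longrightarrow> \<bar>\<phi> y - \<phi> y0\<bar> \<le> K"
  shows "\<bar>integral {c..d} \<phi> - (d - c) * \<phi> y0\<bar> \<le> K * (d - c)"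
proof -
  have i: "\<phi> integrable_on {c..d}" using assms(1) by (rule integrable_continuous_real)
  have "integral {c..d} (\<lambda>y. \<phi> y - \<phi> y0) = integral {c..d} \<phi> - (d - c) * \<phi> y0"
    using i assms(2) by (subst integral_diff) auto
  moreover have "norm (integral {c..d} (\<lambda>y. \<phi> y - \<phi> y0)) \<le> K * (d - c)"
    using assms by (intro integral_bound) (auto intro!: continuous_intros)
  ultimately show ?thesis by simp
qed

text \<open>The increment of \<open>f\<close> along a side of length \<open>\<rho>\<close> differs by \<open>O(\<eta> \<rho>)\<close> from its mean over
  a parallel strip of width \<open>\<eta> \<rho>\<close>, and that mean is controlled by the Lebesgue point property.\<close>

lemma forward_differentiable_AE:
  fixes f :: "real \<times> real \<Rightarrow> real"
  assumes L: "M-lipschitz_on UNIV f" and W: "weak_gradient f G1 G2"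
  obtains N where "negligible N" "\<And>x e. x \<notin> N \<Longrightarrow> e > 0 \<Longrightarrow>
    \<exists>d>0. \<forall>z1 z2. 0 \<le> z1 \<longrightarrow> 0 \<le> z2 \<longrightarrow> norm (z1, z2) < d \<longrightarrow>
      \<bar>f (x + (z1, z2)) - f x - (G1 x * z1 + G2 x * z2)\<bar> \<le> e * norm (z1, z2)"
proof -
  have M: "0 \<le> M" using L by (rule lipschitz_on_nonneg)
  have fL: "\<bar>f p - f q\<bar> \<le> M * norm (p - q)" for p q
    using lipschitz_onD[OF L, of p q] by (simp add: dist_real_def dist_norm)
  have cf: "continuous_on UNIV f" by (rule lipschitz_on_continuous_on[OF L])
  have cf': "continuous_on U (\<lambda>y. f (x, y))" "continuous_on U (\<lambda>y. f (y, x))" for U x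
    by (intro continuous_on_compose2[OF cf] continuous_intros; simp)+
  have G1: "\<And>a b c d. a \<le> b \<Longrightarrow> c \<le> d \<Longrightarrow>
      (G1 has_integral integral {c..d} (\<lambda>y. f (b, y) - f (a, y))) (cbox (a, c) (b, d))"
    and G2: "\<And>a b c d. a \<le> b \<Longrightarrow> c \<le> d \<Longrightarrow>
      (G2 has_integral integral {a..b} (\<lambda>x. f (x, d) - f (x, c))) (cbox (a, c) (b, d))"
    and i1: "\<And>u v q. (\<lambda>p. \<bar>G1 p - q\<bar>) integrable_on cbox u v"
    and i2: "\<And>u v q. (\<lambda>p. \<bar>G2 p - q\<bar>) integrable_on cbox u v"
    using W unfolding weak_gradient_def by blast+
  obtain N1 where N1: "negligible N1" "\<And>x e. x \<notin> N1 \<Longrightarrow> e > 0 \<Longrightarrow>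
    \<exists>d>0. \<forall>r. 0 < r \<longrightarrow> r < d \<longrightarrow> integral (cbox x (x + r *\<^sub>R (1, 1))) (\<lambda>p. \<bar>G1 p - G1 x\<bar>) \<le> e * r\<^sup>2"
    using Lebesgue_points_corner[OF i1] by metis
  obtain N2 where N2: "negligible N2" "\<And>x e. x \<notin> N2 \<Longrightarrow> e > 0 \<Longrightarrow>
    \<exists>d>0. \<forall>r. 0 < r \<longrightarrow> r < d \<longrightarrow> integral (cbox x (x + r *\<^sub>R (1, 1))) (\<lambda>p. \<bar>G2 p - G2 x\<bar>) \<le> e * r\<^sup>2"
    using Lebesgue_points_corner[OF i2] by metis
  show thesis
  proof (rule that[of "N1 \<union> N2"])
    show "negligible (N1 \<union> N2)" using N1 N2 by simp
    fix x and e :: real assume x: "x \<notin> N1 \<union> N2" and e: "e > 0"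
    obtain x1 x2 where x12: "x = (x1, x2)" by (cases x)
    \<comment> \<open>The strip of relative width \<open>\<eta>\<close> contributes an error
      \<open>2 * M * \<eta> * \<rho>\<close>, at most a quarter of \<open>e * \<rho>\<close>, on
      each leg.\<close>
    define \<eta> where "\<eta> = min 1 (e / (8 * (M + 1)))"
    have \<eta>: "0 < \<eta>" "\<eta> \<le> 1" using e M by (auto simp: \<eta>_def)
    have "4 * M * \<eta> \<le> 4 * M * (e / (8 * (M + 1)))" using M by (intro mult_left_mono) (auto simp: \<eta>_def)
    also have "\<dots> \<le> e / 2" using M e by (simp add: field_simps)
    finally have \<eta>M: "4 * M * \<eta> \<le> e / 2" .
    \<comment> \<open>The square of side \<open>2 * \<rho>\<close> gives a deviation
      \<open>4 * \<kappa> * \<rho>\<^sup>2\<close>; divided by the width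
      \<open>\<eta> * \<rho>\<close> this is the other quarter of \<open>e * \<rho>\<close> on each
      leg.\<close>
    define \<kappa> where "\<kappa> = e * \<eta> / 16"
    have \<kappa>: "0 < \<kappa>" using e \<eta> by (simp add: \<kappa>_def)
    obtain d1 where d1: "d1 > 0" "\<And>r. 0 < r \<Longrightarrow> r < d1 \<Longrightarrow>
        integral (cbox x (x + r *\<^sub>R (1, 1))) (\<lambda>p. \<bar>G1 p - G1 x\<bar>) \<le> \<kappa> * r\<^sup>2"
      using N1(2)[of x \<kappa>] x \<kappa> by auto
    obtain d2 where d2: "d2 > 0" "\<And>r. 0 < r \<Longrightarrow> r < d2 \<Longrightarrow>
        integral (cbox x (x + r *\<^sub>R (1, 1))) (\<lambda>p. \<bar>G2 p - G2 x\<bar>) \<le> \<kappa> * r\<^sup>2"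
      using N2(2)[of x \<kappa>] x \<kappa> by auto
    show "\<exists>d>0. \<forall>z1 z2. 0 \<le> z1 \<longrightarrow> 0 \<le> z2 \<longrightarrow> norm (z1, z2) < d \<longrightarrow>
      \<bar>f (x + (z1, z2)) - f x - (G1 x * z1 + G2 x * z2)\<bar> \<le> e * norm (z1, z2)"
    proof (intro exI[of _ "min d1 d2 / 2"] conjI allI impI)
      show "0 < min d1 d2 / 2" using d1 d2 by simp
      fix z1 z2 :: real assume z: "0 \<le> z1" "0 \<le> z2" "norm (z1, z2) < min d1 d2 / 2"
      define \<rho> where "\<rho> = norm (z1, z2)"
      show "\<bar>f (x + (z1, z2)) - f x - (G1 x * z1 + G2 x * z2)\<bar> \<le> e * norm (z1, z2)"
      proof (cases "\<rho> = 0")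
        case True
        then have "z1 = 0" "z2 = 0" by (auto simp: \<rho>_def norm_Pair)
        then show ?thesis by (simp flip: zero_prod_def)
      next
        case False
        then have \<rho>: "\<rho> > 0" "2 * \<rho> < d1" "2 * \<rho> < d2" using z by (auto simp: \<rho>_def)
        have z\<rho>: "z1 \<le> \<rho>" "z2 \<le> \<rho>"
          using norm_fst_le[of z1 z2] norm_snd_le[of z2 z1] z by (auto simp: \<rho>_def)
        define \<delta> where "\<delta> = \<eta> * \<rho>"
        have \<delta>: "0 < \<delta>" "\<delta> \<le> \<rho>" using \<eta> \<rho> by (auto simp: \<delta>_def mult_le_cancel_right1)
        \<comment> \<open>Both strips fit into this square: the sides are at most
          \<open>\<rho>\<close> and so is the width \<open>\<delta>\<close>.\<close>
        let ?Q = "cbox x (x + (2 * \<rho>) *\<^sub>R (1, 1))"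
        have Q: "?Q = cbox (x1, x2) (x1 + 2 * \<rho>, x2 + 2 * \<rho>)" by (simp add: x12)
        have K: "integral ?Q (\<lambda>p. \<bar>G1 p - G1 x\<bar>) \<le> 4 * \<kappa> * \<rho>\<^sup>2" "integral ?Q (\<lambda>p. \<bar>G2 p - G2 x\<bar>) \<le> 4 * \<kappa> * \<rho>\<^sup>2"
          using d1(2)[of "2 * \<rho>"] d2(2)[of "2 * \<rho>"] \<rho> by (auto simp: power_mult_distrib)
        have leg: "\<bar>D - \<gamma> * z\<bar> \<le> e / 2 * \<rho>"
          if "\<bar>I - \<gamma> * (z * \<delta>)\<bar> \<le> 4 * \<kappa> * \<rho>\<^sup>2" "\<bar>I - \<delta> * D\<bar> \<le> 2 * M * \<delta> * \<delta>" for I D \<gamma> z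
        proof -
          have "\<delta> * (D - \<gamma> * z) = \<delta> * D - \<gamma> * (z * \<delta>)" by (simp add: algebra_simps)
          then have "\<bar>\<delta> * (D - \<gamma> * z)\<bar> \<le> 4 * \<kappa> * \<rho>\<^sup>2 + 2 * M * \<delta> * \<delta>" using that by linarith
          also have "\<dots> = \<delta> * (e / 4 * \<rho> + (2 * M * \<eta>) * \<rho>)"
            by (simp add: \<kappa>_def \<delta>_def power2_eq_square algebra_simps)
          also have "\<dots> \<le> \<delta> * (e / 4 * \<rho> + e / 4 * \<rho>)"
            using \<eta>M \<delta> \<rho> by (intro mult_left_mono add_mono mult_right_mono) auto
          also have "\<dots> = \<delta> * (e / 2 * \<rho>)" by (simp add: algebra_simps)
          finally have "\<delta> * \<bar>D - \<gamma> * z\<bar> \<le> \<delta> * (e / 2 * \<rho>)" using \<delta> by (simp only: abs_mult abs_of_pos)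
          then show ?thesis using \<delta>(1) by (simp only: mult_le_cancel_left_pos)
        qed
        have 1: "\<bar>(f (x1 + z1, x2) - f (x1, x2)) - G1 x * z1\<bar> \<le> e / 2 * \<rho>"
        proof (rule leg)
          let ?\<phi> = "\<lambda>y. f (x1 + z1, y) - f (x1, y)"
          have "(G1 has_integral integral {x2..x2 + \<delta>} ?\<phi>) (cbox (x1, x2) (x1 + z1, x2 + \<delta>))"
            using z \<delta> by (intro G1) auto
          moreover have "cbox (x1, x2) (x1 + z1, x2 + \<delta>) \<subseteq> ?Q"
            unfolding Q using z z\<rho> \<delta> \<rho> by (auto simp: cbox_Pair_eq)
          ultimately have "\<bar>integral {x2..x2 + \<delta>} ?\<phi> - G1 x * ((x1 + z1 - x1) * (x2 + \<delta> - x2))\<bar>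
              \<le> integral ?Q (\<lambda>p. \<bar>G1 p - G1 x\<bar>)"
            using z \<delta> by (intro rectangle_mean i1) auto
          then show "\<bar>integral {x2..x2 + \<delta>} ?\<phi> - G1 x * (z1 * \<delta>)\<bar> \<le> 4 * \<kappa> * \<rho>\<^sup>2" using K(1) by simp
          have "\<bar>?\<phi> y - ?\<phi> x2\<bar> \<le> 2 * M * \<delta>" if "y \<in> {x2..x2 + \<delta>}" for y
          proof -
            have "M * (y - x2) \<le> M * \<delta>" using that M by (intro mult_left_mono) auto
            then show ?thesis
              using fL[of "(x1 + z1, y)" "(x1 + z1, x2)"] fL[of "(x1, y)" "(x1, x2)"] that by (simp add: norm_Pair)
          qed
          then have "\<bar>integral {x2..x2 + \<delta>} ?\<phi> - (x2 + \<delta> - x2) * ?\<phi> x2\<bar> \<le> 2 * M * \<delta> * (x2 + \<delta> - x2)"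
            using \<delta> by (intro mean_increment continuous_intros cf') auto
          then show "\<bar>integral {x2..x2 + \<delta>} ?\<phi> - \<delta> * ?\<phi> x2\<bar> \<le> 2 * M * \<delta> * \<delta>" by simp
        qed
        have 2: "\<bar>(f (x1 + z1, x2 + z2) - f (x1 + z1, x2)) - G2 x * z2\<bar> \<le> e / 2 * \<rho>"
        proof (rule leg)
          let ?\<phi> = "\<lambda>y. f (y, x2 + z2) - f (y, x2)"
          have "(G2 has_integral integral {x1 + z1..x1 + z1 + \<delta>} ?\<phi>) (cbox (x1 + z1, x2) (x1 + z1 + \<delta>, x2 + z2))"
            using z \<delta> by (intro G2) auto
          moreover have "cbox (x1 + z1, x2) (x1 + z1 + \<delta>, x2 + z2) \<subseteq> ?Q"
            unfolding Q using z z\<rho> \<delta> \<rho> by (auto simp: cbox_Pair_eq)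
          ultimately have "\<bar>integral {x1 + z1..x1 + z1 + \<delta>} ?\<phi>
                - G2 x * ((x1 + z1 + \<delta> - (x1 + z1)) * (x2 + z2 - x2))\<bar> \<le> integral ?Q (\<lambda>p. \<bar>G2 p - G2 x\<bar>)"
            using z \<delta> by (intro rectangle_mean i2) auto
          then show "\<bar>integral {x1 + z1..x1 + z1 + \<delta>} ?\<phi> - G2 x * (z2 * \<delta>)\<bar> \<le> 4 * \<kappa> * \<rho>\<^sup>2"
            using K(2) by (simp add: mult.commute)
          have "\<bar>?\<phi> y - ?\<phi> (x1 + z1)\<bar> \<le> 2 * M * \<delta>" if "y \<in> {x1 + z1..x1 + z1 + \<delta>}" for y
          proof -
            have "M * (y - (x1 + z1)) \<le> M * \<delta>" using that M by (intro mult_left_mono) auto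
            then show ?thesis
              using fL[of "(y, x2 + z2)" "(x1 + z1, x2 + z2)"] fL[of "(y, x2)" "(x1 + z1, x2)"] that
              by (simp add: norm_Pair)
          qed
          then have "\<bar>integral {x1 + z1..x1 + z1 + \<delta>} ?\<phi> - (x1 + z1 + \<delta> - (x1 + z1)) * ?\<phi> (x1 + z1)\<bar> \<le> 2 * M * \<delta> * (x1 + z1 + \<delta> - (x1 + z1))"
            using \<delta> by (intro mean_increment continuous_intros cf') auto
          then show "\<bar>integral {x1 + z1..x1 + z1 + \<delta>} ?\<phi> - \<delta> * ?\<phi> (x1 + z1)\<bar> \<le> 2 * M * \<delta> * \<delta>" by simp
        qed
        have "\<bar>f (x + (z1, z2)) - f x - (G1 x * z1 + G2 x * z2)\<bar> \<le> e / 2 * \<rho> + e / 2 * \<rho>"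
        proof -
          have "f (x + (z1, z2)) = f (x1 + z1, x2 + z2)" "f x = f (x1, x2)" by (simp_all add: x12)
          then show ?thesis using 1 2 by linarith
        qed
        then show ?thesis by (simp add: \<rho>_def)
      qed
    qed
  qed
qed

text \<open>The four coordinate sign changes are isometries that carry each quadrant to the first.
  Outside the union of four null sets the one-sided expansions agree on the same linear map.\<close>

lemma Lipschitz_differentiable_AE:
  fixes f :: "real \<times> real \<Rightarrow> real"
  assumes L: "M-lipschitz_on UNIV f" and W: "weak_gradient f G1 G2"
  obtains N where "negligible N"
    "\<And>x. x \<notin> N \<Longrightarrow> (f has_derivative (\<lambda>z. G1 x * fst z + G2 x * snd z)) (at x)"
proof -
  define quad where "quad = (\<lambda>s t N. negligible N \<and> (\<forall>x e. x \<notin> N \<longrightarrow> e > 0 \<longrightarrow>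
    (\<exists>d>0. \<forall>z1 z2. 0 \<le> z1 \<longrightarrow> 0 \<le> z2 \<longrightarrow> norm (z1, z2) < d \<longrightarrow>
      \<bar>f (x + (s * z1, t * z2)) - f x - (G1 x * (s * z1) + G2 x * (t * z2))\<bar> \<le> e * norm (z1, z2))))"
  have quadrant: "\<exists>N. quad s t N"
    if T: "T = (\<lambda>p. (s * fst p, t * snd p))" and st: "s * s = 1" "t * t = 1"
      and W': "weak_gradient (\<lambda>p. f (T p)) (\<lambda>p. s * G1 (T p)) (\<lambda>p. t * G2 (T p))" for s t :: real and T
  proof -
    have st': "\<bar>s\<bar> = 1" "\<bar>t\<bar> = 1" using st by (auto simp: square_eq_1_iff)
    have sst: "s * (s * a) = a" "t * (t * a) = a" for a using st by (simp_all flip: mult.assoc)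
    have TT: "T (T p) = p" for p by (cases p) (simp add: T sst)
    have linT: "linear T" by (rule linearI) (auto simp: T algebra_simps)
    have nT: "norm (T p) = norm p" for p
      by (cases p) (simp add: T norm_Pair abs_mult st' power_mult_distrib power2_eq_square st)
    have "M-lipschitz_on UNIV (\<lambda>p. f (T p))"
    proof (rule lipschitz_onI)
      fix p q
      have "dist (T p) (T q) = dist p q" using nT[of "p - q"] by (simp add: dist_norm linear_diff[OF linT])
      then show "dist (f (T p)) (f (T q)) \<le> M * dist p q" using lipschitz_onD[OF L, of "T p" "T q"] by simp
    qed (rule lipschitz_on_nonneg[OF L])
    from forward_differentiable_AE[OF this W'] obtain N where N: "negligible N" "\<And>x e. x \<notin> N \<Longrightarrow> e > 0 \<Longrightarrow>
      \<exists>d>0. \<forall>z1 z2. 0 \<le> z1 \<longrightarrow> 0 \<le> z2 \<longrightarrow> norm (z1, z2) < d \<longrightarrow>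
        \<bar>f (T (x + (z1, z2))) - f (T x) - (s * G1 (T x) * z1 + t * G2 (T x) * z2)\<bar> \<le> e * norm (z1, z2)"
      by metis
    have "negligible (T ` N)"
    proof (rule negligible_locally_Lipschitz_image[OF _ N(1)])
      fix x show "\<exists>U B. open U \<and> x \<in> U \<and> (\<forall>y\<in>N \<inter> U. norm (T y - T x) \<le> B * norm (y - x))"
        using nT by (intro exI[of _ UNIV] exI[of _ 1]) (simp flip: linear_diff[OF linT])
    qed simp
    moreover have "\<exists>d>0. \<forall>z1 z2. 0 \<le> z1 \<longrightarrow> 0 \<le> z2 \<longrightarrow> norm (z1, z2) < d \<longrightarrow>
      \<bar>f (x + (s * z1, t * z2)) - f x - (G1 x * (s * z1) + G2 x * (t * z2))\<bar> \<le> e * norm (z1, z2)"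
      if x: "x \<notin> T ` N" and e: "e > 0" for x e
    proof -
      have "T x \<notin> N" using x TT by (metis image_eqI)
      from N(2)[OF this e] obtain d where d: "d > 0" "\<And>z1 z2. 0 \<le> z1 \<Longrightarrow> 0 \<le> z2 \<Longrightarrow> norm (z1, z2) < d \<Longrightarrow>
        \<bar>f (T (T x + (z1, z2))) - f x - (s * G1 x * z1 + t * G2 x * z2)\<bar> \<le> e * norm (z1, z2)"
        unfolding TT by blast
      have "T (T x + (z1, z2)) = x + (s * z1, t * z2)" for z1 z2
        using linear_add[OF linT, of "T x" "(z1, z2)"] by (simp add: TT) (simp add: T)
      with d show ?thesis by (intro exI[of _ d]) (simp add: mult_ac)
    qed
    ultimately show ?thesis unfolding quad_def by blast
  qed
  have q1: "\<exists>N. quad 1 1 N" by (rule quadrant[of id]) (use W in \<open>auto simp: id_def\<close>)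
  have q2: "\<exists>N. quad (- 1) 1 N"
    by (rule quadrant[of reflect_fst]) (use weak_gradient_reflect[OF W] in \<open>auto simp: reflect_fst_def fun_eq_iff\<close>)
  have W3: "weak_gradient (\<lambda>p. f (fst p, - snd p)) (\<lambda>p. G1 (fst p, - snd p)) (\<lambda>p. - G2 (fst p, - snd p))"
    using weak_gradient_swap[OF weak_gradient_reflect[OF weak_gradient_swap[OF W]]]
    by (simp add: reflect_fst_def prod.swap_def)
  have q3: "\<exists>N. quad 1 (- 1) N"
    by (rule quadrant[of "\<lambda>p. (fst p, - snd p)"]) (use W3 in auto)
  have q4: "\<exists>N. quad (- 1) (- 1) N"
    by (rule quadrant[of "\<lambda>p. (- fst p, - snd p)"])
      (use weak_gradient_reflect[OF W3] in \<open>auto simp: reflect_fst_def\<close>)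
  obtain N1 N2 N3 N4 where N: "quad 1 1 N1" "quad (- 1) 1 N2" "quad 1 (- 1) N3" "quad (- 1) (- 1) N4"
    using q1 q2 q3 q4 by blast
  show thesis
  proof (rule that[of "N1 \<union> N2 \<union> (N3 \<union> N4)"])
    show "negligible (N1 \<union> N2 \<union> (N3 \<union> N4))" using N by (auto simp: quad_def)
    fix x assume x: "x \<notin> N1 \<union> N2 \<union> (N3 \<union> N4)"
    let ?D = "\<lambda>z. G1 x * fst z + G2 x * snd z"
    show "(f has_derivative ?D) (at x)"
      unfolding has_derivative_at_alt
    proof (intro conjI allI impI)
      show "bounded_linear ?D"
        by (intro bounded_linear_add bounded_linear_const_mult bounded_linear_fst bounded_linear_snd)
      fix e :: real assume e: "e > 0"
      have ex: "\<exists>d>0. \<forall>z1 z2. 0 \<le> z1 \<longrightarrow> 0 \<le> z2 \<longrightarrow> norm (z1, z2) < d \<longrightarrow>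
        \<bar>f (x + (s * z1, t * z2)) - f x - (G1 x * (s * z1) + G2 x * (t * z2))\<bar> \<le> e * norm (z1, z2)"
        if "quad s t N" "x \<notin> N" for s t N
        using that e unfolding quad_def by blast
      obtain d1 where d1: "d1 > 0" "\<And>z1 z2. 0 \<le> z1 \<Longrightarrow> 0 \<le> z2 \<Longrightarrow> norm (z1, z2) < d1 \<Longrightarrow>
        \<bar>f (x + (1 * z1, 1 * z2)) - f x - (G1 x * (1 * z1) + G2 x * (1 * z2))\<bar> \<le> e * norm (z1, z2)"
        using ex[OF N(1)] x by blast
      obtain d2 where d2: "d2 > 0" "\<And>z1 z2. 0 \<le> z1 \<Longrightarrow> 0 \<le> z2 \<Longrightarrow> norm (z1, z2) < d2 \<Longrightarrow>
        \<bar>f (x + (- 1 * z1, 1 * z2)) - f x - (G1 x * (- 1 * z1) + G2 x * (1 * z2))\<bar> \<le> e * norm (z1, z2)"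
        using ex[OF N(2)] x by blast
      obtain d3 where d3: "d3 > 0" "\<And>z1 z2. 0 \<le> z1 \<Longrightarrow> 0 \<le> z2 \<Longrightarrow> norm (z1, z2) < d3 \<Longrightarrow>
        \<bar>f (x + (1 * z1, - 1 * z2)) - f x - (G1 x * (1 * z1) + G2 x * (- 1 * z2))\<bar> \<le> e * norm (z1, z2)"
        using ex[OF N(3)] x by blast
      obtain d4 where d4: "d4 > 0" "\<And>z1 z2. 0 \<le> z1 \<Longrightarrow> 0 \<le> z2 \<Longrightarrow> norm (z1, z2) < d4 \<Longrightarrow>
        \<bar>f (x + (- 1 * z1, - 1 * z2)) - f x - (G1 x * (- 1 * z1) + G2 x * (- 1 * z2))\<bar> \<le> e * norm (z1, z2)"
        using ex[OF N(4)] x by blast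
      define d where "d = min (min d1 d2) (min d3 d4)"
      have main: "\<bar>f (x + (z1, z2)) - f x - (G1 x * z1 + G2 x * z2)\<bar> \<le> e * norm (z1, z2)"
        if z: "norm (z1, z2) < d" for z1 z2
      proof -
        have n: "norm (\<bar>z1\<bar>, \<bar>z2\<bar>) = norm (z1, z2)" by (simp add: norm_Pair)
        consider "0 \<le> z1" "0 \<le> z2" | "z1 \<le> 0" "0 \<le> z2" | "0 \<le> z1" "z2 \<le> 0" | "z1 \<le> 0" "z2 \<le> 0" by linarith
        then show ?thesis
        proof cases
          case 1 then show ?thesis using d1(2)[of z1 z2] z by (simp add: d_def)
        next
          case 2 then show ?thesis using d2(2)[of "- z1" z2] z n by (simp add: d_def)
        next
          case 3 then show ?thesis using d3(2)[of z1 "- z2"] z n by (simp add: d_def)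
        next
          case 4 then show ?thesis using d4(2)[of "- z1" "- z2"] z n by (simp add: d_def)
        qed
      qed
      show "\<exists>d>0. \<forall>y. norm (y - x) < d \<longrightarrow> norm (f y - f x - ?D (y - x)) \<le> e * norm (y - x)"
      proof (intro exI[of _ d] conjI allI impI)
        show "0 < d" using d1(1) d2(1) d3(1) d4(1) by (simp add: d_def)
        fix y assume y: "norm (y - x) < d"
        obtain z1 z2 where z: "y - x = (z1, z2)" by (cases "y - x")
        then have "y = x + (z1, z2)" by (simp add: algebra_simps)
        with main[of z1 z2] y show "norm (f y - f x - ?D (y - x)) \<le> e * norm (y - x)" by (simp add: z)
      qed
    qed
  qed
qed

text \<open>In orthonormal coordinates with first axis along \<open>y - x\<close>, the bound on the
  first partial derivative is integrated over a rectangle of height \<open>\<delta>\<close>; the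
  Lipschitz property recovers the increment on the segment as \<open>\<delta>\<close> tends to
  0.\<close>

lemma directional_gradient_bound:
  fixes g :: "real^2 \<Rightarrow> real"
  assumes L: "M-lipschitz_on UNIV g" and N0: "negligible N0" "\<And>x. x \<notin> N0 \<Longrightarrow> norm (gradient g x) \<le> L"
  shows "g y - g x \<le> L * norm (y - x)"
proof (cases "y = x")
  case False
  have M: "0 \<le> M" using L by (rule lipschitz_on_nonneg)
  define l where "l = norm (y - x)"
  have l: "l > 0" using False by (simp add: l_def)
  define u where "u = (1 / l) *\<^sub>R (y - x)"
  define u' :: "real^2" where "u' = vector [- u $ 2, u $ 1]"
  have nu: "norm u = 1" using l by (simp add: u_def l_def)
  then have "u \<bullet> u = 1" by (simp add: dot_square_norm)
  then have uu: "u $ 1 * u $ 1 + u $ 2 * u $ 2 = 1" by (simp add: inner_vec_def sum_2)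
  have ip: "u \<bullet> u = 1" "u' \<bullet> u = 0" "u \<bullet> u' = 0" "u' \<bullet> u' = 1"
    using uu by (simp_all add: inner_vec_def sum_2 u'_def)
  then have nu': "norm u' = 1" by (simp add: norm_eq_sqrt_inner)
  define T where "T = (\<lambda>p. x + (fst p *\<^sub>R u + snd p *\<^sub>R u'))"
  define S where "S = (\<lambda>q. ((q - x) \<bullet> u, (q - x) \<bullet> u'))"
  have ST: "S (T p) = p" for p
    by (cases p) (simp add: S_def T_def inner_add_left ip)
  have TS: "T (S q) = q" for q
  proof -
    define w where "w = q - x"
    have "(w \<bullet> u) *\<^sub>R u + (w \<bullet> u') *\<^sub>R u' = w"
    proof (simp add: vec_eq_iff forall_2 inner_vec_def sum_2 u'_def, intro conjI)
      have "(w $ 1 * u $ 1 + w $ 2 * u $ 2) * u $ 1 - (w $ 2 * u $ 1 - w $ 1 * u $ 2) * u $ 2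
          = w $ 1 * (u $ 1 * u $ 1 + u $ 2 * u $ 2)" by (simp add: algebra_simps)
      then show "(w $ 1 * u $ 1 + w $ 2 * u $ 2) * u $ 1 - (w $ 2 * u $ 1 - w $ 1 * u $ 2) * u $ 2 = w $ 1"
        using uu by simp
      have "(w $ 1 * u $ 1 + w $ 2 * u $ 2) * u $ 2 + (w $ 2 * u $ 1 - w $ 1 * u $ 2) * u $ 1
          = w $ 2 * (u $ 1 * u $ 1 + u $ 2 * u $ 2)" by (simp add: algebra_simps)
      then show "(w $ 1 * u $ 1 + w $ 2 * u $ 2) * u $ 2 + (w $ 2 * u $ 1 - w $ 1 * u $ 2) * u $ 1 = w $ 2"
        using uu by simp
    qed
    then show ?thesis by (simp add: T_def S_def w_def)
  qed
  define f where "f = (\<lambda>p. g (T p))"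
  have "(2 * M)-lipschitz_on UNIV f"
  proof (rule lipschitz_onI)
    fix p q :: "real \<times> real"
    obtain a b c d where pq: "p = (a, b)" "q = (c, d)" by (cases p, cases q)
    have "T p - T q = (a - c) *\<^sub>R u + (b - d) *\<^sub>R u'" by (simp add: T_def pq algebra_simps)
    then have "norm (T p - T q) \<le> \<bar>a - c\<bar> + \<bar>b - d\<bar>"
      using norm_triangle_ineq[of "(a - c) *\<^sub>R u" "(b - d) *\<^sub>R u'"] nu nu' by simp
    also have "\<dots> \<le> 2 * norm (p - q)"
      using norm_fst_le[of "a - c" "b - d"] norm_snd_le[of "b - d" "a - c"] by (simp add: pq)
    finally have "M * norm (T p - T q) \<le> M * (2 * norm (p - q))" using M by (rule mult_left_mono)
    then show "dist (f p) (f q) \<le> 2 * M * dist p q"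
      using lipschitz_onD[OF L, of "T p" "T q"] by (simp add: f_def dist_norm)
  qed (use M in simp)
  note fL = this
  obtain G1 G2 where W: "weak_gradient f G1 G2" using Lipschitz_weak_gradient[OF fL] by blast
  obtain N where N: "negligible N"
    "\<And>p. p \<notin> N \<Longrightarrow> (f has_derivative (\<lambda>z. G1 p * fst z + G2 p * snd z)) (at p)"
    using Lipschitz_differentiable_AE[OF fL W] by metis
  have "negligible (S ` N0)"
  proof (rule negligible_locally_Lipschitz_image[OF _ N0(1)])
    fix q
    have "norm (S q' - S q) \<le> 2 * norm (q' - q)" for q'
    proof -
      have "S q' - S q = ((q' - q) \<bullet> u, (q' - q) \<bullet> u')" by (simp add: S_def inner_diff_left)
      then have "norm (S q' - S q) \<le> \<bar>(q' - q) \<bullet> u\<bar> + \<bar>(q' - q) \<bullet> u'\<bar>" using norm_Pair_le by (metis real_norm_def)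
      then show ?thesis
        using Cauchy_Schwarz_ineq2[of "q' - q" u] Cauchy_Schwarz_ineq2[of "q' - q" u'] nu nu' by simp
    qed
    then show "\<exists>U B. open U \<and> q \<in> U \<and> (\<forall>q'\<in>N0 \<inter> U. norm (S q' - S q) \<le> B * norm (q' - q))"
      by (intro exI[of _ UNIV] exI[of _ 2]) simp
  qed simp
  then have neg: "negligible (N \<union> S ` N0)" using N(1) by simp
  \<comment> \<open>Off the exceptional set the density is the actual derivative of \<open>g\<close>
    in the unit direction \<open>u\<close>.\<close>
  have G1L: "G1 p \<le> L" if p: "p \<notin> N \<union> S ` N0" for p
  proof -
    have "T p \<notin> N0" using p ST by (metis UnCI image_eqI)
    then have gL: "norm (gradient g (T p)) \<le> L" by (rule N0(2))
    have "(f has_derivative (\<lambda>z. G1 p * fst z + G2 p * snd z)) (at (S (T p)))"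
      using N(2) p by (simp add: ST)
    moreover have "(S has_derivative (\<lambda>h. (h \<bullet> u, h \<bullet> u'))) (at (T p))"
      unfolding S_def by (auto intro!: derivative_eq_intros)
    ultimately have "((\<lambda>q. f (S q)) has_derivative (\<lambda>h. G1 p * fst (h \<bullet> u, h \<bullet> u') + G2 p * snd (h \<bullet> u, h \<bullet> u'))) (at (T p))"
      by (rule has_derivative_compose[rotated])
    then have d: "(g has_derivative (\<lambda>h. G1 p * (h \<bullet> u) + G2 p * (h \<bullet> u'))) (at (T p))"
      by (simp add: f_def TS)
    then have "(g has_derivative (\<lambda>h. h \<bullet> gradient g (T p))) (at (T p))"
      using GDERIV_exists[of g "T p"] unfolding gderiv_def differentiable_def by blast
    from has_derivative_unique[OF d this] have "G1 p = u \<bullet> gradient g (T p)" using ip by (auto dest: fun_cong[of _ _ u])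
    also have "\<dots> \<le> norm (gradient g (T p))" using norm_cauchy_schwarz[of u "gradient g (T p)"] nu by simp
    finally show ?thesis using gL by simp
  qed
  have "g y - g x \<le> L * l + 4 * M * \<delta>" if \<delta>: "\<delta> > 0" for \<delta>
  proof -
    let ?\<phi> = "\<lambda>t. f (l, t) - f (0, t)"
    let ?B = "cbox (0, 0) (l, \<delta>) :: (real \<times> real) set"
    have G1: "(G1 has_integral integral {0..\<delta>} ?\<phi>) ?B"
      using W l \<delta> unfolding weak_gradient_def by simp
    have "((\<lambda>p. if p \<in> N \<union> S ` N0 then L else G1 p) has_integral integral {0..\<delta>} ?\<phi>) ?B"
      by (rule has_integral_spike[OF neg _ G1]) auto
    moreover have "((\<lambda>p. L) has_integral L * (l * \<delta>)) ?B"
      using has_integral_const[of L "(0, 0)" "(l, \<delta>)"] l \<delta> by (simp add: content_Pair mult.commute)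
    ultimately have I: "integral {0..\<delta>} ?\<phi> \<le> L * (l * \<delta>)"
      by (rule has_integral_le) (use G1L in auto)
    \<comment> \<open>Each vertical side of the rectangle contributes
      \<open>2 * M * \<delta>\<close>, as \<open>2 * M\<close> is a Lipschitz constant of
      \<open>f\<close>.\<close>
    have "\<bar>integral {0..\<delta>} ?\<phi> - (\<delta> - 0) * ?\<phi> 0\<bar> \<le> (4 * M * \<delta>) * (\<delta> - 0)"
    proof (rule mean_increment)
      have cf: "continuous_on UNIV f" by (rule lipschitz_on_continuous_on[OF fL])
      show "continuous_on {0..\<delta>} ?\<phi>"
        by (intro continuous_intros continuous_on_compose2[OF cf]; simp)
      fix t assume t: "t \<in> {0..\<delta>}"
      have "\<bar>f (a, t) - f (a, 0)\<bar> \<le> 2 * M * \<delta>" for a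
      proof -
        have "\<bar>f (a, t) - f (a, 0)\<bar> \<le> 2 * M * t"
          using lipschitz_onD[OF fL, of "(a, t)" "(a, 0)"] t by (simp add: dist_real_def dist_Pair_Pair)
        also have "\<dots> \<le> 2 * M * \<delta>" using t M by (intro mult_left_mono) auto
        finally show ?thesis .
      qed
      from this[of l] this[of 0] show "\<bar>?\<phi> t - ?\<phi> 0\<bar> \<le> 4 * M * \<delta>" by linarith
    qed (use \<delta> in auto)
    then have "\<delta> * ?\<phi> 0 \<le> \<delta> * (L * l + 4 * M * \<delta>)" using I by (simp add: algebra_simps abs_le_iff)
    then have "?\<phi> 0 \<le> L * l + 4 * M * \<delta>" using \<delta> by simp
    moreover have "f (l, 0) = g y" "f (0, 0) = g x" using l by (simp_all add: f_def T_def u_def)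
    ultimately show ?thesis by simp
  qed
  note * = this
  have "g y - g x \<le> L * l"
  proof (rule field_le_epsilon)
    fix e :: real assume "e > 0"
    define \<delta> where "\<delta> = e / (4 * M + 1)"
    have "\<delta> > 0" "4 * M * \<delta> \<le> e" using \<open>e > 0\<close> M by (auto simp: \<delta>_def field_simps)
    with *[of \<delta>] show "g y - g x \<le> L * l + e" by linarith
  qed
  then show ?thesis by (simp add: l_def)
qed simp

lemma Linf_gradient_bound_imp_Lipschitz:
  fixes g :: "real^2 \<Rightarrow> real"
  assumes L: "M-lipschitz_on UNIV g" and inf: "Linf_norm_gradient g = ereal L"
  shows "L-lipschitz_on UNIV g"
proof -
  have "AE x in lebesgue. norm (gradient g x) \<le> L"
    using esssup_AE[of "\<lambda>x. ereal (norm (gradient g x))" lebesgue] inf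
    unfolding Linf_norm_gradient_def by simp
  then obtain N0 where "N0 \<in> null_sets lebesgue" and N0: "{x \<in> space lebesgue. \<not> norm (gradient g x) \<le> L} \<subseteq> N0"
    unfolding eventually_ae_filter by blast
  then have neg: "negligible N0" by (simp add: negligible_iff_null_sets)
  have bd: "norm (gradient g x) \<le> L" if "x \<notin> N0" for x using N0 that by auto
  \<comment> \<open>A point outside the null set is needed to see that \<open>L\<close> is
    nonnegative, as a Lipschitz constant must be.\<close>
  have "N0 \<noteq> UNIV" using neg by auto
  then obtain x0 where "x0 \<notin> N0" by blast
  then have "0 \<le> L" using bd[of x0] norm_ge_zero order_trans by blast
  moreover have "dist (g x) (g y) \<le> L * dist x y" for x y
    using directional_gradient_bound[OF L neg bd, of x y] directional_gradient_bound[OF L neg bd, of y x]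
    by (simp add: dist_real_def dist_norm norm_minus_commute abs_le_iff)
  ultimately show ?thesis by (intro lipschitz_onI)
qed

section \<open>The convergence rate\<close>

lemma lipschitz_on_rescale:
  fixes u :: "'a::real_normed_vector \<Rightarrow> real"
  assumes L: "L-lipschitz_on S u" and \<epsilon>: "\<epsilon> > 0" and S: "\<And>z. z \<in> T \<Longrightarrow> \<epsilon> *\<^sub>R z \<in> S"
  shows "L-lipschitz_on T (\<lambda>z. u (\<epsilon> *\<^sub>R z) / \<epsilon>)"
proof (rule lipschitz_onI)
  fix z z' assume z: "z \<in> T" "z' \<in> T"
  have "\<bar>u (\<epsilon> *\<^sub>R z) - u (\<epsilon> *\<^sub>R z')\<bar> \<le> L * norm (\<epsilon> *\<^sub>R (z - z'))"
    using lipschitz_onD[OF L S[OF z(1)] S[OF z(2)]] by (simp add: dist_real_def dist_norm scaleR_diff_right)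
  then have "\<bar>u (\<epsilon> *\<^sub>R z) - u (\<epsilon> *\<^sub>R z')\<bar> / \<epsilon> \<le> L * norm (z - z')"
    using \<epsilon> by (simp add: pos_divide_le_eq mult_ac)
  then show "dist (u (\<epsilon> *\<^sub>R z) / \<epsilon>) (u (\<epsilon> *\<^sub>R z') / \<epsilon>) \<le> L * dist z z'"
    using \<epsilon> by (simp add: dist_real_def dist_norm flip: diff_divide_distrib)
qed (rule lipschitz_on_nonneg[OF L])

text \<open>Scaling space, time and values by the same factor leaves all first derivatives
  unchanged. It removes \<open>\<epsilon>\<close> from the Hamiltonian, keeps the Lipschitz constant
  of the data, and turns a bound by a constant into one of order \<open>\<epsilon>\<close>.\<close>

lemma Cauchy_solution_rescale:
  assumes u: "Cauchy_solution K g u" and \<epsilon>: "\<epsilon> > 0"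
  shows "Cauchy_solution (\<lambda>x. K (\<epsilon> *\<^sub>R x)) (\<lambda>x. g (\<epsilon> *\<^sub>R x) / \<epsilon>) (\<lambda>z. u (\<epsilon> *\<^sub>R z) / \<epsilon>)"
proof -
  let ?\<Omega> = "UNIV \<times> {0<..} :: ((real^2) \<times> real) set"
  let ?w = "\<lambda>z. u (\<epsilon> *\<^sub>R z) / \<epsilon>"
  obtain L where L: "L-lipschitz_on (UNIV \<times> {0..}) u" and u0: "\<And>x. u (x, 0) = g x"
    and sol: "viscosity_solution (\<lambda>(x, t) (q, a). a + K x q) ?\<Omega> u"
    using u unfolding Cauchy_solution_def by blast
  have lip: "L-lipschitz_on (UNIV \<times> {0..}) ?w"
    by (rule lipschitz_on_rescale[OF L \<epsilon>]) (use \<epsilon> in \<open>auto simp: mem_Times_iff\<close>)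
  have contw: "continuous_on ?\<Omega> ?w"
  proof -
    have "continuous_on ?\<Omega> u" using sol by (simp add: viscosity_solution_def viscosity_subsolution_def)
    then have "continuous_on ?\<Omega> (\<lambda>z. u (\<epsilon> *\<^sub>R z))"
      by (rule continuous_on_compose2) (use \<epsilon> in \<open>auto simp: mem_Times_iff intro!: continuous_intros\<close>)
    then show ?thesis using \<epsilon> by (intro continuous_on_divide continuous_on_const) auto
  qed
  \<comment> \<open>A test function for the rescaled problem is pulled back to one for the original,
    with the same gradient at the corresponding point.\<close>
  have test: "C1_on ?\<Omega> (\<lambda>y. \<epsilon> * \<phi> (y /\<^sub>R \<epsilon>))"
      "gradient (\<lambda>y. \<epsilon> * \<phi> (y /\<^sub>R \<epsilon>)) (\<epsilon> *\<^sub>R z) = gradient \<phi> z"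
    if \<phi>: "C1_on ?\<Omega> \<phi>" and z: "z \<in> ?\<Omega>" for \<phi> z
  proof -
    have in\<Omega>: "y /\<^sub>R \<epsilon> \<in> ?\<Omega>" if "y \<in> ?\<Omega>" for y using that \<epsilon> by (auto simp: mem_Times_iff)
    have G: "GDERIV (\<lambda>y. \<epsilon> * \<phi> (y /\<^sub>R \<epsilon>)) y :> gradient \<phi> (y /\<^sub>R \<epsilon>)" if y: "y \<in> ?\<Omega>" for y
    proof -
      have "\<forall>z\<in>?\<Omega>. \<phi> differentiable (at z)" using \<phi> unfolding C1_on_def by (rule conjunct1)
      then have "\<phi> differentiable (at (y /\<^sub>R \<epsilon>))" by (rule bspec) (rule in\<Omega>[OF y])
      note GDERIV_exists[OF this, unfolded gderiv_def]
      moreover have "((\<lambda>y. y /\<^sub>R \<epsilon>) has_derivative (\<lambda>h. h /\<^sub>R \<epsilon>)) (at y)"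
        by (auto intro!: derivative_eq_intros)
      ultimately have "((\<lambda>y. \<phi> (y /\<^sub>R \<epsilon>)) has_derivative (\<lambda>h. (h /\<^sub>R \<epsilon>) \<bullet> gradient \<phi> (y /\<^sub>R \<epsilon>))) (at y)"
        by (rule has_derivative_compose[rotated])
      note has_derivative_mult_right[OF this, of \<epsilon>]
      moreover have "(\<lambda>h. \<epsilon> * ((h /\<^sub>R \<epsilon>) \<bullet> gradient \<phi> (y /\<^sub>R \<epsilon>))) = (\<lambda>h. h \<bullet> gradient \<phi> (y /\<^sub>R \<epsilon>))"
        using \<epsilon> by (simp add: fun_eq_iff mult.assoc[symmetric])
      ultimately show ?thesis unfolding gderiv_def by simp
    qed
    show "C1_on ?\<Omega> (\<lambda>y. \<epsilon> * \<phi> (y /\<^sub>R \<epsilon>))"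
    proof (rule C1_onI[OF G])
      have "continuous_on ?\<Omega> (gradient \<phi>)" using \<phi> by (simp add: C1_on_def)
      then show "continuous_on ?\<Omega> (\<lambda>y. gradient \<phi> (y /\<^sub>R \<epsilon>))"
        by (rule continuous_on_compose2) (use in\<Omega> in \<open>auto intro!: continuous_intros\<close>)
    qed
    have "\<epsilon> *\<^sub>R z \<in> ?\<Omega>" using z \<epsilon> by (auto simp: mem_Times_iff)
    from gradient_eqI[OF G[OF this]] show "gradient (\<lambda>y. \<epsilon> * \<phi> (y /\<^sub>R \<epsilon>)) (\<epsilon> *\<^sub>R z) = gradient \<phi> z"
      using \<epsilon> by simp
  qed
  have nhds: "\<forall>\<^sub>F y in nhds (\<epsilon> *\<^sub>R z). Q (y /\<^sub>R \<epsilon>)" if "\<forall>\<^sub>F z' in nhds z. Q z'" for Q and z :: "(real^2) \<times> real"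
  proof -
    have "((\<lambda>y. y /\<^sub>R \<epsilon>) \<longlongrightarrow> (\<epsilon> *\<^sub>R z) /\<^sub>R \<epsilon>) (nhds (\<epsilon> *\<^sub>R z))"
      by (intro tendsto_intros filterlim_ident)
    then show ?thesis using that \<epsilon> by (simp add: eventually_compose_filterlim)
  qed
  have sub: "viscosity_subsolution (\<lambda>(x, t) (q, a). a + K x q) ?\<Omega> u"
    and super: "viscosity_supersolution (\<lambda>(x, t) (q, a). a + K x q) ?\<Omega> u"
    using sol by (auto simp: viscosity_solution_def)
  have "viscosity_subsolution (\<lambda>(x, t) (q, a). a + K (\<epsilon> *\<^sub>R x) q) ?\<Omega> ?w"
    unfolding viscosity_subsolution_def
  proof (intro conjI allI ballI impI)
    fix \<phi> z
    assume z: "z \<in> ?\<Omega>" and *: "C1_on ?\<Omega> \<phi> \<and> (\<forall>\<^sub>F z' in nhds z. ?w z' - \<phi> z' \<le> ?w z - \<phi> z)"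
    from * have \<phi>: "C1_on ?\<Omega> \<phi>" and m: "\<forall>\<^sub>F z' in nhds z. ?w z' - \<phi> z' \<le> ?w z - \<phi> z"
      by (rule conjunct1, rule conjunct2)
    have "\<epsilon> *\<^sub>R z \<in> ?\<Omega>" using z \<epsilon> by (auto simp: mem_Times_iff)
    moreover have "\<forall>\<^sub>F y in nhds (\<epsilon> *\<^sub>R z). u y - \<epsilon> * \<phi> (y /\<^sub>R \<epsilon>) \<le> u (\<epsilon> *\<^sub>R z) - \<epsilon> * \<phi> ((\<epsilon> *\<^sub>R z) /\<^sub>R \<epsilon>)"
      using nhds[OF m]
    proof eventually_elim
      case (elim y)
      from mult_left_mono[OF elim less_imp_le[OF \<epsilon>]] show ?case
        using \<epsilon> by (simp add: right_diff_distrib)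
    qed
    ultimately have "(\<lambda>(x, t) (q, a). a + K x q) (\<epsilon> *\<^sub>R z) (gradient (\<lambda>y. \<epsilon> * \<phi> (y /\<^sub>R \<epsilon>)) (\<epsilon> *\<^sub>R z)) \<le> 0"
      by (rule viscosity_subsolution_test[OF sub test(1)[OF \<phi> z]])
    then show "(\<lambda>(x, t) (q, a). a + K (\<epsilon> *\<^sub>R x) q) z (gradient \<phi> z) \<le> 0"
      unfolding test(2)[OF \<phi> z] by (simp add: split_beta)
  qed (rule contw)
  moreover have "viscosity_supersolution (\<lambda>(x, t) (q, a). a + K (\<epsilon> *\<^sub>R x) q) ?\<Omega> ?w"
    unfolding viscosity_supersolution_def
  proof (intro conjI allI ballI impI)
    fix \<phi> z
    assume z: "z \<in> ?\<Omega>" and *: "C1_on ?\<Omega> \<phi> \<and> (\<forall>\<^sub>F z' in nhds z. ?w z' - \<phi> z' \<ge> ?w z - \<phi> z)"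
    from * have \<phi>: "C1_on ?\<Omega> \<phi>" and m: "\<forall>\<^sub>F z' in nhds z. ?w z' - \<phi> z' \<ge> ?w z - \<phi> z"
      by (rule conjunct1, rule conjunct2)
    have "\<epsilon> *\<^sub>R z \<in> ?\<Omega>" using z \<epsilon> by (auto simp: mem_Times_iff)
    moreover have "\<forall>\<^sub>F y in nhds (\<epsilon> *\<^sub>R z). u y - \<epsilon> * \<phi> (y /\<^sub>R \<epsilon>) \<ge> u (\<epsilon> *\<^sub>R z) - \<epsilon> * \<phi> ((\<epsilon> *\<^sub>R z) /\<^sub>R \<epsilon>)"
      using nhds[OF m]
    proof eventually_elim
      case (elim y)
      from mult_left_mono[OF elim less_imp_le[OF \<epsilon>]] show ?case
        using \<epsilon> by (simp add: right_diff_distrib)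
    qed
    ultimately have "(\<lambda>(x, t) (q, a). a + K x q) (\<epsilon> *\<^sub>R z) (gradient (\<lambda>y. \<epsilon> * \<phi> (y /\<^sub>R \<epsilon>)) (\<epsilon> *\<^sub>R z)) \<ge> 0"
      by (rule viscosity_supersolution_test[OF super test(1)[OF \<phi> z]])
    then show "(\<lambda>(x, t) (q, a). a + K (\<epsilon> *\<^sub>R x) q) z (gradient \<phi> z) \<ge> 0"
      unfolding test(2)[OF \<phi> z] by (simp add: split_beta)
  qed (rule contw)
  ultimately show ?thesis
    unfolding Cauchy_solution_def viscosity_solution_def using lip u0 by auto
qed

context homogeneous_Hamiltonian
begin

lemma value_functions_close:
  assumes A: "A > 0" and g: "L-lipschitz_on UNIV g" "\<And>y. \<bar>g y\<bar> \<le> B" "L \<le> lower_const * A"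
  shows "\<bar>value_function A k g (x, t) - Finsler_distance.value_function (\<lambda>x y. stable_norm (y - x)) A k g (x, t)\<bar>
    \<le> A * (16 * upper_const)"
proof -
  interpret stable: Finsler_distance "\<lambda>x y. stable_norm (y - x)" "\<lambda>_. stable_norm" "\<lambda>_. effective_gauge"
      lower_const upper_const
    by (rule stable_Finsler_distance)
  have C: "0 \<le> 16 * upper_const" using upper_const(1) by simp
  have d: "distance y x \<le> stable_norm (x - y) + 16 * upper_const"
    "stable_norm (x - y) \<le> distance y x + 16 * upper_const" for y
    using distance_stable_norm[of y x] by auto
  have "value_function A k g (x, t) - A * (16 * upper_const) \<le> stable.value_function A k g (x, t)"
  proof (rule stable.value_function_greatest[OF A k g])
    fix y show "value_function A k g (x, t) - A * (16 * upper_const)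
        \<le> g y + truncated_action A k t (stable_norm (x - y))"
      using value_function_le[OF A k g, of x t y] truncated_action_mono_Lipschitz[OF A k d(1)[of y] C, of t] by simp
  qed
  moreover have "stable.value_function A k g (x, t) - A * (16 * upper_const) \<le> value_function A k g (x, t)"
  proof (rule value_function_greatest[OF A k g])
    fix y show "stable.value_function A k g (x, t) - A * (16 * upper_const)
        \<le> g y + truncated_action A k t (distance y x)"
      using stable.value_function_le[OF A k g, of x t y] truncated_action_mono_Lipschitz[OF A k d(2)[of y] C, of t] by simp
  qed
  ultimately show ?thesis by linarith
qed

lemma homogenization_unit_scale:
  assumes A: "A > 0" and g: "L-lipschitz_on UNIV g" "\<And>y. \<bar>g y\<bar> \<le> B" "L \<le> lower_const * A"
    and w: "Cauchy_solution H g w" and w': "Cauchy_solution (\<lambda>_. effective_Hamiltonian H) g w'"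
    and t: "t \<ge> 0"
  shows "\<bar>w (x, t) - w' (x, t)\<bar> \<le> A * (16 * upper_const)"
proof -
  interpret stable: Finsler_distance "\<lambda>x y. stable_norm (y - x)" "\<lambda>_. stable_norm" "\<lambda>_. effective_gauge"
      lower_const upper_const
    by (rule stable_Finsler_distance)
  obtain M where "M-lipschitz_on (UNIV \<times> {0..}) w" "\<And>x. w (x, 0) = g x"
    "viscosity_solution (\<lambda>(x, t) (q, a). a + gauge x q powr k) (UNIV \<times> {0<..}) w"
    using w by (auto simp: Cauchy_solution_def gauge_powr)
  moreover have "uniformly_continuous_on (UNIV \<times> cball 0 R) (\<lambda>(x, p). gauge x p powr k)" for R
    unfolding gauge_powr by (rule periodic_uniformly_continuous[OF cont periodic])
  ultimately have "w (x, t) = value_function A k g (x, t)"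
    using Lipschitz_solution_eq_value_function[OF A k g] t by blast
  moreover obtain M' where "M'-lipschitz_on (UNIV \<times> {0..}) w'" "\<And>x. w' (x, 0) = g x"
    "viscosity_solution (\<lambda>(x, t) (q, a). a + effective_gauge q powr k) (UNIV \<times> {0<..}) w'"
    using w' by (auto simp: Cauchy_solution_def effective_Hamiltonian_eq)
  moreover have "uniformly_continuous_on (UNIV \<times> cball 0 R)
      (\<lambda>(x :: real^2, p). effective_gauge p powr k)" for R
  proof (rule periodic_uniformly_continuous)
    show "continuous_on UNIV (\<lambda>(y :: real^2, p). effective_gauge p powr k)"
      unfolding split_beta
      by (intro continuous_on_powr' continuous_on_compose2[OF effective_gauge_continuous[of UNIV]] continuous_intros)
        (use effective_gauge_nonneg k in auto)
  qed (simp add: Z2_periodic_def)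
  ultimately have "w' (x, t) = stable.value_function A k g (x, t)"
    using stable.Lipschitz_solution_eq_value_function[OF A k g] t by blast
  then show ?thesis
    using \<open>w (x, t) = value_function A k g (x, t)\<close> value_functions_close[OF A g, of x t] by simp
qed

lemma homogenization_rate:
  assumes A: "A > 0" and g: "L-lipschitz_on UNIV g" "bounded (range g)" "L \<le> lower_const * A"
    and \<epsilon>: "\<epsilon> > 0" and u\<epsilon>: "Cauchy_solution (\<lambda>x. H (x /\<^sub>R \<epsilon>)) g u\<^sub>\<epsilon>"
    and u: "Cauchy_solution (\<lambda>_. effective_Hamiltonian H) g u" and t: "t \<ge> 0"
  shows "\<bar>u\<^sub>\<epsilon> (x, t) - u (x, t)\<bar> \<le> A * (16 * upper_const) * \<epsilon>"
proof -
  let ?g = "\<lambda>x. g (\<epsilon> *\<^sub>R x) / \<epsilon>"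
  obtain B where B: "\<And>y. \<bar>g y\<bar> \<le> B" using g(2) by (auto simp: bounded_iff)
  have "L-lipschitz_on UNIV ?g"
    by (rule lipschitz_on_rescale[OF g(1) \<epsilon>]) simp
  moreover have "\<bar>?g y\<bar> \<le> B / \<epsilon>" for y using B[of "\<epsilon> *\<^sub>R y"] \<epsilon> by (simp add: divide_right_mono)
  moreover have "Cauchy_solution H ?g (\<lambda>z. u\<^sub>\<epsilon> (\<epsilon> *\<^sub>R z) / \<epsilon>)"
    using Cauchy_solution_rescale[OF u\<epsilon> \<epsilon>] \<epsilon> by simp
  moreover have "Cauchy_solution (\<lambda>_. effective_Hamiltonian H) ?g (\<lambda>z. u (\<epsilon> *\<^sub>R z) / \<epsilon>)"
    by (rule Cauchy_solution_rescale[OF u \<epsilon>])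
  moreover have "t / \<epsilon> \<ge> 0" using t \<epsilon> by simp
  ultimately have "\<bar>u\<^sub>\<epsilon> (\<epsilon> *\<^sub>R (x /\<^sub>R \<epsilon>, t / \<epsilon>)) / \<epsilon> - u (\<epsilon> *\<^sub>R (x /\<^sub>R \<epsilon>, t / \<epsilon>)) / \<epsilon>\<bar> \<le> A * (16 * upper_const)"
    using homogenization_unit_scale[OF A _ _ g(3)] by blast
  then have "\<bar>u\<^sub>\<epsilon> (x, t) - u (x, t)\<bar> / \<epsilon> \<le> A * (16 * upper_const)"
    using \<epsilon> by (simp flip: diff_divide_distrib)
  then show ?thesis using \<epsilon> by (simp add: field_simps)
qed

end

theorem theorem1p2:
  fixes H :: "real^2 \<Rightarrow> real^2 \<Rightarrow> real"
  assumes "continuous_on UNIV (\<lambda>(y, p). H y p)"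
    and "\<forall>p. Z2_periodic (\<lambda>y. H y p)"
    and "\<forall>M. \<exists>R. \<forall>y p. norm p \<ge> R \<longrightarrow> H y p \<ge> M"
    and "\<forall>y. convex_on UNIV (H y)"
    and "\<exists>k\<ge>1. \<forall>\<mu>\<ge>0. \<forall>y p. H y (\<mu> *\<^sub>R p) = \<mu> powr k * H y p"
  shows "\<forall>L::real. \<exists>C>0. \<forall>g. bounded (range g) \<and> (\<exists>M. M-lipschitz_on UNIV g) \<and>
             Linf_norm_gradient g = ereal L \<longrightarrow>
           (\<forall>\<epsilon>>0. \<forall>u\<^sub>\<epsilon> u.
              Cauchy_solution (\<lambda>x. H (x /\<^sub>R \<epsilon>)) g u\<^sub>\<epsilon> \<and>
              Cauchy_solution (\<lambda>x. effective_Hamiltonian H) g u \<longrightarrow>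
              (\<forall>x. \<forall>t\<ge>0. \<bar>u\<^sub>\<epsilon> (x, t) - u (x, t)\<bar> \<le> C * \<epsilon>))"
proof -
  obtain k where "k \<ge> 1" "\<And>\<mu> y p. \<mu> \<ge> 0 \<Longrightarrow> H y (\<mu> *\<^sub>R p) = \<mu> powr k * H y p"
    using assms(5) by blast
  then interpret homogeneous_Hamiltonian H k
    using assms by unfold_locales auto
  show ?thesis
  proof
    fix L :: real
    \<comment> \<open>The absolute value and the added 1 keep \<open>A\<close> positive for every
      real \<open>L\<close>. The bound \<open>L \<le> lower_const * A\<close> is the admissibility
      condition for the Hopf--Lax formula, and the choice involves only \<open>L\<close> and the
      Hamiltonian.\<close>
    define A where "A = (\<bar>L\<bar> + 1) / lower_const"
    have A: "A > 0" "L \<le> lower_const * A" using lower_const(1) by (auto simp: A_def)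
    have "A * (16 * upper_const) > 0" using A upper_const(1) by simp
    then show "\<exists>C>0. \<forall>g. bounded (range g) \<and> (\<exists>M. M-lipschitz_on UNIV g) \<and>
             Linf_norm_gradient g = ereal L \<longrightarrow>
           (\<forall>\<epsilon>>0. \<forall>u\<^sub>\<epsilon> u.
              Cauchy_solution (\<lambda>x. H (x /\<^sub>R \<epsilon>)) g u\<^sub>\<epsilon> \<and>
              Cauchy_solution (\<lambda>x. effective_Hamiltonian H) g u \<longrightarrow>
              (\<forall>x. \<forall>t\<ge>0. \<bar>u\<^sub>\<epsilon> (x, t) - u (x, t)\<bar> \<le> C * \<epsilon>))"
      using homogenization_rate[OF A(1) Linf_gradient_bound_imp_Lipschitz _ A(2)] by blast
  qed
qed

end
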